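(* Let $\mathcal T=(t_{ijk})_{i,j,k=1}^{I,J,K}=[\mathbf A,\mathbf B,\mathbf C]_R$ with $\mathbf A\in\mathbb R^{I\times R}$, $\mathbf B\in\mathbb R^{J\times R}$, $\mathbf C\in\mathbb R^{K\times R}$, $r_{\mathbf C}=K\le R$, $m=R-K+2$, and $l\ge0$ an integer. Assume that (i) $k_{\mathbf C}=K$; and (ii) $\mathbf A\odot\mathbf B$ has full column rank; and (iii) $\dim\left(\ker(\mathbf R_{m,l}(\mathcal T))\cap S^{m+l}(\mathbb R^{K^{m+l}})\right)=\binom{R}{K-1}$. Then $r_{\mathcal T}=R$, the CPD of $\mathcal T$ is unique and can be found algebraically.
   Context: All tensors and matrices are real; $r_{\mathbf X}$ is the rank of a matrix $\mathbf X$ and $\ker(\mathbf X)$ its null space. A matrix has full column rank if its columns are linearly independent. $k_{\mathbf X}$ (the $k$-rank) is the largest number such that every subset of $k_{\mathbf X}$ columns of $\mathbf X$ is linearly independent. $\mathbf A\odot\mathbf B=[\mathbf a_1\otimes\mathbf b_1\ \dots\ \mathbf a_R\otimes\mathbf b_R]$ is the Khatri–Rao (columnwise Kronecker) product. Decompositions. $\mathcal T=[\mathbf A,\mathbf B,\mathbf C]_R$ means $t_{ijk}=\sum_{r=1}^R a_{ir}b_{jr}c_{kr}$ for all $i,j,k$ (a polyadic decomposition, PD, with $R$ terms). The rank $r_{\mathcal T}$ is the minimal number of rank-one terms in a PD of $\mathcal T$; a PD with $r_{\mathcal T}$ terms is a canonical polyadic decomposition (CPD). The CPD of $\mathcal T$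 is unique if it is only subject to the trivial indeterminacies: the rank-one terms may be permuted, and vectors within the same rank-one term may be scaled provided the overall rank-one term remains the same. The matrix $\mathbf R_{m,l}(\mathcal T)$ ($m\ge1$, $l\ge0$) is the $I^{m+l}J^{m+l}\times K^{m+l}$ matrix whose $((\tilde i-1)J^{m+l}+\tilde j,\tilde k)$-th entry is $$\frac{1}{m!(m+l)!}\sum_{(s_1,\dots,s_{m+l})\in P_{\{k_1,\dots,k_{m+l}\}}}\det\left[t_{i_uj_vs_v}\right]_{u,v=1}^{m}\ \prod_{p=1}^{l}t_{i_{m+p}j_{m+p}s_{m+p}},$$ where $\tilde i=1+\sum_{p=1}^{m+l}(i_p-1)I^{m+l-p}$, $\tilde j=1+\sum_{p=1}^{m+l}(j_p-1)J^{m+l-p}$, $\tilde k=1+\sum_{p=1}^{m+l}(k_p-1)K^{m+l-p}$, with $i_p\in\{1,\dots,I\}$, $j_p\in\{1,\dots,J\}$, $k_p\in\{1,\dots,K\}$, and where $P_{\{k_1,\dots,k_n\}}$ is the set of all permutations of $\{k_1,\dots,k_n\}$, counted with multiplicity when some values coincide, so that it always has $n!$ elements. $S^{m+l}(\mathbb R^{K^{m+l}})\subset\mathbb R^{K^{m+l}}$ is the subspace spanned by all vectors $\mathbf x\otimes\cdots\otimes\mathbf x$ ($m+l$ factors, Kronecker product), $\mathbf x\in\mathbb R^K$. "Found algebraically" means: by an algorithm that recovers the CPD from $\mathcal T$ using only standard linear algebra, involving no procedures more advanced than the computation of the null space of a matrix (orthogonal complement of a subspace) and (generalized) eigenvalue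 / singular value decomposition.
   Formalization: The case K = 1 with R ≥ 2 is excluded: there T is a matrix, (i)–(iii) can hold (e.g. I = J = R = 2, A = B = identity, C = [1 1], l = 0), but a CPD with two or more terms is never unique; K ≥ 1 is also assumed. *)

theory Defs
  imports
    "Jordan_Normal_Form.DL_Rank"
    "Jordan_Normal_Form.Matrix_Kernel"
    "HOL-Combinatorics.Permutations"
begin

text \<open>
  All indices are 0-based. An \<open>I \<times> J \<times> K\<close> tensor is a function
  \<open>nat \<Rightarrow> nat \<Rightarrow> nat \<Rightarrow> real\<close> of which only the values at \<open>i < I\<close>, \<open>j < J\<close>, \<open>k < K\<close> are ever used.
\<close>

type_synonym tensor = "nat \<Rightarrow> nat \<Rightarrow> nat \<Rightarrow> real"

subsection \<open>Linear algebra\<close>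

abbreviation RV :: "nat \<Rightarrow> (real, real vec) module" where
  "RV n \<equiv> module_vec TYPE(real) n"

definition subspace_dim :: "nat \<Rightarrow> real vec set \<Rightarrow> nat" where
  "subspace_dim n W = vectorspace.dim class_ring ((RV n)\<lparr>carrier := W\<rparr>)"

text \<open>Independence of the columns with index in \<open>S\<close> as a family: repeated columns are dependent.\<close>

definition cols_indpt :: "real mat \<Rightarrow> nat set \<Rightarrow> bool" where
  "cols_indpt X S \<longleftrightarrow> inj_on (col X) S \<and>
     \<not> LinearCombinations.module.lin_dep class_ring (RV (dim_row X)) (col X ` S)"

definition full_column_rank :: "real mat \<Rightarrow> bool" where
  "full_column_rank X \<longleftrightarrow> cols_indpt X {..<dim_col X}"

definition k_rank :: "real mat \<Rightarrow> nat" where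
  "k_rank X = Max {k. k \<le> dim_col X \<and> (\<forall>S \<subseteq> {..<dim_col X}. card S = k \<longrightarrow> cols_indpt X S)}"

definition kron :: "real vec \<Rightarrow> real vec \<Rightarrow> real vec" where
  "kron x y = vec (dim_vec x * dim_vec y) (\<lambda>i. x $ (i div dim_vec y) * y $ (i mod dim_vec y))"

fun kron_pow :: "nat \<Rightarrow> real vec \<Rightarrow> real vec" where
  "kron_pow 0 x = vec 1 (\<lambda>_. 1)"
| "kron_pow (Suc n) x = kron x (kron_pow n x)"

definition khatri_rao :: "real mat \<Rightarrow> real mat \<Rightarrow> real mat" where
  "khatri_rao A B =
     mat_of_cols (dim_row A * dim_row B) (map (\<lambda>r. kron (col A r) (col B r)) [0..<dim_col A])"

text \<open>The subspace \<open>S\<^sup>n(\<real>\<^bsup>K^n\<^esup>)\<close> of symmetric tensors, in vectorized form.\<close>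

definition sym_space :: "nat \<Rightarrow> nat \<Rightarrow> real vec set" where
  "sym_space K n =
     LinearCombinations.module.span class_ring (RV (K ^ n)) (kron_pow n ` carrier_vec K)"

subsection \<open>Polyadic decompositions\<close>

definition is_pd ::
  "nat \<Rightarrow> nat \<Rightarrow> nat \<Rightarrow> nat \<Rightarrow> tensor \<Rightarrow> real mat \<Rightarrow> real mat \<Rightarrow> real mat \<Rightarrow> bool" where
  "is_pd I J K R T A B C \<longleftrightarrow>
     A \<in> carrier_mat I R \<and> B \<in> carrier_mat J R \<and> C \<in> carrier_mat K R \<and>
     (\<forall>i<I. \<forall>j<J. \<forall>k<K. T i j k = (\<Sum>r<R. A $$ (i,r) * B $$ (j,r) * C $$ (k,r)))"

text \<open>A decomposition with the least number of terms has no zero term, so all its terms have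
  rank one.\<close>

definition tensor_rank :: "nat \<Rightarrow> nat \<Rightarrow> nat \<Rightarrow> tensor \<Rightarrow> nat" where
  "tensor_rank I J K T = (LEAST R. \<exists>A B C. is_pd I J K R T A B C)"

definition is_cpd ::
  "nat \<Rightarrow> nat \<Rightarrow> nat \<Rightarrow> tensor \<Rightarrow> real mat \<Rightarrow> real mat \<Rightarrow> real mat \<Rightarrow> bool" where
  "is_cpd I J K T A B C \<longleftrightarrow> is_pd I J K (tensor_rank I J K T) T A B C"

definition cpd_unique :: "nat \<Rightarrow> nat \<Rightarrow> nat \<Rightarrow> tensor \<Rightarrow> bool" where
  "cpd_unique I J K T \<longleftrightarrow>
     (\<forall>A B C A' B' C'. is_cpd I J K T A B C \<and> is_cpd I J K T A' B' C' \<longrightarrow>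
        (\<exists>\<pi> \<alpha> \<beta> \<gamma>. \<pi> permutes {..<tensor_rank I J K T} \<and>
           (\<forall>r<tensor_rank I J K T.
              \<alpha> r * \<beta> r * \<gamma> r = 1 \<and>
              col A' r = \<alpha> r \<cdot>\<^sub>v col A (\<pi> r) \<and>
              col B' r = \<beta> r \<cdot>\<^sub>v col B (\<pi> r) \<and>
              col C' r = \<gamma> r \<cdot>\<^sub>v col C (\<pi> r))))"

subsection \<open>The matrix \<open>R\<^sub>m\<^sub>,\<^sub>l(T)\<close>\<close>

text \<open>\<open>digit b n x p\<close> is the \<open>p\<close>-th of the \<open>n\<close> base-\<open>b\<close> digits of \<open>x\<close>, most significant first, so that
  \<open>x = (\<Sum>p<n. digit b n x p * b ^ (n - 1 - p))\<close> whenever \<open>x < b ^ n\<close>.\<close>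

definition digit :: "nat \<Rightarrow> nat \<Rightarrow> nat \<Rightarrow> nat \<Rightarrow> nat" where
  "digit b n x p = x div b ^ (n - 1 - p) mod b"

text \<open>The sum over the permutations of positions counts the arrangements of \<open>(k\<^sub>1, \<dots>, k\<^sub>n)\<close> with
  multiplicity, as required when some of the values coincide.\<close>

definition R_mat :: "nat \<Rightarrow> nat \<Rightarrow> nat \<Rightarrow> nat \<Rightarrow> nat \<Rightarrow> tensor \<Rightarrow> real mat" where
  "R_mat I J K m l T =
     (let n = m + l in
      mat (I ^ n * J ^ n) (K ^ n) (\<lambda>(a, c).
        let i = digit I n (a div J ^ n); j = digit J n (a mod J ^ n); k = digit K n c in
        1 / (fact m * fact n) *
        (\<Sum>\<sigma> | \<sigma> permutes {..<n}.
           det (mat m m (\<lambda>(u, v). T (i u) (j v) (k (\<sigma> v)))) *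
           (\<Prod>p<l. T (i (m + p)) (j (m + p)) (k (\<sigma> (m + p)))))))"

subsection \<open>Algebraic algorithms\<close>

text \<open>
  An algebraic algorithm for tensors of a given format is a finite decision tree working on a
  growing list of real matrices, the registers. It may form matrices whose entries are obtained
  from the entries of earlier registers and rational constants by field operations (this covers
  matrix arithmetic and reshaping); compute a basis of a null space, a generalized eigenvalue
  decomposition, or a singular value decomposition; and branch on whether a number is zero and on
  the number of columns of a register. There are no other operations, and no real constants
  beyond the rational ones.
\<close>

datatype aexp =
    Const rat
  | Entry nat nat nat  \<comment> \<open>register, row, column\<close>
  | Add aexp aexp
  | Sub aexp aexp
  | Mul aexp aexp
  | Div aexp aexp

fun aval :: "real mat list \<Rightarrow> aexp \<Rightarrow> real" where
  "aval \<rho> (Const q) = of_rat q"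
| "aval \<rho> (Entry x i j) = (\<rho> ! x) $$ (i, j)"
| "aval \<rho> (Add e f) = aval \<rho> e + aval \<rho> f"
| "aval \<rho> (Sub e f) = aval \<rho> e - aval \<rho> f"
| "aval \<rho> (Mul e f) = aval \<rho> e * aval \<rho> f"
| "aval \<rho> (Div e f) = aval \<rho> e / aval \<rho> f"

fun adefined :: "real mat list \<Rightarrow> aexp \<Rightarrow> bool" where
  "adefined \<rho> (Const q) \<longleftrightarrow> True"
| "adefined \<rho> (Entry x i j) \<longleftrightarrow> x < length \<rho> \<and> i < dim_row (\<rho> ! x) \<and> j < dim_col (\<rho> ! x)"
| "adefined \<rho> (Add e f) \<longleftrightarrow> adefined \<rho> e \<and> adefined \<rho> f"
| "adefined \<rho> (Sub e f) \<longleftrightarrow> adefined \<rho> e \<and> adefined \<rho> f"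
| "adefined \<rho> (Mul e f) \<longleftrightarrow> adefined \<rho> e \<and> adefined \<rho> f"
| "adefined \<rho> (Div e f) \<longleftrightarrow> adefined \<rho> e \<and> adefined \<rho> f \<and> aval \<rho> f \<noteq> 0"

definition is_null_basis :: "real mat \<Rightarrow> real mat \<Rightarrow> bool" where
  "is_null_basis M N \<longleftrightarrow> dim_row N = dim_col M \<and> full_column_rank N \<and>
     LinearCombinations.module.span class_ring (RV (dim_col M)) (set (cols N)) = mat_kernel M"

text \<open>The generalized eigenvalues are the ratios \<open>D\<^sub>i\<^sub>i : E\<^sub>i\<^sub>i\<close>, possibly infinite, and the columns of
  \<open>X\<close> are the eigenvectors. The ordinary eigenvalue decomposition is the case where \<open>N\<close> is the
  identity.\<close>

definition is_gevd :: "real mat \<Rightarrow> real mat \<Rightarrow> real mat \<Rightarrow> real mat \<Rightarrow> real mat \<Rightarrow> bool" where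
  "is_gevd M N X D E \<longleftrightarrow>
     (\<exists>n. {M, N, X, D, E} \<subseteq> carrier_mat n n \<and>
        invertible_mat X \<and> diagonal_mat D \<and> diagonal_mat E \<and>
        (\<forall>i<n. D $$ (i,i) \<noteq> 0 \<or> E $$ (i,i) \<noteq> 0) \<and>
        M * X * E = N * X * D)"

definition is_svd :: "real mat \<Rightarrow> real mat \<Rightarrow> real mat \<Rightarrow> real mat \<Rightarrow> bool" where
  "is_svd M U S V \<longleftrightarrow>
     (\<exists>p q. M \<in> carrier_mat p q \<and> U \<in> carrier_mat p p \<and> S \<in> carrier_mat p q \<and> V \<in> carrier_mat q q \<and>
        transpose_mat U * U = 1\<^sub>m p \<and> transpose_mat V * V = 1\<^sub>m q \<and> diagonal_mat S \<and>
        (\<forall>i < min p q. S $$ (i,i) \<ge> 0) \<and>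
        (\<forall>i j. i \<le> j \<and> j < min p q \<longrightarrow> S $$ (j,j) \<le> S $$ (i,i)) \<and>
        M = U * S * transpose_mat V)"

datatype instr =
    Compute nat nat "nat \<Rightarrow> nat \<Rightarrow> aexp"  \<comment> \<open>format and entries of the new matrix; entries outside the format are never used\<close>
  | Null_Space nat
  | GEVD nat nat
  | SVD nat

text \<open>\<open>step \<rho> c out\<close>: instruction \<open>c\<close> may append the matrices \<open>out\<close> to the registers \<open>\<rho>\<close>. The results
  of the decompositions are not unique, and any of them is allowed.\<close>

fun step :: "real mat list \<Rightarrow> instr \<Rightarrow> real mat list \<Rightarrow> bool" where
  "step \<rho> (Compute nr nc e) out \<longleftrightarrow>
     (\<forall>i<nr. \<forall>j<nc. adefined \<rho> (e i j)) \<and> out = [mat nr nc (\<lambda>(i, j). aval \<rho> (e i j))]"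
| "step \<rho> (Null_Space x) out \<longleftrightarrow>
     x < length \<rho> \<and> (\<exists>N. is_null_basis (\<rho> ! x) N \<and> out = [N])"
| "step \<rho> (GEVD x y) out \<longleftrightarrow>
     x < length \<rho> \<and> y < length \<rho> \<and> (\<exists>X D E. is_gevd (\<rho> ! x) (\<rho> ! y) X D E \<and> out = [X, D, E])"
| "step \<rho> (SVD x) out \<longleftrightarrow>
     x < length \<rho> \<and> (\<exists>U S V. is_svd (\<rho> ! x) U S V \<and> out = [U, S, V])"

datatype alg =
    Return nat nat nat
  | Do instr alg
  | If_Zero aexp alg alg
  | If_Cols nat nat alg alg  \<comment> \<open>does the register have the given number of columns?\<close>

text \<open>\<open>all_runs alg \<rho> Q\<close>: started on the registers \<open>\<rho>\<close>, the algorithm never gets stuck (undefined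
  expression, nonexistent decomposition or register), and, whichever results the decompositions
  deliver, the three returned matrices satisfy \<open>Q\<close>.\<close>

fun all_runs :: "alg \<Rightarrow> real mat list \<Rightarrow> (real mat \<Rightarrow> real mat \<Rightarrow> real mat \<Rightarrow> bool) \<Rightarrow> bool" where
  "all_runs (Return x y z) \<rho> Q \<longleftrightarrow>
     x < length \<rho> \<and> y < length \<rho> \<and> z < length \<rho> \<and> Q (\<rho> ! x) (\<rho> ! y) (\<rho> ! z)"
| "all_runs (Do c p) \<rho> Q \<longleftrightarrow>
     (\<exists>out. step \<rho> c out) \<and> (\<forall>out. step \<rho> c out \<longrightarrow> all_runs p (\<rho> @ out) Q)"
| "all_runs (If_Zero e p q) \<rho> Q \<longleftrightarrow>
     adefined \<rho> e \<and> (if aval \<rho> e = 0 then all_runs p \<rho> Q else all_runs q \<rho> Q)"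
| "all_runs (If_Cols x n p q) \<rho> Q \<longleftrightarrow>
     x < length \<rho> \<and> (if dim_col (\<rho> ! x) = n then all_runs p \<rho> Q else all_runs q \<rho> Q)"

definition frontal_slices :: "nat \<Rightarrow> nat \<Rightarrow> nat \<Rightarrow> tensor \<Rightarrow> real mat list" where
  "frontal_slices I J K T = map (\<lambda>k. mat I J (\<lambda>(i, j). T i j k)) [0..<K]"

definition finds_cpd :: "alg \<Rightarrow> nat \<Rightarrow> nat \<Rightarrow> nat \<Rightarrow> tensor \<Rightarrow> bool" where
  "finds_cpd alg I J K T \<longleftrightarrow> all_runs alg (frontal_slices I J K T) (is_cpd I J K T)"

end

theory Submission
  imports Defs
begin

text \<open>
  Contracting \<open>T\<close> with a point \<open>x\<close> of \<open>K\<close>-space gives the matrix \<open>T(x) = (\<Sum>r<R. c r (x) a r b r\<^sup>T)\<close>, in which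
  the columns of \<open>C\<close> act as linear forms \<open>c r\<close>. Since \<open>k_rank C = K\<close>, only \<open>0\<close> is a common zero of \<open>K\<close> of
  the \<open>R\<close> forms, and \<open>K - 1\<close> of them vanish on a common line. On the resulting \<open>R choose (K - 1)\<close> lines at
  most \<open>m - 1 = R - K + 1\<close> terms survive, so \<open>T(x)\<close> has rank less than \<open>m\<close> there. The dimension condition
  says that this happens nowhere else, and it makes the lines computable.

  Put \<open>n = m + l\<close>. On the \<open>n\<close>-th power of \<open>x\<close>, the matrix \<open>R_mat\<close> gives the \<open>m\<close>-minors of \<open>T(x)\<close> times
  monomials (\<open>R_mat_power\<close>), so the powers of all points of low rank lie in its kernel. The powers of the
  points on the lines are independent: the product of the forms that do not vanish on a line
  vanishes on all the other lines (\<open>powers_independent\<close>). By the dimension condition they span the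
  symmetric part of the kernel. If fewer than \<open>K - 1\<close> forms vanish at \<open>y\<close>, some product of \<open>n\<close> forms
  vanishes on all the lines but not at \<open>y\<close>; so the power of \<open>y\<close> is not in the kernel, and \<open>T(y)\<close> has rank
  at least \<open>m\<close> (\<open>low_rank_points\<close>).

  Uniqueness follows from this description of the points of low rank. The common zeros of \<open>K - 2\<close>
  forms make up a plane, on which \<open>T\<close> is a matrix pencil with \<open>m\<close> terms. The plane contains a point where
  the rank is \<open>m\<close>, hence the \<open>m\<close> vectors \<open>a r\<close> of the pencil are independent, and so are the \<open>b r\<close>. In
  particular \<open>T(x)\<close> is not a sum of \<open>m - 2\<close> terms of rank one for any nonzero \<open>x\<close> (\<open>not_few_terms\<close>). This
  excludes decompositions with fewer than \<open>R\<close> terms and puts the forms of every decomposition with \<open>R\<close>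
  terms in general position. The plane of \<open>K - 2\<close> forms of a second decomposition contains \<open>m\<close> lines of
  low rank, and by counting it is also a plane of \<open>K - 2\<close> forms of the first one
  (\<open>exists_common_adjacent_points\<close>). On a common plane the terms of both decompositions can be read off
  from \<open>T\<close>: if \<open>x\<close> and \<open>y\<close> lie on two of the lines, then \<open>T(y)\<close> maps the kernel of \<open>T(x)\<close> onto the line of a
  single \<open>a r\<close> (\<open>contract_kernel\<close>). So the factors \<open>a r\<close> and \<open>b r\<close> agree up to order and scaling, and the full
  column rank of the Khatri-Rao product settles the third factor (\<open>same_termsI\<close>).

  The algorithm follows the same path. By polarization the symmetric tensors are a null space
  (\<open>sym_space_iff\<close>), so a basis of the kernel is the result of one null space computation. Contracting the
  first mode of the basis with two points of the moment curve gives a matrix pencil whose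
  eigenvectors turn the basis into multiples of the powers (\<open>gevd_columns\<close>), from which the points
  of low rank are read off. Kernels of contractions then give the factors \<open>a r\<close> and \<open>b r\<close>, and linear systems
  the third factor. The choice of the points on the moment curve and the assignment of eigenvectors to
  terms leave finitely many possibilities, which are tried in turn: an attempt that passes its final
  test has found a decomposition with \<open>R\<close> terms (\<open>solvable_third_factor\<close>), and the right guess passes it
  whatever bases and eigenvectors the decompositions have delivered (\<open>candidates_exist\<close>).
\<close>

section \<open>Linear systems and minors\<close>

lemma mat_mult_vec_sum:
  assumes "i < nr" "dim_vec v = nc"
  shows "(mat nr nc f *\<^sub>v v) $ i = (\<Sum>j<nc. f (i, j) * v $ j)"
  using assms by (auto simp: scalar_prod_def atLeast0LessThan intro!: sum.cong)

lemma det_zero_iff_kernel: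
  fixes f :: "nat \<times> nat \<Rightarrow> real"
  shows "det (mat q q f) = 0 \<longleftrightarrow> (\<exists>y. (\<exists>j<q. y j \<noteq> 0) \<and> (\<forall>i<q. (\<Sum>j<q. f (i, j) * y j) = 0))"
    (is "?l \<longleftrightarrow> ?r")
proof -
  have c: "mat q q f \<in> carrier_mat q q" by simp
  show ?thesis
  proof
    assume ?l
    then obtain v where v: "v \<in> carrier_vec q" "v \<noteq> 0\<^sub>v q" "mat q q f *\<^sub>v v = 0\<^sub>v q"
      using det_0_iff_vec_prod_zero[OF c] by auto
    have "\<exists>j<q. v $ j \<noteq> 0"
    proof (rule ccontr)
      assume "\<not> ?thesis"
      then have "v = 0\<^sub>v q" using v(1) by (intro eq_vecI) auto
      then show False using v by simp
    qed
    moreover have "(\<Sum>j<q. f (i, j) * v $ j) = 0" if "i < q" for i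
      using mat_mult_vec_sum[OF that, of v q f] v that by simp
    ultimately show ?r by (intro exI[of _ "\<lambda>j. v $ j"]) auto
  next
    assume ?r
    then obtain y where y: "\<exists>j<q. y j \<noteq> 0" "\<forall>i<q. (\<Sum>j<q. f (i, j) * y j) = 0" by auto
    have "mat q q f *\<^sub>v vec q y = 0\<^sub>v q"
      using y(2) by (intro eq_vecI) (auto simp: mat_mult_vec_sum simp del: index_mult_mat_vec)
    moreover have "vec q y \<noteq> 0\<^sub>v q" using y(1) by (metis index_vec index_zero_vec(1))
    ultimately show ?l
      unfolding det_0_iff_vec_prod_zero[OF c] by (intro exI[of _ "vec q y"]) simp
  qed
qed

text \<open>Filled up with zero rows, the system becomes square and singular.\<close>

lemma underdetermined_system:
  fixes M :: "nat \<Rightarrow> nat \<Rightarrow> real"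
  assumes "p < q"
  shows "\<exists>y. (\<exists>j<q. y j \<noteq> 0) \<and> (\<forall>i<p. (\<Sum>j<q. M i j * y j) = 0)"
proof -
  let ?f = "\<lambda>(i, j). if i < p then M i j else 0"
  have "det (mat q q ?f) = det (mat q q (\<lambda>(i, j). if i = p then 0 else ?f (i, j)))"
    by (intro arg_cong[of _ _ det] eq_matI) auto
  also have "\<dots> = 0"
  proof -
    have "mat q q (\<lambda>(i, j). if i = p then 0 else ?f (i, j)) =
        mat\<^sub>r q q (\<lambda>i. if i = p then 0\<^sub>v q else vec q (\<lambda>j. ?f (i, j)))"
      by (intro eq_matI) auto
    then show ?thesis using det_row_0[OF assms, of "\<lambda>i. vec q (\<lambda>j. ?f (i, j))"] by auto
  qed
  finally obtain y where y: "\<exists>j<q. y j \<noteq> 0" "\<forall>i<q. (\<Sum>j<q. ?f (i, j) * y j) = 0"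
    using det_zero_iff_kernel[of q ?f] by auto
  have "(\<Sum>j<q. M i j * y j) = 0" if "i < p" for i
    using y(2)[rule_format, of i] that assms by simp
  then show ?thesis using y(1) by blast
qed

lemma underdetermined_system_set:
  fixes g :: "'a \<Rightarrow> nat \<Rightarrow> real"
  assumes "finite V" "card V < q"
  shows "\<exists>y. (\<exists>j<q. y j \<noteq> 0) \<and> (\<forall>r\<in>V. (\<Sum>j<q. g r j * y j) = 0)"
proof -
  obtain e where e: "bij_betw e {..<card V} V"
    using assms(1) ex_bij_betw_nat_finite[of V] by (auto simp: atLeast0LessThan)
  obtain y where y: "\<exists>j<q. y j \<noteq> 0" "\<forall>i<card V. (\<Sum>j<q. g (e i) j * y j) = 0"
    using underdetermined_system[OF assms(2), of "\<lambda>i. g (e i)"] by blast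
  have "(\<Sum>j<q. g r j * y j) = 0" if r: "r \<in> V" for r
  proof -
    obtain i where "i < card V" "r = e i" using e r by (auto simp: bij_betw_def)
    then show ?thesis using y(2) by simp
  qed
  then show ?thesis using y(1) by blast
qed

text \<open>The matrix of a sum of rank-one terms, after a choice of \<open>m\<close> rows and \<open>m\<close> columns.\<close>

abbreviation outer_sum :: "nat \<Rightarrow> 'a set \<Rightarrow> ('a \<Rightarrow> nat \<Rightarrow> real) \<Rightarrow> ('a \<Rightarrow> nat \<Rightarrow> real) \<Rightarrow> real mat" where
  "outer_sum m V f g \<equiv> mat m m (\<lambda>(u, v). \<Sum>r\<in>V. f r u * g r v)"

lemma outer_sum_kernel:
  fixes f g :: "'a \<Rightarrow> nat \<Rightarrow> real"
  shows "(\<Sum>j<m. (\<Sum>r\<in>V. f r u * g r j) * y j) = (\<Sum>r\<in>V. f r u * (\<Sum>j<m. g r j * y j))"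
proof -
  have "(\<Sum>j<m. (\<Sum>r\<in>V. f r u * g r j) * y j) = (\<Sum>j<m. \<Sum>r\<in>V. f r u * g r j * y j)"
    by (simp add: sum_distrib_right)
  also have "\<dots> = (\<Sum>r\<in>V. \<Sum>j<m. f r u * g r j * y j)" by (rule sum.swap)
  finally show ?thesis by (simp add: sum_distrib_left mult.assoc)
qed

lemma det_outer_sum_eq_0I:
  fixes f g :: "'a \<Rightarrow> nat \<Rightarrow> real"
  assumes "\<exists>j<m. y j \<noteq> 0" "\<And>r. r \<in> V \<Longrightarrow> (\<Sum>j<m. g r j * y j) = 0"
  shows "det (outer_sum m V f g) = 0"
  unfolding det_zero_iff_kernel using assms by (auto simp: outer_sum_kernel)

text \<open>Fewer than \<open>m\<close> right factors have a common null vector, which is then a null vector of the matrix.\<close>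

lemma det_outer_sum_few_terms:
  fixes f g :: "'a \<Rightarrow> nat \<Rightarrow> real"
  assumes "finite V" "card V < m"
  shows "det (outer_sum m V f g) = 0"
proof -
  obtain y where "\<exists>j<m. y j \<noteq> 0" "\<forall>r\<in>V. (\<Sum>j<m. g r j * y j) = 0"
    using underdetermined_system_set[OF assms, of g] by blast
  then show ?thesis using det_outer_sum_eq_0I[of m y V g f] by blast
qed

text \<open>With a linear relation among the left factors, one term of the sum can be eliminated, which
  leaves too few terms for a nonzero determinant.\<close>

lemma det_outer_sum_indep:
  fixes f g :: "'a \<Rightarrow> nat \<Rightarrow> real"
  assumes fin: "finite V" and card: "card V = m" and det: "det (outer_sum m V f g) \<noteq> 0"
    and rel: "\<And>u. u < m \<Longrightarrow> (\<Sum>r\<in>V. f r u * y r) = 0" and s: "s \<in> V"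
  shows "y s = 0"
proof (rule ccontr)
  assume ys: "y s \<noteq> 0"
  let ?g = "\<lambda>r v. g r v - y r / y s * g s v"
  have "outer_sum m V f g = outer_sum m (V - {s}) f ?g"
  proof (intro eq_matI)
    fix u v assume "u < dim_row (outer_sum m (V - {s}) f ?g)" "v < dim_col (outer_sum m (V - {s}) f ?g)"
    then have u: "u < m" and v: "v < m" by auto
    have a: "f s u * y s = - (\<Sum>r\<in>V - {s}. f r u * y r)"
      using rel[OF u] sum.remove[OF fin s, of "\<lambda>r. f r u * y r"] by simp
    then have b: "f s u = - (\<Sum>r\<in>V - {s}. f r u * y r) / y s" using ys by (simp add: field_simps)
    have "(\<Sum>r\<in>V. f r u * g r v) = f s u * g s v + (\<Sum>r\<in>V - {s}. f r u * g r v)"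
      using sum.remove[OF fin s] by blast
    also have "\<dots> = (\<Sum>r\<in>V - {s}. f r u * ?g r v)"
      unfolding b by (simp add: algebra_simps sum_subtractf sum_distrib_left sum_divide_distrib sum_negf)
    finally show "outer_sum m V f g $$ (u, v) = outer_sum m (V - {s}) f ?g $$ (u, v)"
      using u v by simp
  qed auto
  moreover have "card (V - {s}) < m" 
    using card_Diff1_less[OF fin s] card by simp
  ultimately show False using det det_outer_sum_few_terms[of "V - {s}" m f ?g] fin by simp
qed

section \<open>Points at which a tensor drops rank\<close>

definition form :: "nat \<Rightarrow> (nat \<Rightarrow> nat \<Rightarrow> real) \<Rightarrow> nat \<Rightarrow> (nat \<Rightarrow> real) \<Rightarrow> real" where
  "form K c r x = (\<Sum>k<K. c r k * x k)"

lemma form_add: "form K c r (\<lambda>k. s * x k + t * y k) = s * form K c r x + t * form K c r y"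
  by (simp add: form_def sum.distrib sum_distrib_left algebra_simps)

abbreviation nonzero :: "nat \<Rightarrow> (nat \<Rightarrow> real) \<Rightarrow> bool" where
  "nonzero K x \<equiv> \<exists>k<K. x k \<noteq> 0"

definition contract :: "nat \<Rightarrow> tensor \<Rightarrow> (nat \<Rightarrow> real) \<Rightarrow> nat \<Rightarrow> nat \<Rightarrow> real" where
  "contract K T x i j = (\<Sum>k<K. T i j k * x k)"

text \<open>Rank below \<open>m\<close>, in terms of minors because these are the entries of the matrix \<open>R_mat\<close>. Rows and columns
  may be selected repeatedly, which adds only zero minors.\<close>

definition low_rank_at :: "nat \<Rightarrow> nat \<Rightarrow> nat \<Rightarrow> nat \<Rightarrow> tensor \<Rightarrow> (nat \<Rightarrow> real) \<Rightarrow> bool" where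
  "low_rank_at m I J K T x \<longleftrightarrow>
     (\<forall>i j. (\<forall>u<m. i u < I) \<longrightarrow> (\<forall>v<m. j v < J) \<longrightarrow>
        det (mat m m (\<lambda>(u, v). contract K T x (i u) (j v))) = 0)"

text \<open>The first index of each factor is that of the term, so that \<open>a r\<close>, \<open>b r\<close> and \<open>c r\<close> are vectors.\<close>

definition decomposes ::
  "nat \<Rightarrow> nat \<Rightarrow> nat \<Rightarrow> nat \<Rightarrow> tensor \<Rightarrow> (nat \<Rightarrow> nat \<Rightarrow> real) \<Rightarrow> (nat \<Rightarrow> nat \<Rightarrow> real) \<Rightarrow>
    (nat \<Rightarrow> nat \<Rightarrow> real) \<Rightarrow> bool" where
  "decomposes I J K R T a b c \<longleftrightarrow>
     (\<forall>i<I. \<forall>j<J. \<forall>k<K. T i j k = (\<Sum>r<R. a r i * b r j * c r k))"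

text \<open>For the columns of \<open>C\<close> this is \<open>k_rank C = K\<close>, in dual form: \<open>K\<close> of the forms have no common zero but \<open>0\<close>.\<close>

definition general_position :: "nat \<Rightarrow> nat \<Rightarrow> (nat \<Rightarrow> nat \<Rightarrow> real) \<Rightarrow> bool" where
  "general_position K R c \<longleftrightarrow>
     (\<forall>S \<subseteq> {..<R}. card S = K \<longrightarrow> (\<forall>x. (\<forall>r\<in>S. form K c r x = 0) \<longrightarrow> \<not> nonzero K x))"

lemma general_positionD:
  assumes "general_position K R c" "S \<subseteq> {..<R}" "K \<le> card S" "\<And>r. r \<in> S \<Longrightarrow> form K c r x = 0"
  shows "\<not> nonzero K x"
proof -
  obtain S' where "S' \<subseteq> S" "card S' = K"
    using obtain_subset_with_card_n[OF assms(3)] by blast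
  then show ?thesis using assms unfolding general_position_def by blast
qed

lemma exists_common_zero:
  assumes "finite S" "card S < K"
  shows "\<exists>x. nonzero K x \<and> (\<forall>r\<in>S. form K c r x = 0)"
  using underdetermined_system_set[OF assms, of c] unfolding form_def .

lemma contract_decomposes:
  assumes "decomposes I J K R T a b c" "i < I" "j < J"
  shows "contract K T x i j = (\<Sum>r<R. a r i * b r j * form K c r x)"
proof -
  have "contract K T x i j = (\<Sum>k<K. \<Sum>r<R. a r i * b r j * c r k * x k)"
    using assms by (simp add: contract_def decomposes_def sum_distrib_right)
  also have "\<dots> = (\<Sum>r<R. \<Sum>k<K. a r i * b r j * c r k * x k)" by (rule sum.swap)
  finally show ?thesis by (simp add: form_def sum_distrib_left mult.assoc)
qed

lemma contract_decomposes_restrict: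
  assumes "decomposes I J K R T a b c" "i < I" "j < J"
    and "\<And>r. r \<in> S \<Longrightarrow> form K c r x = 0" "V = {..<R} - S"
  shows "contract K T x i j = (\<Sum>r\<in>V. a r i * (form K c r x * b r j))"
  unfolding contract_decomposes[OF assms(1-3)] assms(5)
  by (rule sum.mono_neutral_cong_right) (auto simp: assms(4))

lemma low_rank_atI:
  assumes "finite V" "card V < m"
    and "\<And>i j. i < I \<Longrightarrow> j < J \<Longrightarrow> contract K T x i j = (\<Sum>r\<in>V. f r i * g r j)"
  shows "low_rank_at m I J K T x"
  unfolding low_rank_at_def
proof (intro allI impI)
  fix i j :: "nat \<Rightarrow> nat"
  assume i: "\<forall>u<m. i u < I" and j: "\<forall>v<m. j v < J"
  have "mat m m (\<lambda>(u, v). contract K T x (i u) (j v)) =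
      outer_sum m V (\<lambda>r u. f r (i u)) (\<lambda>r v. g r (j v))"
    using i j by (intro eq_matI) (auto simp: assms(3))
  then show "det (mat m m (\<lambda>(u, v). contract K T x (i u) (j v))) = 0"
    by (simp only: det_outer_sum_few_terms[OF assms(1,2)])
qed

text \<open>The geometric content of the hypotheses: \<open>c\<close> consists of \<open>R\<close> linear forms in general position
  on \<open>K\<close>-space, and the contraction of \<open>T\<close> by a point has rank below \<open>m = R - K + 2\<close> only at the
  points where the obvious reason for it holds, namely that at least \<open>K - 1\<close> of the forms vanish.\<close>

locale rank_drop =
  fixes I J K R m :: nat and T :: tensor and c :: "nat \<Rightarrow> nat \<Rightarrow> real"
  assumes K2: "2 \<le> K" and KR: "K \<le> R" and m: "m = R - K + 2"
    and gp: "general_position K R c"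
    and drop: "\<And>x. nonzero K x \<Longrightarrow> low_rank_at m I J K T x \<Longrightarrow>
      K - 1 \<le> card {r. r < R \<and> form K c r x = 0}"
begin

lemma card_zero_forms_less:
  assumes "nonzero K x" shows "card {r. r < R \<and> form K c r x = 0} < K"
proof (rule ccontr)
  assume *: "\<not> ?thesis"
  have "\<not> nonzero K x"
  proof (rule general_positionD[OF gp])
    show "{r. r < R \<and> form K c r x = 0} \<subseteq> {..<R}" by blast
    show "K \<le> card {r. r < R \<and> form K c r x = 0}" using * by simp
  qed blast
  with assms show False by blast
qed

text \<open>If all points \<open>x + n y\<close> had low rank, then the same \<open>K - 1\<close> forms would vanish at two of them, and therefore
  on the whole plane of \<open>x\<close> and \<open>y\<close>. But the plane contains a nonzero zero of one more form.\<close>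

lemma exists_full_rank_point:
  assumes indep: "\<And>s t. \<not> nonzero K (\<lambda>k. s * x k + t * y k) \<Longrightarrow> s = 0 \<and> t = 0"
  obtains t where "\<not> low_rank_at m I J K T (\<lambda>k. x k + t * y k)"
proof (rule ccontr)
  assume none: "\<not> thesis"
  let ?z = "\<lambda>n::nat. \<lambda>k. 1 * x k + real n * y k"
  let ?Z = "\<lambda>n. {r. r < R \<and> form K c r (?z n) = 0}"
  have nz: "nonzero K (?z n)" for n using indep[of 1 "real n"] by auto
  have card: "K - 1 \<le> card (?Z n)" for n
  proof -
    have "low_rank_at m I J K T (?z n)" using none that[of "real n"] by auto
    then show ?thesis by (rule drop[OF nz])
  qed
  have "\<not> inj_on ?Z UNIV"
  proof
    assume "inj_on ?Z UNIV"
    moreover have "finite (range ?Z)" by (rule finite_subset[of _ "Pow {..<R}"]) auto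
    ultimately have "finite (UNIV :: nat set)" using finite_imageD by blast
    then show False by simp
  qed
  then obtain n n' where nn: "n \<noteq> n'" "?Z n = ?Z n'" unfolding inj_on_def by blast
  have zero: "form K c r x = 0 \<and> form K c r y = 0" if "r \<in> ?Z n" for r
  proof -
    have 1: "form K c r x + real n * form K c r y = 0" and 2: "form K c r x + real n' * form K c r y = 0"
      using that that[unfolded nn(2)] form_add[of K c r 1 x _ y] by auto
    have "(real n - real n') * form K c r y = 0" 
      unfolding left_diff_distrib using 1 2 by linarith
    with nn(1) have "form K c r y = 0" by simp
    with 1 show ?thesis by simp
  qed
  obtain Z where Z: "Z \<subseteq> {..<R}" "finite Z" "K - 1 \<le> card Z" "card Z < K"
    and zeroZ: "\<And>r. r \<in> Z \<Longrightarrow> form K c r x = 0" "\<And>r. r \<in> Z \<Longrightarrow> form K c r y = 0"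
    and otherZ: "\<And>r. r < R \<Longrightarrow> r \<notin> Z \<Longrightarrow> form K c r (?z n) \<noteq> 0"
  proof (rule that[of "?Z n"])
    show "?Z n \<subseteq> {..<R}" "finite (?Z n)" by auto
    show "K - 1 \<le> card (?Z n)" "card (?Z n) < K" by (rule card, rule card_zero_forms_less[OF nz])
  qed (use zero in blast)+
  have "\<not> {..<R} \<subseteq> Z" using card_mono[OF Z(2), of "{..<R}"] Z(4) KR by auto
  then obtain q where q: "q < R" "q \<notin> Z" by blast
  let ?w = "\<lambda>k. form K c q y * x k + (- form K c q x) * y k"
  have cardq: "K \<le> card (insert q Z)" using q(2) Z K2 by simp
  have zw: "form K c r ?w = 0" if "r \<in> insert q Z" for r
    using that zeroZ[of r] unfolding form_add by (cases "r = q") auto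
  have "insert q Z \<subseteq> {..<R}" using q Z by auto
  from general_positionD[OF gp this cardq zw] have "\<not> nonzero K ?w" .
  from indep[OF this] have "form K c q y = 0" "form K c q x = 0" by auto
  then have "form K c q (?z n) = 0" unfolding form_add by simp
  then show False using otherZ[OF q] by blast
qed

end

text \<open>\<open>x\<close> and \<open>y\<close> span the plane on which only the \<open>m\<close> forms outside \<open>U\<close> live, and \<open>p\<close> and \<open>q\<close> vanish
  at \<open>x\<close> and \<open>y\<close>, respectively. On that plane \<open>T\<close> is a matrix pencil with \<open>m\<close> terms.\<close>

locale adjacent_points = rank_drop +
  fixes c' :: "nat \<Rightarrow> nat \<Rightarrow> real" and a b :: "nat \<Rightarrow> nat \<Rightarrow> real"
    and U :: "nat set" and p q :: nat and x y :: "nat \<Rightarrow> real"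
  assumes dec: "decomposes I J K R T a b c'" and gp': "general_position K R c'"
    and U: "U \<subseteq> {..<R}" "card U = K - 2" and p: "p < R" "p \<notin> U" and q: "q < R" "q \<notin> U" and pq: "p \<noteq> q"
    and x: "nonzero K x" "\<And>r. r \<in> insert p U \<Longrightarrow> form K c' r x = 0"
    and y: "nonzero K y" "\<And>r. r \<in> insert q U \<Longrightarrow> form K c' r y = 0"
begin

abbreviation "V \<equiv> {..<R} - U"

lemma finite_U: "finite U" using U(1) finite_subset by blast

lemma card_V: "card V = m"
  using card_Diff_subset[OF finite_U U(1)] U(2) K2 KR m by simp

text \<open>Otherwise \<open>K\<close> forms would vanish at \<open>x\<close>.\<close>

lemma x_nonzero_forms: "r \<in> V - {p} \<Longrightarrow> form K c' r x \<noteq> 0"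
proof
  assume r: "r \<in> V - {p}" and 0: "form K c' r x = 0"
  have "\<not> nonzero K x"
    by (rule general_positionD[OF gp', of "insert r (insert p U)"])
      (use r 0 x p U K2 finite_U in auto)
  then show False using x(1) by blast
qed

lemma y_nonzero_form: "form K c' p y \<noteq> 0"
proof
  assume 0: "form K c' p y = 0"
  have "\<not> nonzero K y"
    by (rule general_positionD[OF gp', of "insert p (insert q U)"])
      (use 0 y p q pq U K2 finite_U in auto)
  then show False using y(1) by blast
qed

lemma independent_points:
  assumes "\<not> nonzero K (\<lambda>k. s * x k + t * y k)" shows "s = 0 \<and> t = 0"
proof -
  have f: "s * form K c' r x + t * form K c' r y = 0" for r
    using assms unfolding form_add[symmetric] by (simp add: form_def)
  have "s = 0" using f[of q] y(2)[of q] x_nonzero_forms[of q] q pq by auto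
  moreover have "t = 0" using f[of p] x(2)[of p] y_nonzero_form by auto
  ultimately show ?thesis by simp
qed

text \<open>At a point \<open>z\<close> of the plane where the rank is not low, the \<open>m\<close> terms of the pencil give a nonzero minor.\<close>

lemma nonzero_minor:
  "\<exists>i j z. (\<forall>u<m. i u < I) \<and> (\<forall>v<m. j v < J) \<and>
    det (outer_sum m V (\<lambda>r u. a r (i u)) (\<lambda>r v. form K c' r z * b r (j v))) \<noteq> 0"
proof -
  obtain t where t: "\<not> low_rank_at m I J K T (\<lambda>k. x k + t * y k)"
    using exists_full_rank_point[of x y] independent_points by metis
  define z where "z = (\<lambda>k. 1 * x k + t * y k)"
  have "\<not> low_rank_at m I J K T z" using t unfolding z_def by simp
  then obtain i j where i: "\<forall>u<m. i u < I" and j: "\<forall>v<m. j v < J"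
    and d: "det (mat m m (\<lambda>(u, v). contract K T z (i u) (j v))) \<noteq> 0"
    unfolding low_rank_at_def by blast
  have z0: "form K c' r z = 0" if "r \<in> U" for r
    unfolding z_def form_add using that x(2) y(2) by simp
  have "mat m m (\<lambda>(u, v). contract K T z (i u) (j v)) =
      outer_sum m V (\<lambda>r u. a r (i u)) (\<lambda>r v. form K c' r z * b r (j v))"
    using contract_decomposes_restrict[OF dec _ _ z0 refl] i j by (intro eq_matI) auto
  with d i j show ?thesis by (intro exI[of _ i] exI[of _ j] exI[of _ z]) simp
qed

text \<open>The same rows and columns show that the left and the right factors of the pencil are independent.\<close>

lemma selected_minor:
  "\<exists>i j. (\<forall>u<m. i u < I) \<and> (\<forall>v<m. j v < J) \<and>
    (\<forall>w. (\<forall>u<m. (\<Sum>s\<in>V. a s (i u) * w s) = 0) \<longrightarrow> (\<forall>r\<in>V. w r = 0)) \<and>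
    (\<forall>w. (\<exists>v<m. w v \<noteq> 0) \<longrightarrow> (\<exists>r\<in>V. (\<Sum>v<m. b r (j v) * w v) \<noteq> 0))"
proof -
  obtain i j z where ij: "\<forall>u<m. i u < I" "\<forall>v<m. j v < J"
    and d: "det (outer_sum m V (\<lambda>r u. a r (i u)) (\<lambda>r v. form K c' r z * b r (j v))) \<noteq> 0"
    using nonzero_minor by blast
  show ?thesis
  proof (intro exI conjI allI impI ballI)
    fix w :: "nat \<Rightarrow> real" and r
    assume "\<forall>u<m. (\<Sum>s\<in>V. a s (i u) * w s) = 0" "r \<in> V"
    then show "w r = 0" using det_outer_sum_indep[OF _ card_V d, of w r] by auto
  next
    fix w :: "nat \<Rightarrow> real"
    assume w: "\<exists>v<m. w v \<noteq> 0"
    show "\<exists>r\<in>V. (\<Sum>v<m. b r (j v) * w v) \<noteq> 0"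
    proof (rule ccontr)
      assume "\<not> ?thesis"
      then have "(\<Sum>v<m. form K c' r z * b r (j v) * w v) = 0" if "r \<in> V" for r
        using that by (simp add: mult.assoc flip: sum_distrib_left)
      then have "det (outer_sum m V (\<lambda>r u. a r (i u)) (\<lambda>r v. form K c' r z * b r (j v))) = 0"
        by (intro det_outer_sum_eq_0I[OF w])
      then show False using d by simp
    qed
  qed (use ij in auto)
qed

lemma contract_vector:
  assumes "i < I" "\<And>r. r \<in> S \<Longrightarrow> form K c' r w = 0" "W = {..<R} - S"
  shows "(\<Sum>j<J. contract K T w i j * z j) = (\<Sum>r\<in>W. a r i * (form K c' r w * (\<Sum>j<J. b r j * z j)))"
proof -
  have "(\<Sum>j<J. contract K T w i j * z j) = (\<Sum>j<J. (\<Sum>r\<in>W. a r i * (form K c' r w * b r j)) * z j)"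
    using contract_decomposes_restrict[OF dec assms(1) _ assms(2,3)] by simp
  also have "\<dots> = (\<Sum>r\<in>W. a r i * (\<Sum>j<J. (form K c' r w * b r j) * z j))"
    using outer_sum_kernel[where f="\<lambda>r i. a r i" and g="\<lambda>r j. form K c' r w * b r j"] by simp
  finally show ?thesis by (simp add: sum_distrib_left mult.assoc)
qed

text \<open>The kernel of the contraction by \<open>x\<close> consists of the vectors that all \<open>b r\<close> with \<open>r \<in> V - {p}\<close>
  annihilate, so that only the term \<open>p\<close> of the contraction by \<open>y\<close> survives on it.\<close>

lemma contract_kernel:
  assumes ker: "\<And>i. i < I \<Longrightarrow> (\<Sum>j<J. contract K T x i j * z j) = 0" and i: "i < I"
  shows "(\<Sum>j<J. contract K T y i j * z j) = form K c' p y * (\<Sum>j<J. b p j * z j) * a p i"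
proof -
  obtain ii jj where ii: "\<forall>u<m. ii u < I" and jj: "\<forall>v<m. jj v < J"
    and ind: "\<forall>w. (\<forall>u<m. (\<Sum>s\<in>V. a s (ii u) * w s) = 0) \<longrightarrow> (\<forall>r\<in>V. w r = 0)"
    and dual: "\<forall>w. (\<exists>v<m. w v \<noteq> 0) \<longrightarrow> (\<exists>r\<in>V. (\<Sum>v<m. b r (jj v) * w v) \<noteq> 0)"
    using selected_minor by blast
  have 1: "(\<Sum>s\<in>V. a s (ii u) * (form K c' s x * (\<Sum>j<J. b s j * z j))) = 0" if "u < m" for u
    using ker[of "ii u"] contract_vector[of "ii u" U x V z] x(2) ii that by auto
  have 2: "(\<Sum>j<J. b r j * z j) = 0" if "r \<in> V - {p}" for r
    using ind[rule_format, of "\<lambda>s. form K c' s x * (\<Sum>j<J. b s j * z j)" r] 1 x_nonzero_forms[OF that] that by auto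
  have "(\<Sum>j<J. contract K T y i j * z j) = (\<Sum>r\<in>V. a r i * (form K c' r y * (\<Sum>j<J. b r j * z j)))"
    by (rule contract_vector[OF i, of U]) (use y in auto)
  also have "\<dots> = (\<Sum>r\<in>{p}. a r i * (form K c' r y * (\<Sum>j<J. b r j * z j)))"
    by (rule sum.mono_neutral_right) (use p 2 in auto)
  finally show ?thesis by simp
qed

text \<open>The conditions are \<open>m - 1\<close> equations for the \<open>m\<close> selected coordinates. The other coordinates are \<open>0\<close>.\<close>

lemma exists_dual_vector:
  "\<exists>z. (\<forall>r\<in>V - {p}. (\<Sum>j<J. b r j * z j) = 0) \<and> (\<Sum>j<J. b p j * z j) \<noteq> 0"
proof -
  obtain ii jj where ii: "\<forall>u<m. ii u < I" and jj: "\<forall>v<m. jj v < J"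
    and ind: "\<forall>w. (\<forall>u<m. (\<Sum>s\<in>V. a s (ii u) * w s) = 0) \<longrightarrow> (\<forall>r\<in>V. w r = 0)"
    and dual: "\<forall>w. (\<exists>v<m. w v \<noteq> 0) \<longrightarrow> (\<exists>r\<in>V. (\<Sum>v<m. b r (jj v) * w v) \<noteq> 0)"
    using selected_minor by blast
  have "card (V - {p}) < m" using card_Diff1_less[of V p] card_V p by auto
  then obtain w where w: "\<exists>v<m. w v \<noteq> 0" "\<forall>r\<in>V - {p}. (\<Sum>v<m. b r (jj v) * w v) = 0"
    using underdetermined_system_set[of "V - {p}" m "\<lambda>r v. b r (jj v)"] by blast
  define z where "z j = (\<Sum>v<m. if jj v = j then w v else 0)" for j
  have z: "(\<Sum>j<J. b r j * z j) = (\<Sum>v<m. b r (jj v) * w v)" for r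
  proof -
    have "(\<Sum>j<J. b r j * z j) = (\<Sum>v<m. \<Sum>j<J. b r j * (if jj v = j then w v else 0))"
      unfolding z_def sum_distrib_left by (rule sum.swap)
    also have "\<dots> = (\<Sum>v<m. b r (jj v) * w v)"
      using jj by (intro sum.cong) (auto simp: if_distrib cong: if_cong)
    finally show ?thesis .
  qed
  show ?thesis using w dual[rule_format, of w] unfolding z[symmetric] by (intro exI[of _ z]) auto
qed

lemma exists_kernel_vector:
  "\<exists>z. (\<forall>i<I. (\<Sum>j<J. contract K T x i j * z j) = 0) \<and>
    form K c' p y * (\<Sum>j<J. b p j * z j) \<noteq> 0"
proof -
  obtain z where z: "\<forall>r\<in>V - {p}. (\<Sum>j<J. b r j * z j) = 0" "(\<Sum>j<J. b p j * z j) \<noteq> 0"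
    using exists_dual_vector by blast
  have "(\<Sum>j<J. contract K T x i j * z j) = 0" if i: "i < I" for i
  proof -
    have "(\<Sum>j<J. contract K T x i j * z j) =
        (\<Sum>r\<in>V. a r i * (form K c' r x * (\<Sum>j<J. b r j * z j)))"
      by (rule contract_vector[OF i, of U]) (use x in auto)
    also have "\<dots> = 0"
    proof (rule sum.neutral, rule ballI)
      fix r assume "r \<in> V"
      then show "a r i * (form K c' r x * (\<Sum>j<J. b r j * z j)) = 0"
        using z(1) x(2)[of p] by (cases "r = p") auto
    qed
    finally show ?thesis .
  qed
  then show ?thesis using z(2) y_nonzero_form by auto
qed

lemma a_nonzero: "\<exists>i<I. a p i \<noteq> 0"
proof (rule ccontr)
  assume 0: "\<not> ?thesis"
  obtain ii jj where ii: "\<forall>u<m. ii u < I" and jj: "\<forall>v<m. jj v < J"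
    and ind: "\<forall>w. (\<forall>u<m. (\<Sum>s\<in>V. a s (ii u) * w s) = 0) \<longrightarrow> (\<forall>r\<in>V. w r = 0)"
    and dual: "\<forall>w. (\<exists>v<m. w v \<noteq> 0) \<longrightarrow> (\<exists>r\<in>V. (\<Sum>v<m. b r (jj v) * w v) \<noteq> 0)"
    using selected_minor by blast
  define w :: "nat \<Rightarrow> real" where "w s = (if s = p then 1 else 0)" for s
  have "(\<Sum>s\<in>V. a s (ii u) * w s) = 0" if "u < m" for u
    using 0 ii that by (intro sum.neutral) (simp add: w_def)
  then have "w p = 0" using ind p by blast
  then have False by (simp add: w_def)
  then show False .
qed

end

section \<open>Uniqueness\<close>

lemma exists_subset_with_card:
  assumes "n \<le> card A" shows "\<exists>S\<subseteq>A. card S = n"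
  using obtain_subset_with_card_n[OF assms] by blast

text \<open>Exchanging the first two modes transfers results on the factors \<open>a r\<close> to the factors \<open>b r\<close>.\<close>

definition swap_modes :: "tensor \<Rightarrow> tensor" where
  "swap_modes T i j k = T j i k"

lemma contract_swap_modes: "contract K (swap_modes T) x i j = contract K T x j i"
  by (simp add: contract_def swap_modes_def)

lemma low_rank_at_swap_modesI:
  assumes "low_rank_at m I J K T x" shows "low_rank_at m J I K (swap_modes T) x"
  unfolding low_rank_at_def contract_swap_modes
proof (intro allI impI)
  fix i j :: "nat \<Rightarrow> nat"
  assume i: "\<forall>u<m. i u < J" and j: "\<forall>v<m. j v < I"
  have "mat m m (\<lambda>(u, v). contract K T x (j v) (i u)) =
      transpose_mat (mat m m (\<lambda>(u, v). contract K T x (j u) (i v)))"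
    by (intro eq_matI) auto
  moreover have "det (mat m m (\<lambda>(u, v). contract K T x (j u) (i v))) = 0"
    by (rule assms[unfolded low_rank_at_def, rule_format]) (use i j in auto)
  ultimately show "det (mat m m (\<lambda>(u, v). contract K T x (j v) (i u))) = 0"
    by (simp only: det_transpose[OF mat_carrier])
qed

lemma swap_modes_swap_modes [simp]: "swap_modes (swap_modes T) = T"
  by (intro ext) (simp add: swap_modes_def)

lemma low_rank_at_swap_modes: "low_rank_at m J I K (swap_modes T) x \<longleftrightarrow> low_rank_at m I J K T x"
  using low_rank_at_swap_modesI[of m I J K T x] low_rank_at_swap_modesI[of m J I K "swap_modes T" x]
  by auto

lemma decomposes_swap_modes: "decomposes I J K R T a b c \<Longrightarrow> decomposes J I K R (swap_modes T) b a c"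
  by (auto simp: decomposes_def swap_modes_def mult.commute)

lemma (in rank_drop) rank_drop_swap_modes: "rank_drop J I K R m (swap_modes T) c"
  by unfold_locales (use K2 KR m gp drop in \<open>auto simp: low_rank_at_swap_modes\<close>)

lemma (in adjacent_points) adjacent_points_swap_modes:
  "adjacent_points J I K R m (swap_modes T) c c' b a U p q x y"
  unfolding adjacent_points_def adjacent_points_axioms_def
  using rank_drop_swap_modes decomposes_swap_modes[OF dec] gp' U p q pq x y by blast

context rank_drop
begin

text \<open>A short sum forces low rank, so \<open>x\<close> is a zero of \<open>K - 1\<close> forms, all but one of which define a pencil with
  independent factors. At \<open>x\<close> all terms of the pencil but the term \<open>p\<close> survive. A vector \<open>w\<close> that is orthogonal
  to \<open>b p\<close> and to the right factors of the short sum would be orthogonal to all right factors of the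
  pencil.\<close>

lemma not_few_terms:
  fixes f g :: "'a \<Rightarrow> nat \<Rightarrow> real"
  assumes dec: "decomposes I J K R T a b c" and x: "nonzero K x"
    and W: "finite W" "card W \<le> m - 2"
    and few: "\<And>i j. i < I \<Longrightarrow> j < J \<Longrightarrow> contract K T x i j = (\<Sum>r\<in>W. f r i * g r j)"
  shows False
proof -
  have cW: "card W < m" using W(2) m by simp
  have "K - 1 \<le> card {r. r < R \<and> form K c r x = 0}"
    by (rule drop[OF x low_rank_atI[OF W(1) cW few]])
  then obtain S where S: "S \<subseteq> {r. r < R \<and> form K c r x = 0}" "card S = K - 1"
    using exists_subset_with_card by blast
  have SR: "S \<subseteq> {..<R}" and finS: "finite S" using S(1) finite_subset[of S "{..<R}"] by auto
  have "S \<noteq> {}" using S(2) K2 by auto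
  then obtain p where p: "p \<in> S" by blast
  define U where "U = S - {p}"
  have U: "U \<subseteq> {..<R}" "card U = K - 2" "p \<notin> U" "finite U"
    using SR S(2) p finS by (auto simp: U_def)
  have SU: "insert p U \<subseteq> S" using p by (auto simp: U_def)
  have "\<not> {..<R} \<subseteq> S" using card_mono[OF finS, of "{..<R}"] S(2) KR K2 by auto
  then obtain q where q: "q < R" "q \<notin> S" by blast
  have qU: "q \<notin> U" "p \<noteq> q" using q SU p by auto
  have "card (insert q U) < K" using U(2,4) qU(1) K2 by simp
  then obtain y where y: "nonzero K y" "\<forall>r\<in>insert q U. form K c r y = 0"
    using exists_common_zero[of "insert q U" K c] U(4) by blast
  interpret adjacent_points I J K R m T c c a b U p q x y
  proof unfold_locales
    show "p < R" using p SR by auto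
    show "form K c r x = 0" if "r \<in> insert p U" for r using that SU S(1) by auto
    show "form K c r y = 0" if "r \<in> insert q U" for r using that y(2) by blast
  qed (fact dec gp U q qU x y)+
  note x_zero = x(2)
  obtain ii jj where ii: "\<forall>u<m. ii u < I" and jj: "\<forall>v<m. jj v < J"
    and ind: "\<forall>w. (\<forall>u<m. (\<Sum>s\<in>V. a s (ii u) * w s) = 0) \<longrightarrow> (\<forall>r\<in>V. w r = 0)"
    and dual: "\<forall>w. (\<exists>v<m. w v \<noteq> 0) \<longrightarrow> (\<exists>r\<in>V. (\<Sum>v<m. b r (jj v) * w v) \<noteq> 0)"
    using selected_minor by blast
  \<comment> \<open>\<open>None\<close> stands for \<open>b p\<close>, and \<open>Some r\<close> for the right factor \<open>r\<close> of the short sum.\<close>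
  define h where "h r v = (case r of None \<Rightarrow> b p (jj v) | Some r' \<Rightarrow> g r' (jj v))" for r v
  have "card (insert None (Some ` W)) = card W + 1"
    using W(1) by (simp add: card_image)
  then have "card (insert None (Some ` W)) < m" using W(2) m by simp
  then obtain w where w: "\<exists>v<m. w v \<noteq> 0"
    and hw: "\<forall>r\<in>insert None (Some ` W). (\<Sum>v<m. h r v * w v) = 0"
    using underdetermined_system_set[of "insert None (Some ` W)" m h] W(1) by blast
  have "(\<Sum>s\<in>V. a s (ii u) * (form K c s x * (\<Sum>v<m. b s (jj v) * w v))) = 0" if u: "u < m" for u
  proof -
    have xU: "form K c r x = 0" if "r \<in> U" for r using that x_zero by blast
    have "(\<Sum>v<m. contract K T x (ii u) (jj v) * w v) =
        (\<Sum>v<m. (\<Sum>s\<in>V. a s (ii u) * (form K c s x * b s (jj v))) * w v)"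
      by (rule sum.cong[OF refl])
        (use contract_decomposes_restrict[OF dec _ _ xU refl] ii jj u in auto)
    also have "\<dots> = (\<Sum>s\<in>V. a s (ii u) * (\<Sum>v<m. form K c s x * b s (jj v) * w v))"
      using outer_sum_kernel[where f="\<lambda>s. a s \<circ> ii" and g="\<lambda>s v. form K c s x * b s (jj v)"] by simp
    also have "\<dots> = (\<Sum>s\<in>V. a s (ii u) * (form K c s x * (\<Sum>v<m. b s (jj v) * w v)))"
      by (simp add: sum_distrib_left mult.assoc)
    finally have 1: "(\<Sum>v<m. contract K T x (ii u) (jj v) * w v) = \<dots>" .
    have "(\<Sum>v<m. contract K T x (ii u) (jj v) * w v) =
        (\<Sum>v<m. (\<Sum>s\<in>W. f s (ii u) * g s (jj v)) * w v)"
      by (rule sum.cong[OF refl]) (use few ii jj u in auto)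
    also have "\<dots> = (\<Sum>s\<in>W. f s (ii u) * (\<Sum>v<m. g s (jj v) * w v))"
      using outer_sum_kernel[where f="\<lambda>s. f s \<circ> ii" and g="\<lambda>s v. g s (jj v)"] by simp
    also have "\<dots> = 0"
      by (rule sum.neutral) (use hw in \<open>auto simp: h_def\<close>)
    finally show ?thesis using 1 by simp
  qed
  then have *: "form K c r x * (\<Sum>v<m. b r (jj v) * w v) = 0" if "r \<in> V" for r
    using ind[THEN spec, of "\<lambda>s. form K c s x * (\<Sum>v<m. b s (jj v) * w v)"] that by blast
  have "(\<Sum>v<m. b r (jj v) * w v) = 0" if "r \<in> V" for r
  proof (cases "r = p")
    case True
    then show ?thesis using hw by (simp add: h_def)
  next
    case False
    then show ?thesis using *[OF that] x_nonzero_forms[of r] that by simp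
  qed
  then show False using dual w by blast
qed

text \<open>If the decomposition were shorter, or if \<open>K\<close> of its forms had a nonzero common zero, then too few of its
  terms would survive at a nonzero point.\<close>

lemma decomposition_length_and_position:
  assumes dec: "decomposes I J K R T a b c" and dec': "decomposes I J K R' T a' b' c'" and R': "R' \<le> R"
  shows "R' = R \<and> general_position K R c'"
proof
  have few: False if S: "S \<subseteq> {..<R'}" "R' - card S \<le> m - 2" and x: "nonzero K x"
    and z: "\<And>r. r \<in> S \<Longrightarrow> form K c' r x = 0" for S x
  proof -
    have "card ({..<R'} - S) \<le> m - 2"
      using S card_Diff_subset[of S "{..<R'}"] finite_subset[OF S(1)] by simp
    from not_few_terms[OF dec x _ this contract_decomposes_restrict[OF dec' _ _ z refl]]
    show False by simp
  qed
  show eq: "R' = R"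
  proof (rule ccontr)
    assume "R' \<noteq> R"
    then have lt: "R' < R" using R' by simp
    define S where "S = {..<min R' (K - 1)}"
    have "finite S" "card S < K" using K2 by (auto simp: S_def)
    then obtain x where x: "nonzero K x" "\<And>r. r \<in> S \<Longrightarrow> form K c' r x = 0"
      using exists_common_zero[of S K c'] by blast
    show False
    proof (rule few[of S x])
      show "S \<subseteq> {..<R'}" by (auto simp: S_def)
      show "R' - card S \<le> m - 2" using lt K2 KR m by (cases "R' \<le> K - 1") (auto simp: S_def)
    qed (use x in auto)
  qed
  show "general_position K R c'"
    unfolding general_position_def
  proof (intro allI impI)
    fix S x assume S: "S \<subseteq> {..<R}" "card S = K" and z: "\<forall>r\<in>S. form K c' r x = 0"
    show "\<not> nonzero K x"
    proof
      assume x: "nonzero K x"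
      show False by (rule few[of S x]) (use S z m eq x in auto)
    qed
  qed
qed

end

text \<open>The common zeros of all forms of \<open>c'\<close> with index in \<open>U'\<close> make up a plane that contains \<open>m\<close> of the lines
  of low rank. A plane spanned by two such lines at which only \<open>z < K - 2\<close> forms of \<open>c\<close> vanish
  identically contains at most \<open>(R - z) / (K - 1 - z) < m\<close> of them. So the plane is
  also cut out by \<open>K - 2\<close> forms of \<open>c\<close>.\<close>

lemma (in rank_drop) exists_common_adjacent_points:
  assumes dec: "decomposes I J K R T a b c"
    and dec': "decomposes I J K R T a' b' c'" and gp': "general_position K R c'" and r: "r < R"
  shows "\<exists>U' U s p q x y. adjacent_points I J K R m T c c' a' b' U' r s x y \<and>
    adjacent_points I J K R m T c c a b U p q x y"
proof -
  have "K - 2 \<le> card ({..<R} - {r})" using KR r by simp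
  then obtain U' where U': "U' \<subseteq> {..<R} - {r}" "card U' = K - 2"
    using exists_subset_with_card by blast
  have U'R: "U' \<subseteq> {..<R}" and finU': "finite U'" and rU': "r \<notin> U'"
    using U'(1) finite_subset[of U' "{..<R}"] by auto
  define V where "V = {..<R} - U'"
  have finV: "finite V" and cardV: "card V = m" and rV: "r \<in> V"
    using card_Diff_subset[OF finU' U'R] U'(2) K2 KR m r rU' by (auto simp: V_def)
  have "\<exists>x. nonzero K x \<and> (\<forall>s\<in>insert t U'. form K c' s x = 0)" for t
  proof -
    have "finite (insert t U')" "card (insert t U') < K" using finU' U'(2) K2 by (auto simp: card_insert_if)
    then show ?thesis using exists_common_zero[of "insert t U'" K c'] by blast
  qed
  then obtain z where z: "\<And>t. nonzero K (z t)" "\<And>t s. s \<in> insert t U' \<Longrightarrow> form K c' s (z t) = 0"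
    by metis
  have adj: "adjacent_points I J K R m T c c' a' b' U' t u (z t) (z u)"
    if "t \<in> V" "u \<in> V" "t \<noteq> u" for t u
    by unfold_locales (use that U'R U'(2) z dec' gp' in \<open>auto simp: V_def\<close>)
  define P where "P t = {s. s < R \<and> form K c s (z t) = 0}" for t
  have finP: "finite (P t)" and PR: "P t \<subseteq> {..<R}" for t by (auto simp: P_def)
  have cardP: "card (P t) = K - 1" if t: "t \<in> V" for t
  proof -
    have tR: "insert t U' \<subseteq> {..<R}" using t U'R by (auto simp: V_def)
    have "card ({..<R} - insert t U') < m"
      using card_Diff_subset[of "insert t U'" "{..<R}"] tR finU' U'(2) t K2 KR m by (simp add: V_def)
    from low_rank_atI[OF _ this contract_decomposes_restrict[OF dec' _ _ z(2) refl]]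
    have "low_rank_at m I J K T (z t)" by simp
    from drop[OF z(1) this] card_zero_forms_less[OF z(1), of t] show ?thesis
      unfolding P_def by linarith
  qed
  have inter: "P t \<inter> P u \<subseteq> P v" if t: "t \<in> V" and u: "u \<in> V" and v: "v \<in> V" and tu: "t \<noteq> u" for t u v
  proof -
    interpret tu: adjacent_points I J K R m T c c' a' b' U' t u "z t" "z u" by (rule adj[OF t u tu])
    interpret ut: adjacent_points I J K R m T c c' a' b' U' u t "z u" "z t"
      by (rule adj[OF u t tu[symmetric]])
    \<comment> \<open>Both forms \<open>t\<close> and \<open>u\<close> of \<open>c'\<close> vanish at \<open>z v - l z u - n z t\<close>, in addition to those in \<open>U'\<close>.\<close>
    define l where "l = form K c' t (z v) / form K c' t (z u)"
    define n where "n = form K c' u (z v) / form K c' u (z t)"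
    have lin: "form K d s (\<lambda>k. 1 * (1 * z v k + (- l) * z u k) + (- n) * z t k) =
        form K d s (z v) - l * form K d s (z u) - n * form K d s (z t)" for d s
      unfolding form_add by simp
    have "\<not> nonzero K (\<lambda>k. 1 * (1 * z v k + (- l) * z u k) + (- n) * z t k)"
    proof (rule general_positionD[OF gp'])
      show "insert t (insert u U') \<subseteq> {..<R}" using t u U'R by (auto simp: V_def)
      show "K \<le> card (insert t (insert u U'))"
        using t u tu finU' U'(2) K2 by (simp add: V_def)
      fix s assume s: "s \<in> insert t (insert u U')"
      show "form K c' s (\<lambda>k. 1 * (1 * z v k + (- l) * z u k) + (- n) * z t k) = 0"
        unfolding lin
      proof -
        consider "s = t" | "s = u" | "s \<in> U'" using s by blast
        then show "form K c' s (z v) - l * form K c' s (z u) - n * form K c' s (z t) = 0"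
        proof cases
          case 1
          then show ?thesis using z(2)[of t t] tu.y_nonzero_form by (simp add: l_def)
        next
          case 2
          then show ?thesis using z(2)[of u u] ut.y_nonzero_form by (simp add: n_def)
        next
          case 3
          then show ?thesis using z(2) by simp
        qed
      qed
    qed
    then have "form K c s (\<lambda>k. 1 * (1 * z v k + (- l) * z u k) + (- n) * z t k) = 0" for s
      unfolding form_def by (intro sum.neutral) auto
    then have eq: "form K c s (z v) - l * form K c s (z u) - n * form K c s (z t) = 0" for s
      unfolding lin .
    show ?thesis
    proof
      fix s assume "s \<in> P t \<inter> P u"
      then show "s \<in> P v" using eq[of s] by (simp add: P_def)
    qed
  qed
  have "\<not> V \<subseteq> {r}" using card_mono[of "{r}" V] cardV m by auto
  then obtain s where s: "s \<in> V" "s \<noteq> r" by blast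
  \<comment> \<open>\<open>Z\<close> consists of the forms of \<open>c\<close> that vanish on the whole plane.\<close>
  define Z where "Z = P r \<inter> P s"
  have interZ: "P t \<inter> P u = Z" if "t \<in> V" "u \<in> V" "t \<noteq> u" for t u
    unfolding Z_def using inter[OF that(1,2) _ that(3)] inter[OF rV s(1) _ s(2)[symmetric]] s rV that
    by blast
  have ZP: "Z \<subseteq> P t" if "t \<in> V" for t
    unfolding Z_def by (rule inter[OF rV s(1) that s(2)[symmetric]])
  have finZ: "finite Z" and ZR: "Z \<subseteq> {..<R}" using finP PR by (auto simp: Z_def)
  have cardZ_le: "card Z \<le> K - 1" using card_mono[OF finP ZP[OF rV]] cardP[OF rV] by simp
  interpret rs: adjacent_points I J K R m T c c' a' b' U' r s "z r" "z s" by (rule adj) (use rV s in auto)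
  have cardZ: "card Z < K - 1"
  proof (rule ccontr)
    assume "\<not> ?thesis"
    with cardZ_le have eq: "card Z = K - 1" by simp
    have "\<not> {..<R} \<subseteq> Z" using card_mono[OF finZ, of "{..<R}"] eq KR K2 by auto
    then obtain q where q: "q < R" "q \<notin> Z" by blast
    have gpq: "\<not> nonzero K w" if "form K c q w = 0" "\<And>t. t \<in> Z \<Longrightarrow> form K c t w = 0" for w
      by (rule general_positionD[OF gp, of "insert q Z"]) (use that q ZR finZ eq K2 in auto)
    have zr: "form K c t (z r) = 0" and zs: "form K c t (z s) = 0" if "t \<in> Z" for t
      using that by (auto simp: Z_def P_def)
    have "\<not> nonzero K (\<lambda>k. form K c q (z s) * z r k + (- form K c q (z r)) * z s k)"
      by (rule gpq; unfold form_add) (use zr zs in auto)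
    from rs.independent_points[OF this] have "form K c q (z r) = 0" by simp
    from gpq[OF this zr] z(1) show False by blast
  qed
  define d where "d = K - 1 - card Z"
  have "card (\<Union>t\<in>V. P t - Z) = (\<Sum>t\<in>V. card (P t - Z))"
  proof (rule card_UN_disjoint)
    show "\<forall>t\<in>V. finite (P t - Z)" using finP by simp
    show "\<forall>t\<in>V. \<forall>u\<in>V. t \<noteq> u \<longrightarrow> (P t - Z) \<inter> (P u - Z) = {}" using interZ by blast
  qed (rule finV)
  also have "\<dots> = (\<Sum>t\<in>V. d)"
    by (rule sum.cong) (use card_Diff_subset[OF finZ ZP] cardP in \<open>auto simp: d_def\<close>)
  also have "\<dots> = m * d" by (simp add: cardV)
  finally have "m * d = card (\<Union>t\<in>V. P t - Z)" ..
  also have "\<dots> \<le> card ({..<R} - Z)" by (rule card_mono) (use PR in auto)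
  also have "\<dots> = R - card Z" using card_Diff_subset[OF finZ ZR] by simp
  also have "\<dots> = m - 1 + d" using m d_def cardZ KR by simp
  \<comment> \<open>The sets \<open>P t - Z\<close> of \<open>d\<close> forms each are disjoint.\<close>
  finally have le: "m * d \<le> m - 1 + d" .
  have d1: "d = 1"
  proof (rule ccontr)
    assume "d \<noteq> 1"
    moreover have "d \<noteq> 0" using cardZ by (simp add: d_def)
    ultimately obtain d' where d': "d = d' + 2" by (metis One_nat_def add_2_eq_Suc' not0_implies_Suc)
    obtain m' where m': "m = m' + 2" using m by simp
    show False using le unfolding d' m' by simp
  qed
  have single: "\<exists>p. P t = insert p Z \<and> p \<notin> Z" if t: "t \<in> V" for t
  proof -
    have "card (P t - Z) = 1" using card_Diff_subset[OF finZ ZP[OF t]] cardP[OF t] d1 d_def by simp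
    then obtain p where "P t - Z = {p}" by (auto simp: card_1_singleton_iff)
    then show ?thesis using ZP[OF t] by blast
  qed
  obtain p where p: "P r = insert p Z" "p \<notin> Z" using single[OF rV] by blast
  obtain q where q: "P s = insert q Z" "q \<notin> Z" using single[OF s(1)] by blast
  have pq: "p \<noteq> q" using interZ[OF rV s(1)] s(2) p q by auto
  have "adjacent_points I J K R m T c c a b Z p q (z r) (z s)"
  proof unfold_locales
    show "card Z = K - 2" using d1 cardZ d_def by simp
    show "p < R" "q < R" using p q PR by blast+
    show "form K c t (z r) = 0" if "t \<in> insert p Z" for t using that p by (auto simp: P_def)
    show "form K c t (z s) = 0" if "t \<in> insert q Z" for t using that q by (auto simp: P_def)
  qed (use dec gp ZR p q pq z in auto)
  then show ?thesis using rs.adjacent_points_axioms by blast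
qed

text \<open>A vector in the kernel of the contraction by \<open>x\<close> is mapped by the contraction by \<open>y\<close> to the line
  of \<open>a p\<close> and to the line of \<open>a' r\<close>.\<close>

lemma adjacent_points_match_left:
  assumes A': "adjacent_points I J K R m T c c' a' b' U' r s x y"
    and A: "adjacent_points I J K R m T c c a b U p q x y"
  shows "\<exists>\<alpha>. \<alpha> \<noteq> 0 \<and> (\<forall>i<I. a' r i = \<alpha> * a p i)"
proof -
  interpret A': adjacent_points I J K R m T c c' a' b' U' r s x y by (rule A')
  interpret A: adjacent_points I J K R m T c c a b U p q x y by (rule A)
  obtain z where ker: "\<forall>i<I. (\<Sum>j<J. contract K T x i j * z j) = 0"
    and nz: "form K c' r y * (\<Sum>j<J. b' r j * z j) \<noteq> 0" (is "?k' \<noteq> 0")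
    using A'.exists_kernel_vector by blast
  let ?k = "form K c p y * (\<Sum>j<J. b p j * z j)"
  have "?k' * a' r i = ?k * a p i" if "i < I" for i
    using A'.contract_kernel[of z i] A.contract_kernel[of z i] ker that by simp
  then have eq: "a' r i = ?k / ?k' * a p i" if "i < I" for i using nz that by (simp add: field_simps)
  moreover have "?k / ?k' \<noteq> 0" using eq A'.a_nonzero by force
  ultimately show ?thesis by blast
qed

lemma (in rank_drop) decomposition_terms_match:
  assumes "decomposes I J K R T a b c"
    and "decomposes I J K R T a' b' c'" and "general_position K R c'" and "r < R"
  shows "\<exists>p \<alpha> \<beta>. p < R \<and> \<alpha> \<noteq> 0 \<and> \<beta> \<noteq> 0 \<and> (\<forall>i<I. a' r i = \<alpha> * a p i) \<and> (\<forall>j<J. b' r j = \<beta> * b p j)"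
proof -
  obtain U' U s p q x y where A': "adjacent_points I J K R m T c c' a' b' U' r s x y"
    and A: "adjacent_points I J K R m T c c a b U p q x y"
    using exists_common_adjacent_points[OF assms] by blast
  obtain \<alpha> where \<alpha>: "\<alpha> \<noteq> 0" "\<forall>i<I. a' r i = \<alpha> * a p i"
    using adjacent_points_match_left[OF A' A] by blast
  obtain \<beta> where \<beta>: "\<beta> \<noteq> 0" "\<forall>i<J. b' r i = \<beta> * b p i"
    using adjacent_points_match_left[OF A'[THEN adjacent_points.adjacent_points_swap_modes]
        A[THEN adjacent_points.adjacent_points_swap_modes]] by blast
  have "p < R" using A unfolding adjacent_points_def adjacent_points_axioms_def by blast
  with \<alpha> \<beta> show ?thesis by blast
qed

definition khatri_rao_independent ::
  "nat \<Rightarrow> nat \<Rightarrow> nat \<Rightarrow> (nat \<Rightarrow> nat \<Rightarrow> real) \<Rightarrow> (nat \<Rightarrow> nat \<Rightarrow> real) \<Rightarrow> bool" where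
  "khatri_rao_independent I J R a b \<longleftrightarrow>
     (\<forall>w. (\<forall>i<I. \<forall>j<J. (\<Sum>r<R. a r i * b r j * w r) = 0) \<longrightarrow> (\<forall>r<R. w r = 0))"

text \<open>The equivalence of \<open>cpd_unique\<close>, in coordinates.\<close>

definition same_terms ::
  "nat \<Rightarrow> nat \<Rightarrow> nat \<Rightarrow> nat \<Rightarrow> (nat \<Rightarrow> nat \<Rightarrow> real) \<Rightarrow> (nat \<Rightarrow> nat \<Rightarrow> real) \<Rightarrow> (nat \<Rightarrow> nat \<Rightarrow> real) \<Rightarrow>
    (nat \<Rightarrow> nat \<Rightarrow> real) \<Rightarrow> (nat \<Rightarrow> nat \<Rightarrow> real) \<Rightarrow> (nat \<Rightarrow> nat \<Rightarrow> real) \<Rightarrow> bool" where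
  "same_terms I J K R a b c a' b' c' \<longleftrightarrow>
     (\<exists>\<pi> \<alpha> \<beta> \<gamma>. \<pi> permutes {..<R} \<and>
        (\<forall>r<R. \<alpha> r * \<beta> r * \<gamma> r = 1 \<and> (\<forall>i<I. a' r i = \<alpha> r * a (\<pi> r) i) \<and>
          (\<forall>j<J. b' r j = \<beta> r * b (\<pi> r) j) \<and> (\<forall>k<K. c' r k = \<gamma> r * c (\<pi> r) k)))"

text \<open>Comparing the coefficients of the independent matrices \<open>a s b s\<^sup>T\<close> expresses \<open>c s\<close> by those \<open>c' r\<close> that are matched
  with \<open>s\<close>. Since \<open>c s\<close> is not zero, every \<open>s\<close> is matched, and the matching is a permutation.\<close>

lemma same_termsI:
  assumes dec: "decomposes I J K R T a b c" and dec': "decomposes I J K R T a' b' c'"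
    and ind: "khatri_rao_independent I J R a b" and cnz: "\<And>s. s < R \<Longrightarrow> nonzero K (c s)"
    and match: "\<And>r. r < R \<Longrightarrow> \<exists>p \<alpha> \<beta>. p < R \<and> \<alpha> \<noteq> 0 \<and> \<beta> \<noteq> 0 \<and>
      (\<forall>i<I. a' r i = \<alpha> * a p i) \<and> (\<forall>j<J. b' r j = \<beta> * b p j)"
  shows "same_terms I J K R a b c a' b' c'"
proof -
  obtain p \<alpha> \<beta> where p: "\<And>r. r < R \<Longrightarrow> p r < R" and nz: "\<And>r. r < R \<Longrightarrow> \<alpha> r \<noteq> 0" "\<And>r. r < R \<Longrightarrow> \<beta> r \<noteq> 0"
    and ab: "\<And>r i. r < R \<Longrightarrow> i < I \<Longrightarrow> a' r i = \<alpha> r * a (p r) i"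
    "\<And>r j. r < R \<Longrightarrow> j < J \<Longrightarrow> b' r j = \<beta> r * b (p r) j"
  proof -
    define M where "M r t \<longleftrightarrow> fst t < R \<and> fst (snd t) \<noteq> 0 \<and> snd (snd t) \<noteq> 0 \<and>
      (\<forall>i<I. a' r i = fst (snd t) * a (fst t) i) \<and> (\<forall>j<J. b' r j = snd (snd t) * b (fst t) j)" for r t
    have "\<exists>t. M r t" if r: "r < R" for r
    proof -
      obtain p \<alpha> \<beta> where "p < R \<and> \<alpha> \<noteq> 0 \<and> \<beta> \<noteq> 0 \<and>
          (\<forall>i<I. a' r i = \<alpha> * a p i) \<and> (\<forall>j<J. b' r j = \<beta> * b p j)"
        using match[OF r] by blast
      then have "M r (p, \<alpha>, \<beta>)" by (simp add: M_def)
      then show ?thesis ..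
    qed
    then have "\<forall>r. \<exists>t. r < R \<longrightarrow> M r t" by blast
    from choice[OF this] obtain t where "\<forall>r. r < R \<longrightarrow> M r (t r)" by blast
    then show thesis
      by (intro that[of "fst \<circ> t" "fst \<circ> (snd \<circ> t)" "snd \<circ> (snd \<circ> t)"]) (auto simp: M_def)
  qed
  have c: "c s k = (\<Sum>r | r < R \<and> p r = s. \<alpha> r * \<beta> r * c' r k)" if s: "s < R" and k: "k < K" for s k
  proof -
    define w where "w s = c s k - (\<Sum>r | r < R \<and> p r = s. \<alpha> r * \<beta> r * c' r k)" for s
    have "(\<Sum>s<R. a s i * b s j * w s) = 0" if ij: "i < I" "j < J" for i j
    proof -
      have "(\<Sum>s<R. a s i * b s j * (\<Sum>r | r < R \<and> p r = s. \<alpha> r * \<beta> r * c' r k)) =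
          (\<Sum>s<R. \<Sum>r | r \<in> {..<R} \<and> p r = s. a (p r) i * b (p r) j * (\<alpha> r * \<beta> r * c' r k))"
        by (simp add: sum_distrib_left)
      also have "\<dots> = (\<Sum>r<R. a (p r) i * b (p r) j * (\<alpha> r * \<beta> r * c' r k))"
        by (rule sum.group) (use p in auto)
      also have "\<dots> = (\<Sum>r<R. a' r i * b' r j * c' r k)"
        by (rule sum.cong) (use ab ij in auto)
      also have "\<dots> = T i j k" using dec' ij k by (simp add: decomposes_def)
      also have "\<dots> = (\<Sum>s<R. a s i * b s j * c s k)" using dec ij k by (simp add: decomposes_def)
      finally show ?thesis by (simp add: w_def right_diff_distrib sum_subtractf)
    qed
    then have "w s = 0" using ind s unfolding khatri_rao_independent_def by blast
    then show ?thesis by (simp add: w_def)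
  qed
  have "{..<R} \<subseteq> p ` {..<R}"
  proof
    fix s assume "s \<in> {..<R}"
    then obtain k where k: "s < R" "k < K" "c s k \<noteq> 0" using cnz by auto
    then have "{r. r < R \<and> p r = s} \<noteq> {}" using c[of s k] by (metis sum.empty)
    then show "s \<in> p ` {..<R}" by auto
  qed
  then have img: "p ` {..<R} = {..<R}" using p by auto
  then have inj: "inj_on p {..<R}" by (simp add: eq_card_imp_inj_on)
  define \<pi> where "\<pi> r = (if r < R then p r else r)" for r
  have "bij_betw \<pi> {..<R} {..<R}"
    using img inj unfolding bij_betw_def \<pi>_def by (auto simp: inj_on_def cong: image_cong_simp)
  then have perm: "\<pi> permutes {..<R}" by (rule bij_imp_permutes) (auto simp: \<pi>_def)
  have "c (p r) k = \<alpha> r * \<beta> r * c' r k" if "r < R" "k < K" for r k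
  proof -
    have "{r'. r' < R \<and> p r' = p r} = {r}" using inj that by (auto simp: inj_on_def)
    then show ?thesis using c[OF p[OF that(1)] that(2)] by simp
  qed
  then show ?thesis unfolding same_terms_def
    by - (rule exI[of _ \<pi>], rule exI[of _ \<alpha>], rule exI[of _ \<beta>], rule exI[of _ "\<lambda>r. 1 / (\<alpha> r * \<beta> r)"],
      use perm nz ab in \<open>auto simp: \<pi>_def\<close>)
qed

lemma general_position_nonzero:
  assumes gp: "general_position K R c" and "1 \<le> K" "K \<le> R" "s < R"
  shows "nonzero K (c s)"
proof (rule ccontr)
  assume 0: "\<not> ?thesis"
  have "K - 1 \<le> card ({..<R} - {s})" using assms by simp
  then obtain S where S: "S \<subseteq> {..<R} - {s}" "card S = K - 1"
    using exists_subset_with_card by blast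
  have finS: "finite S" using S(1) finite_subset by blast
  have "card S < K" using S(2) assms by simp
  then obtain x where x: "nonzero K x" "\<And>r. r \<in> S \<Longrightarrow> form K c r x = 0"
    using exists_common_zero[OF finS] by blast
  have "\<not> nonzero K x"
  proof (rule general_positionD[OF gp, of "insert s S"])
    show "K \<le> card (insert s S)" using finS S assms(2) by (subst card_insert_disjoint) auto
    show "form K c r x = 0" if "r \<in> insert s S" for r
      using that x(2) 0 by (auto simp: form_def)
  qed (use S assms in auto)
  then show False using x(1) by blast
qed

lemma (in rank_drop) decomposition_unique:
  assumes "decomposes I J K R T a b c" "khatri_rao_independent I J R a b"
    and "decomposes I J K R T a' b' c'"
  shows "same_terms I J K R a b c a' b' c'"
  by (rule same_termsI[OF assms(1,3,2)])
    (use general_position_nonzero[OF gp] K2 KR decomposition_terms_match[OF assms(1,3)]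
      decomposition_length_and_position[OF assms(1,3)] in auto)

lemma same_terms_sym_trans:
  assumes "same_terms I J K R a b c a1 b1 c1" "same_terms I J K R a b c a2 b2 c2"
  shows "same_terms I J K R a1 b1 c1 a2 b2 c2"
proof -
  obtain \<pi>1 \<alpha>1 \<beta>1 \<gamma>1 where 1: "\<pi>1 permutes {..<R}" "\<And>r. r < R \<Longrightarrow> \<alpha>1 r * \<beta>1 r * \<gamma>1 r = (1::real)"
    "\<And>r i. r < R \<Longrightarrow> i < I \<Longrightarrow> a1 r i = \<alpha>1 r * a (\<pi>1 r) i"
    "\<And>r j. r < R \<Longrightarrow> j < J \<Longrightarrow> b1 r j = \<beta>1 r * b (\<pi>1 r) j"
    "\<And>r k. r < R \<Longrightarrow> k < K \<Longrightarrow> c1 r k = \<gamma>1 r * c (\<pi>1 r) k"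
    using assms(1) unfolding same_terms_def by blast
  obtain \<pi>2 \<alpha>2 \<beta>2 \<gamma>2 where 2: "\<pi>2 permutes {..<R}" "\<And>r. r < R \<Longrightarrow> \<alpha>2 r * \<beta>2 r * \<gamma>2 r = (1::real)"
    "\<And>r i. r < R \<Longrightarrow> i < I \<Longrightarrow> a2 r i = \<alpha>2 r * a (\<pi>2 r) i"
    "\<And>r j. r < R \<Longrightarrow> j < J \<Longrightarrow> b2 r j = \<beta>2 r * b (\<pi>2 r) j"
    "\<And>r k. r < R \<Longrightarrow> k < K \<Longrightarrow> c2 r k = \<gamma>2 r * c (\<pi>2 r) k"
    using assms(2) unfolding same_terms_def by blast
  define \<pi> where "\<pi> = inv_into UNIV \<pi>1 \<circ> \<pi>2"
  have perm: "\<pi> permutes {..<R}"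
    unfolding \<pi>_def by (rule permutes_compose[OF 2(1) permutes_inv[OF 1(1)]])
  have \<pi>1: "\<pi>1 (\<pi> r) = \<pi>2 r" for r using 1(1) by (simp add: \<pi>_def permutes_inverses)
  have \<pi>R: "\<pi> r < R" if "r < R" for r using permutes_in_image[OF perm, of r] that by simp
  have nz: "\<alpha>1 r \<noteq> 0" "\<beta>1 r \<noteq> 0" "\<gamma>1 r \<noteq> 0" if "r < R" for r using 1(2)[OF that] by auto
  have nz2: "\<alpha>2 r \<noteq> 0" "\<beta>2 r \<noteq> 0" "\<gamma>2 r \<noteq> 0" if "r < R" for r using 2(2)[OF that] by auto
  have "\<alpha>2 r / \<alpha>1 (\<pi> r) * (\<beta>2 r / \<beta>1 (\<pi> r)) * (\<gamma>2 r / \<gamma>1 (\<pi> r)) = 1" if "r < R" for r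
  proof -
    have "\<alpha>2 r / \<alpha>1 (\<pi> r) * (\<beta>2 r / \<beta>1 (\<pi> r)) * (\<gamma>2 r / \<gamma>1 (\<pi> r)) =
        (\<alpha>2 r * \<beta>2 r * \<gamma>2 r) / (\<alpha>1 (\<pi> r) * \<beta>1 (\<pi> r) * \<gamma>1 (\<pi> r))" by simp
    then show ?thesis using 1(2)[OF \<pi>R[OF that]] 2(2)[OF that] by simp
  qed
  then show ?thesis unfolding same_terms_def
    by - (rule exI[of _ \<pi>], rule exI[of _ "\<lambda>r. \<alpha>2 r / \<alpha>1 (\<pi> r)"],
        rule exI[of _ "\<lambda>r. \<beta>2 r / \<beta>1 (\<pi> r)"], rule exI[of _ "\<lambda>r. \<gamma>2 r / \<gamma>1 (\<pi> r)"],
      use perm nz[OF \<pi>R] nz2 in \<open>auto simp: 1(3-5)[OF \<pi>R] 2(3-5) \<pi>1\<close>)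
qed

section \<open>Bases of null spaces\<close>

lemma full_column_rankD:
  assumes "full_column_rank X"
  shows "distinct (cols X)" "\<not> LinearCombinations.module.lin_dep class_ring (RV (dim_row X)) (set (cols X))"
proof -
  have set: "col X ` {..<dim_col X} = set (cols X)" by (auto simp: cols_def)
  have "inj_on (col X) {..<dim_col X}" using assms by (simp add: full_column_rank_def cols_indpt_def)
  then show "distinct (cols X)" by (simp add: cols_def distinct_map atLeast0LessThan)
  show "\<not> LinearCombinations.module.lin_dep class_ring (RV (dim_row X)) (set (cols X))"
    using assms unfolding full_column_rank_def cols_indpt_def set by blast
qed

lemma mult_mat_vec_index:
  assumes "c < dim_row X" "dim_vec w = dim_col X"
  shows "(X *\<^sub>v w) $ c = (\<Sum>q<dim_col X. X $$ (c, q) * w $ q)"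
  using assms by (auto simp: scalar_prod_def atLeast0LessThan intro!: sum.cong)

lemma full_column_rank_indep:
  assumes "full_column_rank X" and 0: "\<forall>c<dim_row X. (\<Sum>q<dim_col X. X $$ (c, q) * w q) = 0"
    and q: "q < dim_col X"
  shows "w q = 0"
proof (rule ccontr)
  assume wq: "w q \<noteq> 0"
  interpret vec_space "TYPE(real)" "dim_row X" .
  have "lin_dep (set (cols X))"
  proof (rule lin_depI)
    show "X \<in> carrier_mat (dim_row X) (dim_col X)" by simp
    show "vec (dim_col X) w \<in> carrier_vec (dim_col X)" by simp
    show "vec (dim_col X) w \<noteq> 0\<^sub>v (dim_col X)" using wq q by (metis index_vec index_zero_vec(1))
    show "X *\<^sub>v vec (dim_col X) w = 0\<^sub>v (dim_row X)"
      using 0 by (intro eq_vecI) (auto simp: mult_mat_vec_index simp del: index_mult_mat_vec)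
  qed (rule full_column_rankD(1)[OF assms(1)])
  with full_column_rankD(2)[OF assms(1)] show False by (rule notE)
qed

lemma mat_kernel_iff:
  "v \<in> mat_kernel M \<longleftrightarrow> dim_vec v = dim_col M \<and> (\<forall>a<dim_row M. (\<Sum>c<dim_col M. M $$ (a, c) * v $ c) = 0)"
proof -
  have idx: "(M *\<^sub>v v) $ a = (\<Sum>c<dim_col M. M $$ (a, c) * v $ c)"
    if "dim_vec v = dim_col M" "a < dim_row M" for a
    by (rule mult_mat_vec_index[OF that(2,1)])
  show ?thesis
  proof
    assume v: "v \<in> mat_kernel M"
    then have dim: "dim_vec v = dim_col M" and 0: "M *\<^sub>v v = 0\<^sub>v (dim_row M)"
      by (simp_all add: mat_kernel_def carrier_vecD)
    have "(\<Sum>c<dim_col M. M $$ (a, c) * v $ c) = 0" if "a < dim_row M" for a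
      unfolding idx[OF dim that, symmetric] 0 using that by simp
    with dim show "dim_vec v = dim_col M \<and> (\<forall>a<dim_row M. (\<Sum>c<dim_col M. M $$ (a, c) * v $ c) = 0)"
      by blast
  next
    assume v: "dim_vec v = dim_col M \<and> (\<forall>a<dim_row M. (\<Sum>c<dim_col M. M $$ (a, c) * v $ c) = 0)"
    have "M *\<^sub>v v = 0\<^sub>v (dim_row M)"
    proof (rule eq_vecI)
      show "\<And>a. a < dim_vec (0\<^sub>v (dim_row M)) \<Longrightarrow> (M *\<^sub>v v) $ a = 0\<^sub>v (dim_row M) $ a"
        using v by (simp add: idx del: index_mult_mat_vec)
    qed simp
    moreover have "v \<in> carrier_vec (dim_col M)" using v by (intro carrier_vecI) blast
    ultimately show "v \<in> mat_kernel M" unfolding mat_kernel_def by blast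
  qed
qed

lemma null_basis_col_in_kernel:
  assumes "is_null_basis M N" "q < dim_col N"
  shows "col N q \<in> mat_kernel M"
proof -
  interpret vec_space "TYPE(real)" "dim_col M" .
  have "set (cols N) \<subseteq> carrier_vec (dim_col M)"
    using assms(1) cols_dim[of N] by (simp add: is_null_basis_def)
  moreover have "col N q \<in> set (cols N)" using assms(2) by (auto simp: cols_def)
  ultimately have "col N q \<in> span (set (cols N))" using in_own_span by blast
  then show ?thesis using assms(1) by (simp add: is_null_basis_def)
qed

lemma null_basis_expand:
  assumes "is_null_basis M N" "v \<in> mat_kernel M"
  shows "\<exists>w. \<forall>c<dim_col M. v $ c = (\<Sum>q<dim_col N. N $$ (c, q) * w q)"
proof -
  interpret vec_space "TYPE(real)" "dim_col M" .
  have N: "N \<in> carrier_mat (dim_col M) (dim_col N)" and fr: "full_column_rank N"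
    using assms(1) by (auto simp: is_null_basis_def)
  have sub: "set (cols N) \<subseteq> carrier_vec (dim_col M)" using cols_dim[of N] N by auto
  have "v \<in> span (set (cols N))" using assms by (simp add: is_null_basis_def)
  then obtain a where "v = lincomb a (set (cols N))" using finite_in_span[OF _ sub] by auto
  then have v: "v = N *\<^sub>v vec (dim_col N) (\<lambda>i. a (col N i))"
    using mat_mult_eq_lincomb[OF N full_column_rankD(1)[OF fr]] by simp
  have "v $ c = (\<Sum>q<dim_col N. N $$ (c, q) * a (col N q))" if "c < dim_col M" for c
  proof -
    have "c < dim_row N" using that N by simp
    then have "(N *\<^sub>v vec (dim_col N) (\<lambda>i. a (col N i))) $ c =
        (\<Sum>q<dim_col N. N $$ (c, q) * vec (dim_col N) (\<lambda>i. a (col N i)) $ q)"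
      by (rule mult_mat_vec_index) simp
    then show ?thesis unfolding v[symmetric] by simp
  qed
  then show ?thesis by (intro exI[of _ "\<lambda>q. a (col N q)"]) simp
qed

lemma null_basis_exists:
  "\<exists>N. is_null_basis M N \<and> dim_col N = subspace_dim (dim_col M) (mat_kernel M)"
proof -
  define nc where "nc = dim_col M"
  have M: "M \<in> carrier_mat (dim_row M) nc" by (simp add: nc_def)
  interpret kernel "dim_row M" nc M by unfold_locales (rule M)
  obtain B where B: "finite B" "basis B" using kernel_basis_exists[OF M] by blast
  have sub: "B \<subseteq> mat_kernel M" and li: "lin_indpt B" and gen: "span B = mat_kernel M"
    using B(2) unfolding Ker.basis_def by auto
  have subc: "B \<subseteq> carrier_vec nc" using sub mat_kernel_carrier[OF M] by blast
  obtain xs where xs: "set xs = B" "distinct xs" using finite_distinct_list[OF B(1)] by blast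
  define N where "N = mat_of_cols nc xs"
  have cols: "cols N = xs" unfolding N_def using xs subc by (intro cols_mat_of_cols) auto
  have set: "col N ` {..<dim_col N} = set (cols N)" by (auto simp: cols_def)
  have "inj_on (col N) {..<dim_col N}"
    using xs(2) unfolding cols[symmetric] by (simp add: cols_def distinct_map atLeast0LessThan)
  moreover have "\<not> NC.lin_dep B" using li lindep_same[OF sub] by simp
  ultimately have "full_column_rank N"
    unfolding full_column_rank_def cols_indpt_def set cols xs(1) by (simp add: N_def)
  moreover have "NC.span (set (cols N)) = mat_kernel M"
    unfolding cols xs(1) using gen span_same[OF sub] by simp
  ultimately have "is_null_basis M N"
    unfolding is_null_basis_def nc_def[symmetric] by (simp add: N_def)
  moreover have "dim_col N = subspace_dim (dim_col M) (mat_kernel M)"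
    using Ker.dim_basis[OF B] distinct_card[OF xs(2)] xs(1)
    unfolding subspace_dim_def nc_def[symmetric] by (simp add: N_def)
  ultimately show ?thesis by blast
qed

text \<open>The Steinitz bound, for families that are given by coordinates.\<close>

lemma combination_indep_card_le:
  fixes f g :: "nat \<Rightarrow> nat \<Rightarrow> real"
  assumes f: "\<And>q. q < Q \<Longrightarrow> \<exists>w. \<forall>c<N. f q c = (\<Sum>p<P. g p c * w p)"
    and indep: "\<And>w. \<forall>c<N. (\<Sum>q<Q. f q c * w q) = 0 \<Longrightarrow> \<forall>q<Q. w q = 0"
  shows "Q \<le> P"
proof (rule ccontr)
  assume "\<not> Q \<le> P"
  then have "P < Q" by simp
  have "\<forall>q. \<exists>w. q < Q \<longrightarrow> (\<forall>c<N. f q c = (\<Sum>p<P. g p c * w p))" using f by blast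
  from choice[OF this] obtain w where w: "\<And>q c. q < Q \<Longrightarrow> c < N \<Longrightarrow> f q c = (\<Sum>p<P. g p c * w q p)"
    by blast
  obtain y where y: "\<exists>q<Q. y q \<noteq> 0" "\<forall>p<P. (\<Sum>q<Q. w q p * y q) = 0"
    using underdetermined_system[OF \<open>P < Q\<close>, of "\<lambda>p q. w q p"] by blast
  have "(\<Sum>q<Q. f q c * y q) = 0" if c: "c < N" for c
  proof -
    have "(\<Sum>q<Q. f q c * y q) = (\<Sum>q<Q. (\<Sum>p<P. g p c * w q p) * y q)"
      using w c by simp
    also have "\<dots> = (\<Sum>p<P. g p c * (\<Sum>q<Q. w q p * y q))"
      using outer_sum_kernel[where f="\<lambda>p c. g p c" and g="\<lambda>p q. w q p"] by simp
    also have "\<dots> = 0" using y(2) by simp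
    finally show ?thesis .
  qed
  then show False using indep y(1) by blast
qed

text \<open>As many independent combinations as there are generators generate as much.\<close>

lemma combination_exchange:
  fixes f g :: "nat \<Rightarrow> nat \<Rightarrow> real"
  assumes f: "\<And>q. q < Q \<Longrightarrow> \<exists>w. \<forall>c<N. f q c = (\<Sum>p<Q. g p c * w p)"
    and indep: "\<And>w. \<forall>c<N. (\<Sum>q<Q. f q c * w q) = 0 \<Longrightarrow> \<forall>q<Q. w q = 0"
    and v: "\<exists>w. \<forall>c<N. v c = (\<Sum>p<Q. g p c * w p)"
  shows "\<exists>w. \<forall>c<N. v c = (\<Sum>q<Q. f q c * w q)"
proof (rule ccontr)
  assume none: "\<not> ?thesis"
  define h where "h q = (if q < Q then f q else v)" for q
  have 1: "\<exists>w. \<forall>c<N. h q c = (\<Sum>p<Q. g p c * w p)" if "q < Suc Q" for q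
    using f[of q] v by (simp add: h_def)
  have 2: "\<forall>q<Suc Q. w q = 0" if w: "\<forall>c<N. (\<Sum>q<Suc Q. h q c * w q) = 0" for w
  proof -
    have sum: "(\<Sum>q<Q. f q c * w q) + v c * w Q = 0" if "c < N" for c
      using w that by (simp add: h_def)
    have wQ: "w Q = 0"
    proof (rule ccontr)
      assume wQ: "w Q \<noteq> 0"
      have "v c = (\<Sum>q<Q. f q c * (- w q / w Q))" if "c < N" for c
      proof -
        have "v c = - (\<Sum>q<Q. f q c * w q) / w Q" using sum[OF that] wQ by (simp add: field_simps)
        then show ?thesis by (simp add: sum_divide_distrib sum_negf)
      qed
      then have "\<exists>w. \<forall>c<N. v c = (\<Sum>q<Q. f q c * w q)" by (intro exI[of _ "\<lambda>q. - w q / w Q"]) simp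
      with none show False by (rule notE)
    qed
    have "\<forall>q<Q. w q = 0" by (rule indep) (use sum wQ in simp)
    then show ?thesis using wQ by (simp add: less_Suc_eq)
  qed
  have "Suc Q \<le> Q" by (rule combination_indep_card_le[where f=h and g=g and N=N]) (fact 1, fact 2)
  then show False by simp
qed

lemma null_basis_indep:
  assumes "is_null_basis M N" "\<forall>c<dim_col M. (\<Sum>q<dim_col N. N $$ (c, q) * w q) = 0"
  shows "\<forall>q<dim_col N. w q = 0"
  using assms full_column_rank_indep[of N w] by (auto simp: is_null_basis_def)

lemma null_basis_dim_le:
  assumes "is_null_basis M N" "is_null_basis M N'"
  shows "dim_col N \<le> dim_col N'"
proof (rule combination_indep_card_le[where f="\<lambda>q c. N $$ (c, q)" and g="\<lambda>q c. N' $$ (c, q)"])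
  fix q assume q: "q < dim_col N"
  have "dim_row N = dim_col M" using assms(1) by (simp add: is_null_basis_def)
  then show "\<exists>w. \<forall>c<dim_col M. N $$ (c, q) = (\<Sum>p<dim_col N'. N' $$ (c, p) * w p)"
    using null_basis_expand[OF assms(2) null_basis_col_in_kernel[OF assms(1) q]] q by simp
next
  fix w assume "\<forall>c<dim_col M. (\<Sum>q<dim_col N. N $$ (c, q) * w q) = 0"
  then show "\<forall>q<dim_col N. w q = 0" by (rule null_basis_indep[OF assms(1)])
qed

lemma null_basis_dim:
  assumes "is_null_basis M N"
  shows "dim_col N = subspace_dim (dim_col M) (mat_kernel M)"
proof -
  obtain N' where N': "is_null_basis M N'" "dim_col N' = subspace_dim (dim_col M) (mat_kernel M)"
    using null_basis_exists[of M] by blast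
  then show ?thesis using null_basis_dim_le[OF assms N'(1)] null_basis_dim_le[OF N'(1) assms] by simp
qed

section \<open>Symmetric tensors as a null space\<close>

lemma digit_less: "0 < b \<Longrightarrow> digit b n x p < b"
  by (simp add: digit_def)

text \<open>The entries of the \<open>n\<close>-fold Kronecker power of \<open>x\<close>, by \<open>kron_pow_index\<close> below.\<close>

definition power_entry :: "nat \<Rightarrow> nat \<Rightarrow> (nat \<Rightarrow> real) \<Rightarrow> nat \<Rightarrow> real" where
  "power_entry K n x c = (\<Prod>p<n. x (digit K n c p))"

lemma digit_0: "k < K \<Longrightarrow> d < K ^ n \<Longrightarrow> digit K (Suc n) (k * K ^ n + d) 0 = k"
  by (simp add: digit_def)

lemma digit_Suc:
  assumes "d < K ^ n" "p < n"
  shows "digit K (Suc n) (k * K ^ n + d) (Suc p) = digit K n d p"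
proof -
  define e where "e = n - 1 - p"
  have r: "n = e + Suc p" using assms(2) by (simp add: e_def)
  have e: "Suc n - 1 - Suc p = e" by (simp add: e_def)
  have K: "0 < K" using assms by (cases "K = 0") (auto simp: power_0_left)
  have "(k * K ^ n + d) div K ^ e = k * K ^ Suc p + d div K ^ e"
  proof -
    have eq: "k * K ^ n + d = d + (k * K ^ Suc p) * K ^ e" unfolding r by (simp add: power_add)
    show ?thesis unfolding eq using K by simp
  qed
  then show ?thesis unfolding digit_def e e_def[symmetric] by (simp add: mod_add_left_eq[symmetric])
qed

lemma power_entry_Suc:
  "k < K \<Longrightarrow> d < K ^ n \<Longrightarrow> power_entry K (Suc n) x (k * K ^ n + d) = x k * power_entry K n x d"
  unfolding power_entry_def prod.lessThan_Suc_shift by (simp add: digit_0 digit_Suc)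

lemma sum_power_split:
  fixes h :: "nat \<Rightarrow> real"
  shows "(\<Sum>c<K ^ Suc n. h c) = (\<Sum>k<K. \<Sum>d<K ^ n. h (k * K ^ n + d))"
proof -
  have "(\<Sum>c<K ^ Suc n. h c) = (\<Sum>k<K. sum h {k * K ^ n..<k * K ^ n + K ^ n})"
    using sum.nat_group[of h "K ^ n" K] by (simp add: mult.commute)
  also have "\<dots> = (\<Sum>k<K. \<Sum>d<K ^ n. h (k * K ^ n + d))"
  proof (rule sum.cong[OF refl])
    fix k
    show "sum h {k * K ^ n..<k * K ^ n + K ^ n} = (\<Sum>d<K ^ n. h (k * K ^ n + d))"
      using sum.shift_bounds_nat_ivl[of h 0 "k * K ^ n" "K ^ n"] by (simp add: add.commute atLeast0LessThan)
  qed
  finally show ?thesis .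
qed

lemma dim_kron_pow: "dim_vec (kron_pow n (vec K x)) = K ^ n"
  by (induction n) (auto simp: kron_def)

lemma kron_pow_index: "c < K ^ n \<Longrightarrow> kron_pow n (vec K x) $ c = power_entry K n x c"
proof (induction n arbitrary: c)
  case 0
  then show ?case by (simp add: power_entry_def)
next
  case (Suc n)
  have K: "0 < K" using Suc.prems by (cases K) auto
  define k d where "k = c div K ^ n" and "d = c mod K ^ n"
  have kd: "c = k * K ^ n + d" "k < K" "d < K ^ n"
    using Suc.prems K by (auto simp: k_def d_def less_mult_imp_div_less mult.commute)
  have "kron_pow (Suc n) (vec K x) $ c = x k * kron_pow n (vec K x) $ d"
    using Suc.prems kd(2) by (simp add: kron_def dim_kron_pow k_def d_def)
  then show ?case using Suc.IH[OF kd(3)] power_entry_Suc[OF kd(2,3)] kd(1) by simp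
qed

text \<open>The indices below \<open>K ^ n\<close> run through all tuples of \<open>n\<close> digits, so the sum of products factorizes.\<close>

lemma sum_prod_digits:
  fixes g :: "nat \<Rightarrow> nat \<Rightarrow> real"
  shows "(\<Sum>c<K ^ n. \<Prod>p<n. g p (digit K n c p)) = (\<Prod>p<n. \<Sum>k<K. g p k)"
proof (induction n arbitrary: g)
  case 0
  then show ?case by simp
next
  case (Suc n)
  have "(\<Sum>c<K ^ Suc n. \<Prod>p<Suc n. g p (digit K (Suc n) c p)) =
      (\<Sum>k<K. \<Sum>d<K ^ n. g 0 k * (\<Prod>p<n. g (Suc p) (digit K n d p)))"
    unfolding sum_power_split
    by (intro sum.cong refl) (simp add: prod.lessThan_Suc_shift digit_0 digit_Suc del: prod.lessThan_Suc)
  also have "\<dots> = (\<Sum>k<K. g 0 k) * (\<Prod>p<n. \<Sum>k<K. g (Suc p) k)"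
    by (simp add: Suc.IH[of "\<lambda>p. g (Suc p)"] sum_distrib_right flip: sum_distrib_left)
  finally show ?case by (simp add: prod.lessThan_Suc_shift del: prod.lessThan_Suc)
qed

lemma prod_permute:
  assumes "\<sigma> permutes {..<n::nat}"
  shows "(\<Prod>p<n. h (\<sigma> p)) = (\<Prod>p<n. h p :: real)"
  using prod.permute[OF assms, of h] by (simp add: o_def)

lemma sum_prod_digits_permuted:
  fixes g :: "nat \<Rightarrow> nat \<Rightarrow> real"
  assumes \<sigma>: "\<sigma> permutes {..<n}"
  shows "(\<Sum>c<K ^ n. \<Prod>p<n. g p (digit K n c (\<sigma> p))) = (\<Prod>p<n. \<Sum>k<K. g p k)"
proof -
  let ?i = "inv_into UNIV \<sigma>"
  have inv: "?i (\<sigma> p) = p" for p using permutes_inverses(2)[OF \<sigma>] by simp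
  have "(\<Prod>p<n. g p (digit K n c (\<sigma> p))) = (\<Prod>p<n. g (?i p) (digit K n c p))" for c
    using prod_permute[OF \<sigma>, of "\<lambda>p. g (?i p) (digit K n c p)"] by (simp add: inv)
  then have "(\<Sum>c<K ^ n. \<Prod>p<n. g p (digit K n c (\<sigma> p))) = (\<Prod>p<n. \<Sum>k<K. g (?i p) k)"
    using sum_prod_digits[where g="\<lambda>p. g (?i p)"] by simp
  also have "\<dots> = (\<Prod>p<n. \<Sum>k<K. g p k)"
    using prod_permute[OF \<sigma>, of "\<lambda>p. \<Sum>k<K. g (?i p) k"] by (simp add: inv)
  finally show ?thesis .
qed

lemma sum_prod_power_entry:
  fixes d :: "nat \<Rightarrow> nat \<Rightarrow> real"
  shows "(\<Sum>c<K ^ n. (\<Prod>p<n. d p (digit K n c p)) * power_entry K n x c) = (\<Prod>p<n. \<Sum>k<K. d p k * x k)"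
  unfolding power_entry_def prod.distrib[symmetric] by (rule sum_prod_digits)

lemma alternating_sum_Pow:
  "finite D \<Longrightarrow> (\<Sum>C\<in>Pow D. (- 1) ^ card C) = (if D = {} then 1 else 0 :: real)"
proof (induction D rule: finite_induct)
  case empty
  then show ?case by simp
next
  case (insert x D)
  have inj: "inj_on (insert x) (Pow D)" using insert(2) by (auto simp: inj_on_def)
  have disj: "Pow D \<inter> insert x ` Pow D = {}" using insert(2) by auto
  have "(\<Sum>C\<in>insert x ` Pow D. (- 1) ^ card C) = (\<Sum>C\<in>Pow D. (- 1 :: real) ^ card (insert x C))"
    by (rule sum.reindex_cong[OF inj]) auto
  also have "\<dots> = (\<Sum>C\<in>Pow D. - ((- 1) ^ card C))"
  proof (rule sum.cong[OF refl])
    fix C assume "C \<in> Pow D"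
    then have "finite C" "x \<notin> C" using insert finite_subset by auto
    then show "(- 1 :: real) ^ card (insert x C) = - ((- 1) ^ card C)" by simp
  qed
  finally show ?case
    unfolding Pow_insert using insert(1) disj by (simp add: sum.union_disjoint sum_negf)
qed

lemma alternating_sum_supersets:
  assumes "G \<subseteq> {..<n::nat}"
  shows "(\<Sum>B\<in>Pow {..<n}. if G \<subseteq> B then (- 1) ^ (n - card B) else 0) = (if G = {..<n} then 1 else 0 :: real)"
proof -
  have "(\<Sum>B\<in>Pow {..<n}. if G \<subseteq> B then (- 1) ^ (n - card B) else 0 :: real) =
      (\<Sum>B\<in>{B\<in>Pow {..<n}. G \<subseteq> B}. (- 1) ^ (n - card B))"
    by (rule sum.inter_filter[symmetric]) simp
  also have "\<dots> = (\<Sum>C\<in>Pow ({..<n} - G). (- 1) ^ card C)"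
  proof (rule sum.reindex_bij_witness[where i="\<lambda>C. {..<n} - C" and j="\<lambda>B. {..<n} - B"])
    fix B assume "B \<in> {B \<in> Pow {..<n}. G \<subseteq> B}"
    then have B: "B \<subseteq> {..<n}" "G \<subseteq> B" by auto
    then show "(- 1 :: real) ^ card ({..<n} - B) = (- 1) ^ (n - card B)"
      using finite_subset[OF B(1)] by (simp add: card_Diff_subset)
  qed (use assms in auto)
  also have "\<dots> = (if {..<n} - G = {} then 1 else 0)" by (rule alternating_sum_Pow) simp
  also have "{..<n} - G = {} \<longleftrightarrow> G = {..<n}" using assms by auto
  finally show ?thesis .
qed

text \<open>The polarization identity behind the fact that powers of vectors span the symmetric tensors:
  by inclusion and exclusion over the values of \<open>g\<close>, only the bijections survive.\<close>

lemma sum_permutations_polarization: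
  fixes M :: "nat \<Rightarrow> nat \<Rightarrow> real"
  shows "(\<Sum>\<sigma> | \<sigma> permutes {..<n}. \<Prod>p<n. M (\<sigma> p) p) =
    (\<Sum>B\<in>Pow {..<n}. (- 1) ^ (n - card B) * (\<Prod>p<n. \<Sum>i\<in>B. M i p))"
proof -
  let ?F = "{..<n} \<rightarrow>\<^sub>E {..<n}"
  have finF: "finite ?F" by (intro finite_PiE) auto
  have expand: "(\<Prod>p<n. \<Sum>i\<in>B. M i p) = (\<Sum>g\<in>?F. if g ` {..<n} \<subseteq> B then \<Prod>p<n. M (g p) p else 0)"
    if B: "B \<in> Pow {..<n}" for B
  proof -
    have finB: "finite B" using B finite_subset by auto
    have "(\<Prod>p<n. \<Sum>i\<in>B. M i p) = (\<Sum>g\<in>{..<n} \<rightarrow>\<^sub>E B. \<Prod>p<n. M (g p) p)"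
      by (rule prod_sum_PiE) (use finB in auto)
    also have "{..<n} \<rightarrow>\<^sub>E B = {g\<in>?F. g ` {..<n} \<subseteq> B}"
    proof (rule Set.set_eqI)
      fix g
      show "g \<in> {..<n} \<rightarrow>\<^sub>E B \<longleftrightarrow> g \<in> {g\<in>?F. g ` {..<n} \<subseteq> B}"
        unfolding mem_Collect_eq PiE_iff image_subset_iff using B by blast
    qed
    finally show ?thesis using finF by (simp add: sum.inter_filter)
  qed
  have "(\<Sum>B\<in>Pow {..<n}. (- 1) ^ (n - card B) * (\<Prod>p<n. \<Sum>i\<in>B. M i p)) =
      (\<Sum>B\<in>Pow {..<n}. \<Sum>g\<in>?F. (if g ` {..<n} \<subseteq> B then (- 1) ^ (n - card B) else 0) * (\<Prod>p<n. M (g p) p))"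
    by (intro sum.cong refl) (auto simp: expand sum_distrib_left intro!: sum.cong)
  also have "\<dots> = (\<Sum>g\<in>?F. \<Sum>B\<in>Pow {..<n}. (if g ` {..<n} \<subseteq> B then (- 1) ^ (n - card B) else 0) * (\<Prod>p<n. M (g p) p))"
    by (rule sum.swap)
  also have "\<dots> = (\<Sum>g\<in>?F. (if g ` {..<n} = {..<n} then 1 else 0) * (\<Prod>p<n. M (g p) p))"
  proof (rule sum.cong[OF refl])
    fix g assume "g \<in> ?F"
    then have "g ` {..<n} \<subseteq> {..<n}" by auto
    then show "(\<Sum>B\<in>Pow {..<n}. (if g ` {..<n} \<subseteq> B then (- 1) ^ (n - card B) else 0) * (\<Prod>p<n. M (g p) p)) =
        (if g ` {..<n} = {..<n} then 1 else 0) * (\<Prod>p<n. M (g p) p)"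
      using alternating_sum_supersets[of "g ` {..<n}" n] by (simp only: sum_distrib_right[symmetric])
  qed
  also have "\<dots> = (\<Sum>g\<in>{g\<in>?F. g ` {..<n} = {..<n}}. \<Prod>p<n. M (g p) p)"
    using finF by (simp add: sum.inter_filter if_distrib[of "\<lambda>x. x * _"] cong: if_cong)
  also have "\<dots> = (\<Sum>\<sigma> | \<sigma> permutes {..<n}. \<Prod>p<n. M (\<sigma> p) p)"
  proof (rule sum.reindex_bij_witness[where i="\<lambda>\<sigma>. restrict \<sigma> {..<n}" and j="\<lambda>g p. if p < n then g p else p"])
    fix g assume "g \<in> {g \<in> ?F. g ` {..<n} = {..<n}}"
    then have g: "g \<in> ?F" "g ` {..<n} = {..<n}" by auto
    show "restrict (\<lambda>p. if p < n then g p else p) {..<n} = g"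
      using g(1) by (intro ext) (auto simp: PiE_def extensional_def restrict_def)
    have "inj_on g {..<n}" by (rule eq_card_imp_inj_on) (simp_all add: g(2))
    then have "bij_betw (\<lambda>p. if p < n then g p else p) {..<n} {..<n}"
      using g(2) by (auto simp: bij_betw_def inj_on_def)
    then have "(\<lambda>p. if p < n then g p else p) permutes {..<n}" by (rule bij_imp_permutes) simp
    then show "(\<lambda>p. if p < n then g p else p) \<in> {\<sigma>. \<sigma> permutes {..<n}}" by simp
    show "(\<Prod>p<n. M (if p < n then g p else p) p) = (\<Prod>p<n. M (g p) p)" by (rule prod.cong) auto
  next
    fix \<sigma> assume "\<sigma> \<in> {\<sigma>. \<sigma> permutes {..<n}}"
    then have \<sigma>: "\<sigma> permutes {..<n}" by simp
    show "(\<lambda>p. if p < n then restrict \<sigma> {..<n} p else p) = \<sigma>"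
      using permutes_not_in[OF \<sigma>] by (intro ext) auto
    show "restrict \<sigma> {..<n} \<in> {g \<in> ?F. g ` {..<n} = {..<n}}"
      using permutes_image[OF \<sigma>] permutes_in_image[OF \<sigma>] by auto
  qed
  finally show ?thesis ..
qed

text \<open>\<open>n!\<close> times the difference between the identity and the projection onto the symmetric tensors.\<close>

definition symmetry_defect :: "nat \<Rightarrow> nat \<Rightarrow> nat \<Rightarrow> nat \<Rightarrow> real" where
  "symmetry_defect K n c c' =
     (if c = c' then fact n else 0) -
     real (card {\<sigma>. \<sigma> permutes {..<n} \<and> (\<forall>p<n. digit K n c' (\<sigma> p) = digit K n c p)})"

lemma finite_permutations_lessThan: "finite {\<sigma>. \<sigma> permutes {..<n::nat}}"
  by (rule finite_permutations) simp

lemma card_matching_permutations: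
  "real (card {\<sigma>. \<sigma> permutes {..<n} \<and> (\<forall>p<n. digit K n c' (\<sigma> p) = digit K n c p)}) =
    (\<Sum>\<sigma> | \<sigma> permutes {..<n}. \<Prod>p<n. if digit K n c' (\<sigma> p) = digit K n c p then 1 else 0)"
proof -
  have prod: "(\<Prod>p<n. if P p then 1 else 0 :: real) = (if \<forall>p<n. P p then 1 else 0)" for P
    by (induction n) (auto simp: less_Suc_eq)
  have "real (card {\<sigma>. \<sigma> permutes {..<n} \<and> (\<forall>p<n. digit K n c' (\<sigma> p) = digit K n c p)}) =
      (\<Sum>\<sigma>\<in>{\<sigma>\<in>{\<sigma>. \<sigma> permutes {..<n}}. \<forall>p<n. digit K n c' (\<sigma> p) = digit K n c p}. 1)"
    by simp
  also have "\<dots> = (\<Sum>\<sigma> | \<sigma> permutes {..<n}. if \<forall>p<n. digit K n c' (\<sigma> p) = digit K n c p then 1 else 0)"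
    by (rule sum.inter_filter[OF finite_permutations_lessThan])
  finally show ?thesis unfolding prod .
qed

lemma symmetry_defect_power:
  assumes K: "0 < K" and c: "c < K ^ n"
  shows "(\<Sum>c'<K ^ n. symmetry_defect K n c c' * power_entry K n x c') = 0"
proof -
  have one: "(\<Sum>c'<K ^ n. (\<Prod>p<n. if digit K n c' (\<sigma> p) = digit K n c p then 1 else 0) * power_entry K n x c') =
      power_entry K n x c" if \<sigma>: "\<sigma> permutes {..<n}" for \<sigma>
  proof -
    define g where "g p k = (if k = digit K n c p then x k else 0)" for p k
    have "(\<Sum>c'<K ^ n. (\<Prod>p<n. if digit K n c' (\<sigma> p) = digit K n c p then 1 else 0) * power_entry K n x c') =
        (\<Sum>c'<K ^ n. \<Prod>p<n. g p (digit K n c' (\<sigma> p)))"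
    proof (rule sum.cong[OF refl])
      fix c'
      have perm: "power_entry K n x c' = (\<Prod>p<n. x (digit K n c' (\<sigma> p)))"
        unfolding power_entry_def by (rule prod_permute[OF \<sigma>, symmetric])
      show "(\<Prod>p<n. if digit K n c' (\<sigma> p) = digit K n c p then 1 else 0) * power_entry K n x c' =
          (\<Prod>p<n. g p (digit K n c' (\<sigma> p)))"
        unfolding perm prod.distrib[symmetric] g_def by (rule prod.cong) auto
    qed
    also have "\<dots> = (\<Prod>p<n. \<Sum>k<K. g p k)" by (rule sum_prod_digits_permuted[OF \<sigma>])
    also have "\<dots> = power_entry K n x c"
      unfolding power_entry_def g_def using digit_less[OF K] by (intro prod.cong refl) simp
    finally show ?thesis .
  qed
  have "(\<Sum>c'<K ^ n. real (card {\<sigma>. \<sigma> permutes {..<n} \<and> (\<forall>p<n. digit K n c' (\<sigma> p) = digit K n c p)}) * power_entry K n x c') =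
      (\<Sum>\<sigma> | \<sigma> permutes {..<n}. \<Sum>c'<K ^ n. (\<Prod>p<n. if digit K n c' (\<sigma> p) = digit K n c p then 1 else 0) * power_entry K n x c')"
    unfolding card_matching_permutations sum_distrib_right by (rule sum.swap)
  also have "\<dots> = (\<Sum>\<sigma> | \<sigma> permutes {..<n}. power_entry K n x c)"
    by (rule sum.cong[OF refl]) (use one in simp)
  also have "\<dots> = fact n * power_entry K n x c" by (simp add: card_permutations)
  finally have cnt: "(\<Sum>c'<K ^ n. real (card {\<sigma>. \<sigma> permutes {..<n} \<and> (\<forall>p<n. digit K n c' (\<sigma> p) = digit K n c p)}) * power_entry K n x c') =
      fact n * power_entry K n x c" .
  have "(\<Sum>c'<K ^ n. (if c = c' then fact n else 0) * power_entry K n x c') = fact n * power_entry K n x c"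
    using c by (simp add: if_distrib[of "\<lambda>x. x * _"] cong: if_cong)
  then show ?thesis unfolding symmetry_defect_def left_diff_distrib sum_subtractf cnt by simp
qed

text \<open>A tensor without symmetry defect is a combination of powers: each of its coordinate tensors is
  symmetrized, and the polarization identity is applied.\<close>

lemma symmetric_is_power_combination:
  assumes "\<forall>c<K ^ n. (\<Sum>c'<K ^ n. symmetry_defect K n c c' * v c') = 0"
  shows "\<exists>A :: (nat \<times> nat set) set. \<exists>w y. finite A \<and> (\<forall>c<K ^ n. v c = (\<Sum>t\<in>A. w t * power_entry K n (y t) c))"
proof -
  define y where "y t k = (\<Sum>i\<in>snd t. if digit K n (fst t) i = k then 1 else 0 :: real)" for t :: "nat \<times> nat set" and k
  define w where "w t = v (fst t) / fact n * (- 1) ^ (n - card (snd t))" for t :: "nat \<times> nat set"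
  have "v c = (\<Sum>t\<in>{..<K ^ n} \<times> Pow {..<n}. w t * power_entry K n (y t) c)" if c: "c < K ^ n" for c
  proof -
    let ?cnt = "\<lambda>c'. real (card {\<sigma>. \<sigma> permutes {..<n} \<and> (\<forall>p<n. digit K n c' (\<sigma> p) = digit K n c p)})"
    have "(\<Sum>c'<K ^ n. (if c = c' then fact n else 0) * v c') = (\<Sum>c'<K ^ n. ?cnt c' * v c')"
      using assms c unfolding symmetry_defect_def left_diff_distrib sum_subtractf by simp
    moreover have "(\<Sum>c'<K ^ n. (if c = c' then fact n else 0) * v c') = fact n * v c"
      using c by (simp add: if_distrib[of "\<lambda>x. x * _"] cong: if_cong)
    ultimately have eq: "fact n * v c = (\<Sum>c'<K ^ n. ?cnt c' * v c')" by (simp only:)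
    have "v c = fact n * v c / fact n" by simp
    also have "\<dots> = (\<Sum>c'<K ^ n. ?cnt c' * v c') / fact n" unfolding eq ..
    also have "\<dots> = (\<Sum>c'<K ^ n. v c' / fact n * ?cnt c')" by (simp add: sum_divide_distrib mult.commute)
    also have "\<dots> = (\<Sum>c'<K ^ n. \<Sum>B\<in>Pow {..<n}. w (c', B) * power_entry K n (y (c', B)) c)"
      unfolding card_matching_permutations
        sum_permutations_polarization[where M="\<lambda>i p. if digit K n _ i = digit K n c p then 1 else 0"]
      by (simp add: w_def y_def power_entry_def sum_distrib_left mult.assoc)
    finally show ?thesis by (simp add: sum.cartesian_product)
  qed
  then show ?thesis
    by (intro exI[of _ "{..<K ^ n} \<times> Pow {..<n}"] exI[of _ w] exI[of _ y]) simp
qed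

text \<open>Polarization turns the span of the powers into a null space, which an algorithm can intersect with
  the kernel of a matrix.\<close>

lemma sym_space_iff:
  assumes K: "0 < K"
  shows "v \<in> sym_space K n \<longleftrightarrow> dim_vec v = K ^ n \<and>
    (\<forall>c<K ^ n. (\<Sum>c'<K ^ n. symmetry_defect K n c c' * v $ c') = 0)"
proof -
  interpret vec_space "TYPE(real)" "K ^ n" .
  have kp: "x \<in> carrier_vec K \<Longrightarrow> kron_pow n x = vec (K ^ n) (power_entry K n (\<lambda>k. x $ k))" for x
  proof -
    assume "x \<in> carrier_vec K"
    then have "x = vec K (\<lambda>k. x $ k)" by (intro eq_vecI) auto
    moreover have "kron_pow n (vec K (\<lambda>k. x $ k)) = vec (K ^ n) (power_entry K n (\<lambda>k. x $ k))"
      by (intro eq_vecI) (auto simp: kron_pow_index dim_kron_pow)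
    ultimately show ?thesis by simp
  qed
  have sub: "kron_pow n ` carrier_vec K \<subseteq> carrier_vec (K ^ n)" using kp by auto
  show ?thesis
  proof
    assume v: "v \<in> sym_space K n"
    then have "v \<in> span (kron_pow n ` carrier_vec K)" by (simp add: sym_space_def)
    then obtain a A where A: "v = lincomb a A" "finite A" "A \<subseteq> kron_pow n ` carrier_vec K"
      unfolding span_def by auto
    have Ac: "A \<subseteq> carrier_vec (K ^ n)" using A(3) sub by blast
    have "(\<Sum>c'<K ^ n. symmetry_defect K n c c' * v $ c') = 0" if c: "c < K ^ n" for c
    proof -
      have "(\<Sum>c'<K ^ n. symmetry_defect K n c c' * v $ c') =
          (\<Sum>c'<K ^ n. \<Sum>z\<in>A. a z * (symmetry_defect K n c c' * z $ c'))"
        unfolding A(1) by (intro sum.cong refl) (simp add: lincomb_index[OF _ Ac] sum_distrib_left mult_ac)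
      also have "\<dots> = (\<Sum>z\<in>A. a z * (\<Sum>c'<K ^ n. symmetry_defect K n c c' * z $ c'))"
        unfolding sum_distrib_left by (rule sum.swap)
      also have "\<dots> = 0"
      proof (rule sum.neutral, rule ballI)
        fix z assume "z \<in> A"
        then obtain x where x: "x \<in> carrier_vec K" "z = kron_pow n x" using A(3) by auto
        show "a z * (\<Sum>c'<K ^ n. symmetry_defect K n c c' * z $ c') = 0"
          unfolding x(2) kp[OF x(1)] using symmetry_defect_power[OF K c] by simp
      qed
      finally show ?thesis .
    qed
    moreover have "dim_vec v = K ^ n" using A Ac lincomb_closed[of A a] by simp
    ultimately show "dim_vec v = K ^ n \<and> (\<forall>c<K ^ n. (\<Sum>c'<K ^ n. symmetry_defect K n c c' * v $ c') = 0)"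
      by blast
  next
    assume v: "dim_vec v = K ^ n \<and> (\<forall>c<K ^ n. (\<Sum>c'<K ^ n. symmetry_defect K n c c' * v $ c') = 0)"
    then obtain A :: "(nat \<times> nat set) set" and w y where A: "finite A"
      "\<forall>c<K ^ n. v $ c = (\<Sum>t\<in>A. w t * power_entry K n (y t) c)"
      using symmetric_is_power_combination[of K n "\<lambda>c. v $ c"] by blast
    have "vec (K ^ n) (\<lambda>c. \<Sum>t\<in>A. w t * power_entry K n (y t) c) \<in> span (kron_pow n ` carrier_vec K)"
      using A(1)
    proof (induction A rule: finite_induct)
      case empty
      have "vec (K ^ n) (\<lambda>c. \<Sum>t\<in>{}. w t * power_entry K n (y t) c) = 0\<^sub>v (K ^ n)" by (intro eq_vecI) auto
      then show ?case using vectorspace.span_zero[OF vectorspace_axioms, of "kron_pow n ` carrier_vec K"] by simp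
    next
      case (insert t A)
      have "kron_pow n (vec K (y t)) \<in> span (kron_pow n ` carrier_vec K)"
        by (rule subsetD[OF in_own_span[OF sub]]) simp
      then have "w t \<cdot>\<^sub>v kron_pow n (vec K (y t)) \<in> span (kron_pow n ` carrier_vec K)"
        by (rule smult_in_span[OF sub])
      from span_add1[OF sub this insert.IH]
      have "w t \<cdot>\<^sub>v kron_pow n (vec K (y t)) + vec (K ^ n) (\<lambda>c. \<Sum>t\<in>A. w t * power_entry K n (y t) c)
          \<in> span (kron_pow n ` carrier_vec K)" by simp
      moreover have "w t \<cdot>\<^sub>v kron_pow n (vec K (y t)) + vec (K ^ n) (\<lambda>c. \<Sum>t\<in>A. w t * power_entry K n (y t) c) =
          vec (K ^ n) (\<lambda>c. \<Sum>t\<in>insert t A. w t * power_entry K n (y t) c)"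
        using insert.hyps by (intro eq_vecI) (auto simp: dim_kron_pow kron_pow_index)
      ultimately show ?case by simp
    qed
    also have "vec (K ^ n) (\<lambda>c. \<Sum>t\<in>A. w t * power_entry K n (y t) c) = v"
      using A(2) v by (intro eq_vecI) auto
    finally show "v \<in> sym_space K n" by (simp add: sym_space_def)
  qed
qed

section \<open>The kernel of the matrix of the tensor\<close>

lemma det_by_columns:
  "det (mat m m (\<lambda>(u, v). f u v :: real)) =
    (\<Sum>\<tau> | \<tau> permutes {..<m}. signof \<tau> * (\<Prod>v<m. f (\<tau> v) v))"
proof -
  have "mat m m (\<lambda>(u, v). f u v) = transpose_mat (mat m m (\<lambda>(v, u). f u v))"
    by (intro eq_matI) auto
  then have "det (mat m m (\<lambda>(u, v). f u v)) = det (mat m m (\<lambda>(v, u). f u v))"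
    by (simp only: det_transpose[OF mat_carrier])
  also have "\<dots> = (\<Sum>\<tau> | \<tau> permutes {0..<m}. signof \<tau> * (\<Prod>v = 0..<m. mat m m (\<lambda>(v, u). f u v) $$ (v, \<tau> v)))"
    by (rule det_def'[OF mat_carrier])
  also have "\<dots> = (\<Sum>\<tau> | \<tau> permutes {..<m}. signof \<tau> * (\<Prod>v<m. f (\<tau> v) v))"
    unfolding atLeast0LessThan
  proof (rule sum.cong[OF refl])
    fix \<tau> assume "\<tau> \<in> {\<tau>. \<tau> permutes {..<m}}"
    then have "\<tau> v < m" if "v < m" for v using permutes_in_image[of \<tau> "{..<m}" v] that by simp
    then show "signof \<tau> * (\<Prod>v<m. mat m m (\<lambda>(v, u). f u v) $$ (v, \<tau> v)) =
        signof \<tau> * (\<Prod>v<m. f (\<tau> v) v)" by simp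
  qed
  finally show ?thesis .
qed

lemma prod_lessThan_add: "(\<Prod>p<m + l. h p) = (\<Prod>p<m. h p) * (\<Prod>p<l. h (m + p) :: real)" for m l :: nat
  by (induction l) (simp_all add: mult_ac)

text \<open>On powers of \<open>x\<close>, the matrix gives the \<open>m\<close>-minors of the contraction by \<open>x\<close>, times monomials.\<close>

lemma R_mat_power:
  assumes n: "n = m + l" and a: "a < I ^ n * J ^ n"
    and i: "i = digit I n (a div J ^ n)" and j: "j = digit J n (a mod J ^ n)"
  shows "(\<Sum>c<K ^ n. R_mat I J K m l T $$ (a, c) * power_entry K n x c) =
    1 / fact m * (det (mat m m (\<lambda>(u, v). contract K T x (i u) (j v))) *
      (\<Prod>p<l. contract K T x (i (m + p)) (j (m + p))))"
proof -
  let ?k = "\<lambda>c. digit K n c"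
  let ?D = "\<lambda>\<sigma> c. det (mat m m (\<lambda>(u, v). T (i u) (j v) (?k c (\<sigma> v)))) *
    (\<Prod>p<l. T (i (m + p)) (j (m + p)) (?k c (\<sigma> (m + p))))"
  define H where "H \<tau> p q = T (i (if p < m then \<tau> p else p)) (j p) q" for \<tau> :: "nat \<Rightarrow> nat" and p q
  define E where "E = det (mat m m (\<lambda>(u, v). contract K T x (i u) (j v))) *
      (\<Prod>p<l. contract K T x (i (m + p)) (j (m + p)))"
  have entry: "R_mat I J K m l T $$ (a, c) = 1 / (fact m * fact n) * (\<Sum>\<sigma> | \<sigma> permutes {..<n}. ?D \<sigma> c)"
    if "c < K ^ n" for c
    using a that unfolding R_mat_def Let_def n[symmetric] i j by simp
  have one: "(\<Sum>c<K ^ n. ?D \<sigma> c * power_entry K n x c) = E" if \<sigma>: "\<sigma> permutes {..<n}" for \<sigma>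
  proof -
    have "?D \<sigma> c * power_entry K n x c =
        (\<Sum>\<tau> | \<tau> permutes {..<m}. signof \<tau> * (\<Prod>p<n. H \<tau> p (?k c (\<sigma> p)) * x (?k c (\<sigma> p))))" for c
    proof -
      have perm: "power_entry K n x c = (\<Prod>p<n. x (?k c (\<sigma> p)))"
        unfolding power_entry_def by (rule prod_permute[OF \<sigma>, symmetric])
      have H: "(\<Prod>p<n. H \<tau> p (?k c (\<sigma> p))) = (\<Prod>v<m. T (i (\<tau> v)) (j v) (?k c (\<sigma> v))) *
          (\<Prod>p<l. T (i (m + p)) (j (m + p)) (?k c (\<sigma> (m + p))))" for \<tau>
        unfolding n prod_lessThan_add by (simp add: H_def)
      show ?thesis
        unfolding perm det_by_columns prod.distrib H by (simp add: sum_distrib_right mult.assoc)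
    qed
    then have "(\<Sum>c<K ^ n. ?D \<sigma> c * power_entry K n x c) =
        (\<Sum>c<K ^ n. \<Sum>\<tau> | \<tau> permutes {..<m}. signof \<tau> * (\<Prod>p<n. H \<tau> p (?k c (\<sigma> p)) * x (?k c (\<sigma> p))))"
      by simp
    also have "\<dots> = (\<Sum>\<tau> | \<tau> permutes {..<m}. \<Sum>c<K ^ n. signof \<tau> * (\<Prod>p<n. H \<tau> p (?k c (\<sigma> p)) * x (?k c (\<sigma> p))))"
      by (rule sum.swap)
    also have "\<dots> = (\<Sum>\<tau> | \<tau> permutes {..<m}. signof \<tau> * (\<Prod>p<n. \<Sum>k<K. H \<tau> p k * x k))"
      unfolding sum_distrib_left[symmetric]
      using sum_prod_digits_permuted[OF \<sigma>, where g="\<lambda>p k. H _ p k * x k"] by simp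
    also have "\<dots> = (\<Sum>\<tau> | \<tau> permutes {..<m}. signof \<tau> * ((\<Prod>v<m. contract K T x (i (\<tau> v)) (j v)) *
        (\<Prod>p<l. contract K T x (i (m + p)) (j (m + p)))))"
      unfolding n prod_lessThan_add by (simp add: H_def contract_def)
    also have "\<dots> = E"
      unfolding E_def det_by_columns by (simp add: sum_distrib_right mult.assoc)
    finally show ?thesis .
  qed
  have "(\<Sum>c<K ^ n. R_mat I J K m l T $$ (a, c) * power_entry K n x c) =
      (\<Sum>c<K ^ n. \<Sum>\<sigma> | \<sigma> permutes {..<n}. 1 / (fact m * fact n) * (?D \<sigma> c * power_entry K n x c))"
    by (rule sum.cong[OF refl]) (simp add: entry sum_distrib_left sum_distrib_right mult.assoc)
  also have "\<dots> = (\<Sum>\<sigma> | \<sigma> permutes {..<n}. 1 / (fact m * fact n) * (\<Sum>c<K ^ n. ?D \<sigma> c * power_entry K n x c))"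
    unfolding sum_distrib_left by (rule sum.swap)
  also have "\<dots> = (\<Sum>\<sigma> | \<sigma> permutes {..<n}. 1 / (fact m * fact n) * E)"
    by (rule sum.cong[OF refl]) (use one in simp)
  also have "\<dots> = 1 / fact m * E" by (simp add: card_permutations)
  finally show ?thesis unfolding E_def .
qed

text \<open>A matrix whose null space is the space of the dimension condition.\<close>

definition kernel_system :: "nat \<Rightarrow> nat \<Rightarrow> nat \<Rightarrow> nat \<Rightarrow> nat \<Rightarrow> tensor \<Rightarrow> real mat" where
  "kernel_system I J K m l T =
     mat (I ^ (m + l) * J ^ (m + l) + K ^ (m + l)) (K ^ (m + l)) (\<lambda>(a, c).
       if a < I ^ (m + l) * J ^ (m + l) then R_mat I J K m l T $$ (a, c)
       else symmetry_defect K (m + l) (a - I ^ (m + l) * J ^ (m + l)) c)"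

lemma dim_R_mat: "dim_row (R_mat I J K m l T) = I ^ (m + l) * J ^ (m + l)"
  "dim_col (R_mat I J K m l T) = K ^ (m + l)"
  by (simp_all add: R_mat_def Let_def)

lemma dim_kernel_system: "dim_row (kernel_system I J K m l T) = I ^ (m + l) * J ^ (m + l) + K ^ (m + l)"
  "dim_col (kernel_system I J K m l T) = K ^ (m + l)"
  by (simp_all add: kernel_system_def)

lemma mat_kernel_kernel_system:
  assumes "0 < K"
  shows "mat_kernel (kernel_system I J K m l T) = mat_kernel (R_mat I J K m l T) \<inter> sym_space K (m + l)"
proof (rule Set.set_eqI)
  fix v
  let ?A = "I ^ (m + l) * J ^ (m + l)" and ?N = "K ^ (m + l)"
  let ?f = "\<lambda>a. \<Sum>c<?N. kernel_system I J K m l T $$ (a, c) * v $ c"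
  have f1: "?f a = (\<Sum>c<?N. R_mat I J K m l T $$ (a, c) * v $ c)" if "a < ?A" for a
    using that by (intro sum.cong refl) (simp add: kernel_system_def)
  have f2: "?f (?A + c') = (\<Sum>c<?N. symmetry_defect K (m + l) c' c * v $ c)" if "c' < ?N" for c'
    using that by (intro sum.cong refl) (simp add: kernel_system_def)
  have "(\<forall>a<?A + ?N. ?f a = 0) \<longleftrightarrow> (\<forall>a<?A. ?f a = 0) \<and> (\<forall>c'<?N. ?f (?A + c') = 0)"
  proof (intro iffI conjI allI impI)
    fix a assume *: "(\<forall>a<?A. ?f a = 0) \<and> (\<forall>c'<?N. ?f (?A + c') = 0)" and a: "a < ?A + ?N"
    show "?f a = 0"
    proof (cases "a < ?A")
      case False
      then show ?thesis using *[THEN conjunct2, THEN spec, of "a - ?A"] a by simp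
    qed (use * in blast)
  qed auto
  then show "v \<in> mat_kernel (kernel_system I J K m l T) \<longleftrightarrow>
      v \<in> mat_kernel (R_mat I J K m l T) \<inter> sym_space K (m + l)"
    unfolding Int_iff mat_kernel_iff sym_space_iff[OF assms] dim_R_mat dim_kernel_system
    using f1 f2 by auto
qed

lemma power_in_kernel:
  assumes K: "0 < K" and low: "low_rank_at m I J K T x"
  shows "vec (K ^ (m + l)) (power_entry K (m + l) x) \<in> mat_kernel (kernel_system I J K m l T)"
proof -
  let ?n = "m + l"
  have "(\<Sum>c<K ^ ?n. R_mat I J K m l T $$ (a, c) * power_entry K ?n x c) = 0"
    if a: "a < I ^ ?n * J ^ ?n" for a
  proof -
    define i where "i = digit I ?n (a div J ^ ?n)"
    define j where "j = digit J ?n (a mod J ^ ?n)"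
    show ?thesis
    proof (cases "m = 0")
      case True
      then have False using low unfolding low_rank_at_def by (simp add: det_dim_zero)
      then show ?thesis ..
    next
      case False
      have IJ: "0 < I" "0 < J" using a False by (auto intro!: gr0I simp: power_0_left)
      have "det (mat m m (\<lambda>(u, v). contract K T x (i u) (j v))) = 0"
        by (rule low[unfolded low_rank_at_def, rule_format])
          (simp_all add: i_def j_def digit_less IJ)
      then show ?thesis unfolding R_mat_power[OF refl a i_def j_def] by simp
    qed
  qed
  moreover have "vec (K ^ ?n) (power_entry K ?n x) \<in> sym_space K ?n"
    unfolding sym_space_iff[OF K] using symmetry_defect_power[OF K] by simp
  ultimately show ?thesis
    unfolding mat_kernel_kernel_system[OF K] Int_iff mat_kernel_iff dim_R_mat by simp
qed

section \<open>Powers of the points of low rank\<close>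

text \<open>Evaluation of the product of the forms outside \<open>S\<close> and of a power of the form \<open>d\<close>, as a functional
  on tensors.\<close>

lemma product_functional:
  assumes S: "S \<subseteq> {..<R}" "card ({..<R} - S) = n"
  shows "\<exists>D. \<forall>y. (\<Sum>k<K ^ (n + e). D k * power_entry K (n + e) y k) =
    (\<Prod>r\<in>{..<R} - S. form K c r y) * (\<Sum>k<K. d k * y k) ^ e"
proof -
  obtain \<epsilon> where \<epsilon>: "bij_betw \<epsilon> {..<n} ({..<R} - S)"
    using ex_bij_betw_nat_finite[of "{..<R} - S"] S(2) by (auto simp: atLeast0LessThan)
  define g where "g p = (if p < n then c (\<epsilon> p) else d)" for p
  have "(\<Sum>k<K ^ (n + e). (\<Prod>p<n + e. g p (digit K (n + e) k p)) * power_entry K (n + e) y k) =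
      (\<Prod>r\<in>{..<R} - S. form K c r y) * (\<Sum>k<K. d k * y k) ^ e" for y
  proof -
    have "(\<Sum>k<K ^ (n + e). (\<Prod>p<n + e. g p (digit K (n + e) k p)) * power_entry K (n + e) y k) =
        (\<Prod>p<n + e. \<Sum>k<K. g p k * y k)" by (rule sum_prod_power_entry)
    also have "\<dots> = (\<Prod>p<n. form K c (\<epsilon> p) y) * (\<Sum>k<K. d k * y k) ^ e"
      unfolding prod_lessThan_add by (simp add: g_def form_def)
    also have "(\<Prod>p<n. form K c (\<epsilon> p) y) = (\<Prod>r\<in>{..<R} - S. form K c r y)"
      by (rule prod.reindex_bij_betw[OF \<epsilon>])
    finally show ?thesis .
  qed
  then show ?thesis by (intro exI[of _ "\<lambda>k. \<Prod>p<n + e. g p (digit K (n + e) k p)"]) simp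
qed

text \<open>A decomposition together with a labelling of the points at which \<open>K - 1\<close> of its forms vanish.\<close>

locale tensor_frame =
  fixes I J K R m l Q :: nat and T :: tensor and a b c :: "nat \<Rightarrow> nat \<Rightarrow> real"
    and S :: "nat \<Rightarrow> nat set" and xs :: "nat \<Rightarrow> nat \<Rightarrow> real"
  assumes K2: "2 \<le> K" and KR: "K \<le> R" and m: "m = R - K + 2"
    and gp: "general_position K R c" and dec: "decomposes I J K R T a b c"
    and Q: "Q = R choose (K - 1)"
    and dim: "subspace_dim (K ^ (m + l)) (mat_kernel (kernel_system I J K m l T)) = Q"
    and S: "bij_betw S {..<Q} {S. S \<subseteq> {..<R} \<and> card S = K - 1}"
    and xs: "\<And>q. q < Q \<Longrightarrow> nonzero K (xs q)" "\<And>q r. q < Q \<Longrightarrow> r \<in> S q \<Longrightarrow> form K c r (xs q) = 0"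
begin

lemma S_sub: "q < Q \<Longrightarrow> S q \<subseteq> {..<R}" and card_S: "q < Q \<Longrightarrow> card (S q) = K - 1"
  using S by (auto simp: bij_betw_def)

lemma finite_S: "q < Q \<Longrightarrow> finite (S q)"
  using S_sub finite_subset by blast

lemma card_complement_S: "q < Q \<Longrightarrow> card ({..<R} - S q) = m - 1"
  using card_Diff_subset[OF finite_S S_sub] card_S K2 KR m by simp

lemma S_cover: "A \<subseteq> {..<R} \<Longrightarrow> card A = K - 1 \<Longrightarrow> \<exists>q<Q. S q = A"
proof -
  assume "A \<subseteq> {..<R}" "card A = K - 1"
  then have "A \<in> S ` {..<Q}" using S by (simp add: bij_betw_def)
  then show ?thesis by auto
qed

lemma S_differ:
  assumes "q < Q" "q' < Q" "q \<noteq> q'" shows "\<exists>r. r \<in> S q' \<and> r \<in> {..<R} - S q"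
proof -
  have "S q \<noteq> S q'" using S assms by (auto simp: bij_betw_def inj_on_def)
  then have "\<not> S q' \<subseteq> S q"
    using card_subset_eq[OF finite_S[OF assms(1)], of "S q'"] card_S assms by auto
  then show ?thesis using S_sub[OF assms(2)] by auto
qed

lemma form_nonzero:
  assumes q: "q < Q" and r: "r \<in> {..<R} - S q" shows "form K c r (xs q) \<noteq> 0"
proof
  assume 0: "form K c r (xs q) = 0"
  have "\<not> nonzero K (xs q)"
  proof (rule general_positionD[OF gp, of "insert r (S q)"])
    show "insert r (S q) \<subseteq> {..<R}" using r S_sub[OF q] by auto
    show "K \<le> card (insert r (S q))" using r finite_S[OF q] card_S[OF q] K2 by simp
    show "form K c s (xs q) = 0" if "s \<in> insert r (S q)" for s using that 0 xs(2)[OF q] by auto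
  qed
  then show False using xs(1)[OF q] by blast
qed

lemma low_rank_at_xs: "q < Q \<Longrightarrow> low_rank_at m I J K T (xs q)"
proof -
  assume q: "q < Q"
  have "card ({..<R} - S q) < m" using card_complement_S[OF q] m by simp
  from low_rank_atI[OF _ this contract_decomposes_restrict[OF dec _ _ xs(2)[OF q] refl]]
  show ?thesis by simp
qed

text \<open>The product of the forms outside \<open>S q\<close> vanishes at all labelled points but \<open>xs q\<close>. The remaining degree is
  filled up with the form that is the inner product with \<open>xs q\<close>.\<close>

lemma powers_independent:
  assumes n: "n = m - 1 + e" and 0: "\<forall>k<K ^ n. (\<Sum>q<Q. power_entry K n (xs q) k * w q) = 0"
  shows "\<forall>q<Q. w q = 0"
proof (intro allI impI)
  fix q assume q: "q < Q"
  obtain D where D: "\<forall>y. (\<Sum>k<K ^ (m - 1 + e). D k * power_entry K (m - 1 + e) y k) =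
      (\<Prod>r\<in>{..<R} - S q. form K c r y) * (\<Sum>k<K. xs q k * y k) ^ e"
    using product_functional[OF S_sub[OF q] card_complement_S[OF q], where e=e and d="xs q"] by blast
  define L where "L y = (\<Prod>r\<in>{..<R} - S q. form K c r y) * (\<Sum>k<K. xs q k * y k) ^ e" for y
  have L: "(\<Sum>k<K ^ n. D k * power_entry K n y k) = L y" for y using D unfolding n L_def by blast
  have other: "L (xs q') = 0" if q': "q' < Q" "q' \<noteq> q" for q'
  proof -
    obtain r where r: "r \<in> S q'" "r \<in> {..<R} - S q" using S_differ[OF q q'(1)] q'(2) by blast
    have "(\<Prod>r\<in>{..<R} - S q. form K c r (xs q')) = 0"
      by (rule prod_zero) (use r xs(2)[OF q'(1)] in auto)
    then show ?thesis by (simp add: L_def)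
  qed
  obtain k0 where k0: "k0 < K" "xs q k0 \<noteq> 0" using xs(1)[OF q] by blast
  have "0 < (\<Sum>k<K. xs q k * xs q k)"
    by (rule sum_pos2[of _ k0]) (use k0 in \<open>auto simp: zero_less_mult_iff\<close>)
  moreover have "(\<Prod>r\<in>{..<R} - S q. form K c r (xs q)) \<noteq> 0" using form_nonzero[OF q] by simp
  ultimately have own: "L (xs q) \<noteq> 0" by (simp add: L_def)
  have "0 = (\<Sum>k<K ^ n. D k * (\<Sum>q'<Q. power_entry K n (xs q') k * w q'))" using 0 by simp
  also have "\<dots> = (\<Sum>k<K ^ n. \<Sum>q'<Q. D k * power_entry K n (xs q') k * w q')"
    by (simp add: sum_distrib_left mult.assoc)
  also have "\<dots> = (\<Sum>q'<Q. \<Sum>k<K ^ n. D k * power_entry K n (xs q') k * w q')" by (rule sum.swap)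
  also have "\<dots> = (\<Sum>q'<Q. L (xs q') * w q')" by (simp add: sum_distrib_right[symmetric] L)
  also have "\<dots> = (\<Sum>q'\<in>{q}. L (xs q') * w q')"
    by (rule sum.mono_neutral_right) (use q other in auto)
  finally show "w q = 0" using own by simp
qed

text \<open>There are \<open>Q\<close> of the powers, they are independent, and by assumption the dimension of the kernel is \<open>Q\<close>.\<close>

lemma kernel_spanned_by_powers:
  assumes v: "v \<in> mat_kernel (kernel_system I J K m l T)"
  shows "\<exists>w. \<forall>k<K ^ (m + l). v $ k = (\<Sum>q<Q. power_entry K (m + l) (xs q) k * w q)"
proof -
  let ?M = "kernel_system I J K m l T" and ?n = "m + l"
  obtain N where N: "is_null_basis ?M N" "dim_col N = subspace_dim (dim_col ?M) (mat_kernel ?M)"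
    using null_basis_exists[of ?M] by blast
  have dimN: "dim_col N = Q" using N(2) dim by (simp add: dim_kernel_system)
  have expand: "\<exists>w. \<forall>k<K ^ ?n. u $ k = (\<Sum>p<Q. N $$ (k, p) * w p)" if "u \<in> mat_kernel ?M" for u
    using null_basis_expand[OF N(1) that] unfolding dimN dim_kernel_system .
  have f: "\<exists>w. \<forall>k<K ^ ?n. power_entry K ?n (xs q) k = (\<Sum>p<Q. N $$ (k, p) * w p)" if "q < Q" for q
    using expand[OF power_in_kernel[OF _ low_rank_at_xs[OF that]]] K2 by simp
  show ?thesis
  proof (rule combination_exchange[where f="\<lambda>q. power_entry K ?n (xs q)" and g="\<lambda>p k. N $$ (k, p)"])
    show "\<And>w. \<forall>k<K ^ ?n. (\<Sum>q<Q. power_entry K ?n (xs q) k * w q) = 0 \<Longrightarrow> \<forall>q<Q. w q = 0"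
      by (rule powers_independent[of ?n "Suc l"]) (use m in auto)
  qed (use f expand[OF v] in blast)+
qed

text \<open>If fewer than \<open>K - 1\<close> forms vanish at \<open>y\<close>, then they can be completed to a set \<open>A\<close> of \<open>K - 1\<close> forms
  with a form \<open>r\<close> that does not vanish at \<open>y\<close>. The product of the forms outside \<open>A\<close> with powers of \<open>r\<close>
  vanishes at all labelled points but not at \<open>y\<close>, so that the power of \<open>y\<close> is not in the kernel.\<close>

lemma low_rank_points:
  assumes y: "nonzero K y" and low: "low_rank_at m I J K T y"
  shows "K - 1 \<le> card {r. r < R \<and> form K c r y = 0}"
proof (rule ccontr)
  let ?Z = "{r. r < R \<and> form K c r y = 0}"
  assume less: "\<not> ?thesis"
  have Z: "?Z \<subseteq> {..<R}" by auto
  have "card ?Z \<le> K - 1" "K - 1 \<le> card {..<R}" using less KR by auto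
  from exists_subset_between[OF this Z]
  obtain A where A: "?Z \<subseteq> A" "A \<subseteq> {..<R}" "card A = K - 1" by blast
  have "A \<noteq> ?Z" using A(3) less by auto
  then obtain r where r: "r \<in> A" "r \<notin> ?Z" using A(1) by blast
  have finA: "finite A" using A(2) finite_subset by blast
  have "card ({..<R} - A) = m - 1" using card_Diff_subset[OF finA A(2)] A(3) K2 KR m by simp
  from product_functional[OF A(2) this, where e="Suc l" and d="c r" and K=K and c=c]
  obtain D where D: "\<forall>y. (\<Sum>k<K ^ (m - 1 + Suc l). D k * power_entry K (m - 1 + Suc l) y k) =
      (\<Prod>r\<in>{..<R} - A. form K c r y) * (\<Sum>k<K. c r k * y k) ^ Suc l" by blast
  define L where "L y = (\<Prod>r\<in>{..<R} - A. form K c r y) * form K c r y ^ Suc l" for y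
  have n: "m - 1 + Suc l = m + l" using m by simp
  have L: "(\<Sum>k<K ^ (m + l). D k * power_entry K (m + l) y k) = L y" for y
    using D unfolding n L_def form_def by blast
  have Lxs: "L (xs q) = 0" if q: "q < Q" for q
  proof (cases "S q = A")
    case True
    then show ?thesis using xs(2)[OF q, of r] r(1) by (simp add: L_def)
  next
    case False
    then have "\<not> S q \<subseteq> A" using card_subset_eq[OF finA, of "S q"] A(3) card_S[OF q] by auto
    then obtain s where s: "s \<in> S q" "s \<in> {..<R} - A" using S_sub[OF q] by auto
    have "(\<Prod>r\<in>{..<R} - A. form K c r (xs q)) = 0"
      by (rule prod_zero) (use s xs(2)[OF q] in auto)
    then show ?thesis by (simp add: L_def)
  qed
  have "vec (K ^ (m + l)) (power_entry K (m + l) y) \<in> mat_kernel (kernel_system I J K m l T)"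
    by (rule power_in_kernel) (use K2 low in auto)
  from kernel_spanned_by_powers[OF this]
  obtain w where w: "\<forall>k<K ^ (m + l). power_entry K (m + l) y k = (\<Sum>q<Q. power_entry K (m + l) (xs q) k * w q)"
    by auto
  have "L y = (\<Sum>k<K ^ (m + l). D k * (\<Sum>q<Q. power_entry K (m + l) (xs q) k * w q))"
    unfolding L[symmetric] using w by simp
  also have "\<dots> = (\<Sum>k<K ^ (m + l). \<Sum>q<Q. D k * power_entry K (m + l) (xs q) k * w q)"
    by (simp add: sum_distrib_left mult.assoc)
  also have "\<dots> = (\<Sum>q<Q. \<Sum>k<K ^ (m + l). D k * power_entry K (m + l) (xs q) k * w q)" by (rule sum.swap)
  also have "\<dots> = (\<Sum>q<Q. L (xs q) * w q)" by (simp add: sum_distrib_right[symmetric] L)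
  also have "\<dots> = 0" using Lxs by simp
  finally have "L y = 0" .
  moreover have "L y \<noteq> 0" using A(1) r A(2) by (auto simp: L_def)
  ultimately show False by blast
qed

sublocale rank_drop I J K R m T c
  by unfold_locales (rule K2, rule KR, rule m, rule gp, rule low_rank_points)

text \<open>Every term is the term \<open>p\<close> of a pencil between two labelled points: their labels differ in one element only.\<close>

lemma adjacent_labels:
  assumes r: "r < R"
  shows "\<exists>q<Q. \<exists>q'<Q. \<exists>U s. adjacent_points I J K R m T c c a b U r s (xs q) (xs q')"
proof -
  have "K - 2 \<le> card ({..<R} - {r})" using KR r by simp
  then obtain U where U: "U \<subseteq> {..<R} - {r}" "card U = K - 2" using exists_subset_with_card by blast
  have finU: "finite U" using U(1) finite_subset by blast
  have "card (insert r U) < card {..<R}" using finU U K2 KR by (auto simp: card_insert_if)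
  then have "\<not> {..<R} \<subseteq> insert r U" using card_mono[of "insert r U" "{..<R}"] finU by auto
  then obtain s where s: "s < R" "s \<noteq> r" "s \<notin> U" by auto
  have rU: "r \<notin> U" using U(1) by blast
  have "insert r U \<subseteq> {..<R}" "card (insert r U) = K - 1"
    using U r rU card_insert_disjoint[OF finU rU] K2 by auto
  then obtain q where q: "q < Q" "S q = insert r U" using S_cover by blast
  have "insert s U \<subseteq> {..<R}" "card (insert s U) = K - 1"
    using U s card_insert_disjoint[OF finU s(3)] K2 by auto
  then obtain q' where q': "q' < Q" "S q' = insert s U" using S_cover by blast
  have "adjacent_points I J K R m T c c a b U r s (xs q) (xs q')"
  proof unfold_locales
    show "U \<subseteq> {..<R}" "r \<notin> U" using U by auto
    show "form K c t (xs q) = 0" if "t \<in> insert r U" for t using xs(2)[OF q(1)] q(2) that by blast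
    show "form K c t (xs q') = 0" if "t \<in> insert s U" for t using xs(2)[OF q'(1)] q'(2) that by blast
  qed (use dec gp U(2) r s xs(1) q(1) q'(1) in auto)
  then show ?thesis using q(1) q'(1) by blast
qed

lemma xs_independent:
  assumes q: "q < Q" "q' < Q" "q \<noteq> q'" and 0: "\<not> nonzero K (\<lambda>k. s * xs q k + t * xs q' k)"
  shows "s = 0 \<and> t = 0"
proof -
  have f: "s * form K c r (xs q) + t * form K c r (xs q') = 0" for r
    using 0 unfolding form_add[symmetric] by (simp add: form_def)
  obtain r where r: "r \<in> S q'" "r \<in> {..<R} - S q" using S_differ[OF q] by blast
  obtain r' where r': "r' \<in> S q" "r' \<in> {..<R} - S q'" using S_differ[OF q(2,1)] q(3) by blast
  show ?thesis
    using f[of r] f[of r'] xs(2)[OF q(2) r(1)] xs(2)[OF q(1) r'(1)]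
      form_nonzero[OF q(1) r(2)] form_nonzero[OF q(2) r'(2)] by simp
qed

end

lemma tensor_frame_exists:
  assumes "2 \<le> K" "K \<le> R" "m = R - K + 2" "general_position K R c" "decomposes I J K R T a b c"
    and "Q = R choose (K - 1)"
    and "subspace_dim (K ^ (m + l)) (mat_kernel (kernel_system I J K m l T)) = Q"
  shows "\<exists>S xs. tensor_frame I J K R m l Q T a b c S xs"
proof -
  have "finite {S. S \<subseteq> {..<R} \<and> card S = K - 1}" by (rule finite_subset[of _ "Pow {..<R}"]) auto
  moreover have "card {S. S \<subseteq> {..<R} \<and> card S = K - 1} = Q" using n_subsets[of "{..<R}"] assms(6) by simp
  ultimately obtain S where S: "bij_betw S {..<Q} {S. S \<subseteq> {..<R} \<and> card S = K - 1}"
    using ex_bij_betw_nat_finite[of "{S. S \<subseteq> {..<R} \<and> card S = K - 1}"] by (auto simp: atLeast0LessThan)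
  have "\<exists>x. q < Q \<longrightarrow> nonzero K x \<and> (\<forall>r\<in>S q. form K c r x = 0)" for q
  proof (cases "q < Q")
    case True
    then have "S q \<subseteq> {..<R}" "card (S q) = K - 1" using S by (auto simp: bij_betw_def)
    then show ?thesis using exists_common_zero[of "S q" K c] finite_subset[of "S q" "{..<R}"] assms(1) by auto
  qed simp
  then obtain xs where xs: "\<And>q. q < Q \<longrightarrow> nonzero K (xs q) \<and> (\<forall>r\<in>S q. form K c r (xs q) = 0)"
    using choice[of "\<lambda>q x. q < Q \<longrightarrow> nonzero K x \<and> (\<forall>r\<in>S q. form K c r x = 0)"] by blast
  have "tensor_frame I J K R m l Q T a b c S xs"
    by unfold_locales (use assms S xs in auto)
  then show ?thesis by blast
qed

section \<open>Algebraic algorithms as refinement of state predicates\<close>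

text \<open>Quantities that depend on the tensor and on the registers, and that a single expression computes in all
  states that satisfy \<open>P\<close>.\<close>

definition computable :: "(tensor \<Rightarrow> real mat list \<Rightarrow> bool) \<Rightarrow> (tensor \<Rightarrow> real mat list \<Rightarrow> real) \<Rightarrow> bool" where
  "computable P f \<longleftrightarrow> (\<exists>e. \<forall>T \<rho>. P T \<rho> \<longrightarrow> adefined \<rho> e \<and> aval \<rho> e = f T \<rho>)"

lemma computableI: "(\<And>T \<rho>. P T \<rho> \<Longrightarrow> adefined \<rho> e \<and> aval \<rho> e = f T \<rho>) \<Longrightarrow> computable P f"
  unfolding computable_def by (intro exI[of _ e]) simp

lemma computable_cong:
  assumes "computable P g" "\<And>T \<rho>. P T \<rho> \<Longrightarrow> f T \<rho> = g T \<rho>"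
  shows "computable P f"
proof -
  obtain e where "\<forall>T \<rho>. P T \<rho> \<longrightarrow> adefined \<rho> e \<and> aval \<rho> e = g T \<rho>" using assms(1) unfolding computable_def by blast
  then show ?thesis by (intro computableI[of P e]) (simp add: assms(2))
qed

lemma computable_mono:
  assumes "computable P f" "\<And>T \<rho>. P' T \<rho> \<Longrightarrow> P T \<rho>"
  shows "computable P' f"
proof -
  obtain e where "\<forall>T \<rho>. P T \<rho> \<longrightarrow> adefined \<rho> e \<and> aval \<rho> e = f T \<rho>" using assms(1) unfolding computable_def by blast
  then show ?thesis using assms(2) by (intro computableI[of P' e]) blast
qed

lemma computable_rat: "computable P (\<lambda>T \<rho>. of_rat q)"
  by (rule computableI[of _ "Const q"]) simp

lemma computable_of_nat: "computable P (\<lambda>T \<rho>. of_nat k)"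
  using computable_rat[of P "of_nat k"] by simp

lemma computable_0: "computable P (\<lambda>T \<rho>. 0)" and computable_1: "computable P (\<lambda>T \<rho>. 1)"
  using computable_of_nat[of P 0] computable_of_nat[of P 1] by simp_all

lemma computable_entry:
  assumes "\<And>T \<rho>. P T \<rho> \<Longrightarrow> x < length \<rho> \<and> i < dim_row (\<rho> ! x) \<and> j < dim_col (\<rho> ! x)"
  shows "computable P (\<lambda>T \<rho>. (\<rho> ! x) $$ (i, j))"
  by (rule computableI[of _ "Entry x i j"]) (simp add: assms)

lemma computable_add: "computable P f \<Longrightarrow> computable P g \<Longrightarrow> computable P (\<lambda>T \<rho>. f T \<rho> + g T \<rho>)"
  and computable_diff: "computable P f \<Longrightarrow> computable P g \<Longrightarrow> computable P (\<lambda>T \<rho>. f T \<rho> - g T \<rho>)"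
  and computable_mult: "computable P f \<Longrightarrow> computable P g \<Longrightarrow> computable P (\<lambda>T \<rho>. f T \<rho> * g T \<rho>)"
  and computable_divide: "computable P f \<Longrightarrow> computable P g \<Longrightarrow> (\<And>T \<rho>. P T \<rho> \<Longrightarrow> g T \<rho> \<noteq> 0) \<Longrightarrow>
    computable P (\<lambda>T \<rho>. f T \<rho> / g T \<rho>)"
proof -
  assume "computable P f" "computable P g"
  then obtain d e where "\<forall>T \<rho>. P T \<rho> \<longrightarrow> adefined \<rho> d \<and> aval \<rho> d = f T \<rho>"
    and "\<forall>T \<rho>. P T \<rho> \<longrightarrow> adefined \<rho> e \<and> aval \<rho> e = g T \<rho>"
    unfolding computable_def by blast
  note de = this
  show "computable P (\<lambda>T \<rho>. f T \<rho> + g T \<rho>)" by (rule computableI[of _ "Add d e"]) (use de in simp)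
  show "computable P (\<lambda>T \<rho>. f T \<rho> - g T \<rho>)" by (rule computableI[of _ "Sub d e"]) (use de in simp)
  show "computable P (\<lambda>T \<rho>. f T \<rho> * g T \<rho>)" by (rule computableI[of _ "Mul d e"]) (use de in simp)
  show "computable P (\<lambda>T \<rho>. f T \<rho> / g T \<rho>)" if "\<And>T \<rho>. P T \<rho> \<Longrightarrow> g T \<rho> \<noteq> 0"
    by (rule computableI[of _ "Div d e"]) (use de that in simp)
qed

lemma computable_uminus: "computable P f \<Longrightarrow> computable P (\<lambda>T \<rho>. - f T \<rho>)"
  using computable_diff[OF computable_0, of P f] by simp

lemma computable_sum:
  "finite A \<Longrightarrow> (\<And>x. x \<in> A \<Longrightarrow> computable P (f x)) \<Longrightarrow> computable P (\<lambda>T \<rho>. \<Sum>x\<in>A. f x T \<rho>)"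
  by (induction A rule: finite_induct) (auto intro: computable_0 computable_add)

lemma computable_prod:
  "finite A \<Longrightarrow> (\<And>x. x \<in> A \<Longrightarrow> computable P (f x)) \<Longrightarrow> computable P (\<lambda>T \<rho>. \<Prod>x\<in>A. f x T \<rho>)"
  by (induction A rule: finite_induct) (auto intro: computable_1 computable_mult)

lemma computable_det:
  assumes "\<And>u v. u < m \<Longrightarrow> v < m \<Longrightarrow> computable P (f u v)"
  shows "computable P (\<lambda>T \<rho>. det (mat m m (\<lambda>(u, v). f u v T \<rho>)))"
  unfolding det_by_columns
proof (rule computable_sum)
  show "finite {\<tau>. \<tau> permutes {..<m}}" by (rule finite_permutations_lessThan)
  fix \<tau> assume "\<tau> \<in> {\<tau>. \<tau> permutes {..<m}}"
  then have \<tau>: "\<tau> v < m" if "v < m" for v using permutes_in_image[of \<tau> "{..<m}" v] that by simp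
  have "computable P (\<lambda>T \<rho>. signof \<tau>)"
    using computable_1[of P] computable_uminus[OF computable_1, of P] by (cases "sign \<tau> = 1") (auto simp: sign_def)
  then show "computable P (\<lambda>T \<rho>. signof \<tau> * (\<Prod>v<m. f (\<tau> v) v T \<rho>))"
    by (intro computable_mult computable_prod) (use assms \<tau> in auto)
qed

text \<open>Appending registers does not change the value of an expression.\<close>

lemma adefined_append: "adefined \<rho> e \<Longrightarrow> adefined (\<rho> @ \<rho>') e \<and> aval (\<rho> @ \<rho>') e = aval \<rho> e"
  by (induction e) (auto simp: nth_append)

lemma computable_take:
  assumes "computable (\<lambda>T \<rho>. length \<rho> = n \<and> P T \<rho>) f"
  shows "computable (\<lambda>T \<rho>. n \<le> length \<rho> \<and> P T (take n \<rho>)) (\<lambda>T \<rho>. f T (take n \<rho>))"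
proof -
  obtain e where e: "\<forall>T \<rho>. length \<rho> = n \<and> P T \<rho> \<longrightarrow> adefined \<rho> e \<and> aval \<rho> e = f T \<rho>"
    using assms unfolding computable_def by blast
  show ?thesis
  proof (rule computableI[of _ e])
    fix T \<rho> assume *: "n \<le> length \<rho> \<and> P T (take n \<rho>)"
    then have "length (take n \<rho>) = n \<and> P T (take n \<rho>)" by simp
    then have "adefined (take n \<rho>) e \<and> aval (take n \<rho>) e = f T (take n \<rho>)" using e by blast
    then show "adefined \<rho> e \<and> aval \<rho> e = f T (take n \<rho>)"
      using adefined_append[of "take n \<rho>" e "drop n \<rho>"] by simp
  qed
qed

text \<open>One algorithm achieves the goal \<open>G\<close> from all states with \<open>n\<close> registers that satisfy \<open>P\<close>. Algorithms
  are built backwards: each rule for \<open>solvable\<close> prepends an operation to an algorithm for the states that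
  the operation may lead to.\<close>

definition solvable ::
  "(tensor \<Rightarrow> real mat \<Rightarrow> real mat \<Rightarrow> real mat \<Rightarrow> bool) \<Rightarrow> nat \<Rightarrow> (tensor \<Rightarrow> real mat list \<Rightarrow> bool) \<Rightarrow> bool" where
  "solvable G n P \<longleftrightarrow> (\<exists>alg. \<forall>T \<rho>. length \<rho> = n \<longrightarrow> P T \<rho> \<longrightarrow> all_runs alg \<rho> (G T))"

lemma solvableI: "(\<And>T \<rho>. length \<rho> = n \<Longrightarrow> P T \<rho> \<Longrightarrow> all_runs alg \<rho> (G T)) \<Longrightarrow> solvable G n P"
  unfolding solvable_def by (intro exI[of _ alg]) simp

lemma solvable_mono:
  assumes "solvable G n P'" "\<And>T \<rho>. length \<rho> = n \<Longrightarrow> P T \<rho> \<Longrightarrow> P' T \<rho>"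
  shows "solvable G n P"
proof -
  obtain alg where "\<forall>T \<rho>. length \<rho> = n \<longrightarrow> P' T \<rho> \<longrightarrow> all_runs alg \<rho> (G T)"
    using assms(1) unfolding solvable_def by blast
  then show ?thesis by (intro solvableI[of n P alg G]) (simp add: assms(2))
qed

lemma solvable_impossible: "(\<And>T \<rho>. length \<rho> = n \<Longrightarrow> \<not> P T \<rho>) \<Longrightarrow> solvable G n P"
  by (rule solvableI[of _ _ undefined]) blast

lemma solvable_return:
  assumes "x < n" "y < n" "z < n" "\<And>T \<rho>. length \<rho> = n \<Longrightarrow> P T \<rho> \<Longrightarrow> G T (\<rho> ! x) (\<rho> ! y) (\<rho> ! z)"
  shows "solvable G n P"
  by (rule solvableI[of _ _ "Return x y z"]) (use assms in simp)

lemma solvable_compute: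
  assumes comp: "\<And>i j. i < nr \<Longrightarrow> j < nc \<Longrightarrow> computable (\<lambda>T \<rho>. length \<rho> = n \<and> P T \<rho>) (f i j)"
    and cont: "solvable G (Suc n) (\<lambda>T \<rho>. P T (take n \<rho>) \<and> \<rho> ! n = mat nr nc (\<lambda>(i, j). f i j T (take n \<rho>)))"
  shows "solvable G n P"
proof -
  have "\<forall>i j. \<exists>e. i < nr \<longrightarrow> j < nc \<longrightarrow> (\<forall>T \<rho>. length \<rho> = n \<and> P T \<rho> \<longrightarrow> adefined \<rho> e \<and> aval \<rho> e = f i j T \<rho>)"
    using comp unfolding computable_def by blast
  then have "\<forall>i. \<exists>e. \<forall>j. i < nr \<longrightarrow> j < nc \<longrightarrow> (\<forall>T \<rho>. length \<rho> = n \<and> P T \<rho> \<longrightarrow> adefined \<rho> (e j) \<and> aval \<rho> (e j) = f i j T \<rho>)"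
    by (intro allI choice) blast
  from choice[OF this] obtain e where e: "\<And>i j T \<rho>. i < nr \<Longrightarrow> j < nc \<Longrightarrow> length \<rho> = n \<Longrightarrow> P T \<rho> \<Longrightarrow>
      adefined \<rho> (e i j) \<and> aval \<rho> (e i j) = f i j T \<rho>" by blast
  obtain alg where alg: "\<forall>T \<rho>. length \<rho> = Suc n \<longrightarrow>
      P T (take n \<rho>) \<and> \<rho> ! n = mat nr nc (\<lambda>(i, j). f i j T (take n \<rho>)) \<longrightarrow> all_runs alg \<rho> (G T)"
    using cont unfolding solvable_def by blast
  show ?thesis
  proof (rule solvableI[of _ _ "Do (Compute nr nc e) alg"])
    fix T \<rho> assume *: "length \<rho> = n" "P T \<rho>"
    have mat: "mat nr nc (\<lambda>(i, j). aval \<rho> (e i j)) = mat nr nc (\<lambda>(i, j). f i j T \<rho>)"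
      using e[OF _ _ *] by (intro eq_matI) auto
    have step: "step \<rho> (Compute nr nc e) out \<longleftrightarrow> out = [mat nr nc (\<lambda>(i, j). f i j T \<rho>)]" for out
      using e[OF _ _ *] by (simp add: mat)
    have "all_runs alg (\<rho> @ [mat nr nc (\<lambda>(i, j). f i j T \<rho>)]) (G T)"
      by (rule alg[rule_format]) (use * in auto)
    then show "all_runs (Do (Compute nr nc e) alg) \<rho> (G T)"
      unfolding all_runs.simps step by blast
  qed
qed

lemma solvable_null_basis:
  assumes x: "x < n"
    and cont: "solvable G (Suc n) (\<lambda>T \<rho>. P T (take n \<rho>) \<and> is_null_basis (\<rho> ! x) (\<rho> ! n))"
  shows "solvable G n P"
proof -
  obtain alg where alg: "\<forall>T \<rho>. length \<rho> = Suc n \<longrightarrow> P T (take n \<rho>) \<and> is_null_basis (\<rho> ! x) (\<rho> ! n) \<longrightarrow>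
      all_runs alg \<rho> (G T)"
    using cont unfolding solvable_def by blast
  show ?thesis
  proof (rule solvableI[of _ _ "Do (Null_Space x) alg"])
    fix T \<rho> assume *: "length \<rho> = n" "P T \<rho>"
    have runs: "all_runs alg (\<rho> @ [N]) (G T)" if "is_null_basis (\<rho> ! x) N" for N
      by (rule alg[rule_format]) (use * x that in \<open>auto simp: nth_append\<close>)
    have step: "step \<rho> (Null_Space x) out \<longleftrightarrow> (\<exists>N. is_null_basis (\<rho> ! x) N \<and> out = [N])" for out
      using * x by simp
    obtain N where N: "is_null_basis (\<rho> ! x) N" using null_basis_exists[of "\<rho> ! x"] by blast
    show "all_runs (Do (Null_Space x) alg) \<rho> (G T)"
      unfolding all_runs.simps step
    proof (intro conjI allI impI)
      show "\<exists>out N. is_null_basis (\<rho> ! x) N \<and> out = [N]" by (rule exI[of _ "[N]"], rule exI[of _ N]) (simp add: N)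
    qed (use runs in auto)
  qed
qed

lemma solvable_gevd:
  assumes xy: "x < n" "y < n"
    and ex: "\<And>T \<rho>. length \<rho> = n \<Longrightarrow> P T \<rho> \<Longrightarrow> \<exists>X D E. is_gevd (\<rho> ! x) (\<rho> ! y) X D E"
    and cont: "solvable G (n + 3) (\<lambda>T \<rho>. P T (take n \<rho>) \<and>
      is_gevd (\<rho> ! x) (\<rho> ! y) (\<rho> ! n) (\<rho> ! (n + 1)) (\<rho> ! (n + 2)))"
  shows "solvable G n P"
proof -
  obtain alg where alg: "\<forall>T \<rho>. length \<rho> = n + 3 \<longrightarrow> P T (take n \<rho>) \<and>
      is_gevd (\<rho> ! x) (\<rho> ! y) (\<rho> ! n) (\<rho> ! (n + 1)) (\<rho> ! (n + 2)) \<longrightarrow> all_runs alg \<rho> (G T)"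
    using cont unfolding solvable_def by blast
  show ?thesis
  proof (rule solvableI[of _ _ "Do (GEVD x y) alg"])
    fix T \<rho> assume *: "length \<rho> = n" "P T \<rho>"
    have runs: "all_runs alg (\<rho> @ [X, D, E]) (G T)" if "is_gevd (\<rho> ! x) (\<rho> ! y) X D E" for X D E
      by (rule alg[rule_format]) (use * xy that in \<open>auto simp: nth_append\<close>)
    have step: "step \<rho> (GEVD x y) out \<longleftrightarrow> (\<exists>X D E. is_gevd (\<rho> ! x) (\<rho> ! y) X D E \<and> out = [X, D, E])" for out
      using * xy by simp
    show "all_runs (Do (GEVD x y) alg) \<rho> (G T)"
      unfolding all_runs.simps step
    proof (intro conjI allI impI)
      show "\<exists>out X D E. is_gevd (\<rho> ! x) (\<rho> ! y) X D E \<and> out = [X, D, E]" using ex[OF *] by auto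
    qed (use runs in auto)
  qed
qed

lemma solvable_zero_test:
  assumes comp: "computable (\<lambda>T \<rho>. length \<rho> = n \<and> P T \<rho>) f"
    and z: "solvable G n (\<lambda>T \<rho>. P T \<rho> \<and> f T \<rho> = 0)" and nz: "solvable G n (\<lambda>T \<rho>. P T \<rho> \<and> f T \<rho> \<noteq> 0)"
  shows "solvable G n P"
proof -
  obtain e where e: "\<forall>T \<rho>. length \<rho> = n \<and> P T \<rho> \<longrightarrow> adefined \<rho> e \<and> aval \<rho> e = f T \<rho>"
    using comp unfolding computable_def by blast
  obtain alg1 where 1: "\<forall>T \<rho>. length \<rho> = n \<longrightarrow> P T \<rho> \<and> f T \<rho> = 0 \<longrightarrow> all_runs alg1 \<rho> (G T)"
    using z unfolding solvable_def by blast
  obtain alg2 where 2: "\<forall>T \<rho>. length \<rho> = n \<longrightarrow> P T \<rho> \<and> f T \<rho> \<noteq> 0 \<longrightarrow> all_runs alg2 \<rho> (G T)"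
    using nz unfolding solvable_def by blast
  show ?thesis by (rule solvableI[of _ _ "If_Zero e alg1 alg2"]) (use e 1 2 in simp)
qed

lemma solvable_cases_cols:
  assumes x: "x < n"
    and bound: "\<And>T \<rho>. length \<rho> = n \<Longrightarrow> P T \<rho> \<Longrightarrow> dim_col (\<rho> ! x) < d"
    and cases: "\<And>k. k < d \<Longrightarrow> solvable G n (\<lambda>T \<rho>. P T \<rho> \<and> dim_col (\<rho> ! x) = k)"
  shows "solvable G n P"
  using bound cases
proof (induction d arbitrary: P)
  case 0
  then show ?case by (intro solvable_impossible) blast
next
  case (Suc d)
  have "solvable G n (\<lambda>T \<rho>. P T \<rho> \<and> dim_col (\<rho> ! x) \<noteq> d)"
  proof (rule Suc.IH)
    show "dim_col (\<rho> ! x) < d" if "length \<rho> = n" "P T \<rho> \<and> dim_col (\<rho> ! x) \<noteq> d" for T \<rho>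
      using Suc.prems(1)[of \<rho> T] that by simp
    show "solvable G n (\<lambda>T \<rho>. (P T \<rho> \<and> dim_col (\<rho> ! x) \<noteq> d) \<and> dim_col (\<rho> ! x) = k)" if "k < d" for k
      by (rule solvable_mono[OF Suc.prems(2)[of k]]) (use that in auto)
  qed
  then obtain alg1 where 1: "\<forall>T \<rho>. length \<rho> = n \<longrightarrow> P T \<rho> \<and> dim_col (\<rho> ! x) \<noteq> d \<longrightarrow> all_runs alg1 \<rho> (G T)"
    unfolding solvable_def by blast
  obtain alg2 where 2: "\<forall>T \<rho>. length \<rho> = n \<longrightarrow> P T \<rho> \<and> dim_col (\<rho> ! x) = d \<longrightarrow> all_runs alg2 \<rho> (G T)"
    using Suc.prems(2)[of d] unfolding solvable_def by blast
  show ?case by (rule solvableI[of _ _ "If_Cols x d alg2 alg1"]) (use x 1 2 in simp)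
qed

text \<open>A matrix of a fixed format whose columns span a null space: a basis, filled up with zero columns.\<close>

definition spans_kernel :: "real mat \<Rightarrow> real mat \<Rightarrow> bool" where
  "spans_kernel M N \<longleftrightarrow> N \<in> carrier_mat (dim_col M) (dim_col M) \<and>
     (\<forall>q<dim_col M. \<forall>a<dim_row M. (\<Sum>c<dim_col M. M $$ (a, c) * N $$ (c, q)) = 0) \<and>
     (\<forall>v. (\<forall>a<dim_row M. (\<Sum>c<dim_col M. M $$ (a, c) * v c) = 0) \<longrightarrow>
       (\<exists>w. \<forall>c<dim_col M. v c = (\<Sum>q<dim_col M. N $$ (c, q) * w q)))"

lemma null_basis_dim_col_le:
  assumes "is_null_basis M N" shows "dim_col N \<le> dim_col M"
proof (rule ccontr)
  assume "\<not> ?thesis"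
  then obtain w where w: "\<exists>q<dim_col N. w q \<noteq> 0" "\<forall>c<dim_col M. (\<Sum>q<dim_col N. N $$ (c, q) * w q) = 0"
    using underdetermined_system[of "dim_col M" "dim_col N" "\<lambda>c q. N $$ (c, q)"] by auto
  then show False using null_basis_indep[OF assms w(2)] by blast
qed

lemma spans_kernel_padded:
  assumes N: "is_null_basis M N"
  shows "spans_kernel M (mat (dim_col M) (dim_col M) (\<lambda>(c, q). if q < dim_col N then N $$ (c, q) else 0))"
    (is "spans_kernel M ?N")
proof -
  have rows: "dim_row N = dim_col M" using N by (simp add: is_null_basis_def)
  have le: "dim_col N \<le> dim_col M" by (rule null_basis_dim_col_le[OF N])
  have "(\<Sum>c<dim_col M. M $$ (a, c) * ?N $$ (c, q)) = 0" if "q < dim_col M" "a < dim_row M" for a q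
  proof (cases "q < dim_col N")
    case True
    have "col N q \<in> mat_kernel M" by (rule null_basis_col_in_kernel[OF N True])
    then have "(\<Sum>c<dim_col M. M $$ (a, c) * col N q $ c) = 0" using that unfolding mat_kernel_iff by blast
    then show ?thesis using True that rows by simp
  qed (use that in simp)
  moreover have "\<exists>w. \<forall>c<dim_col M. v c = (\<Sum>q<dim_col M. ?N $$ (c, q) * w q)"
    if v: "\<forall>a<dim_row M. (\<Sum>c<dim_col M. M $$ (a, c) * v c) = 0" for v
  proof -
    have "vec (dim_col M) v \<in> mat_kernel M" using v unfolding mat_kernel_iff by simp
    from null_basis_expand[OF N this]
    obtain w where w: "\<forall>c<dim_col M. v c = (\<Sum>q<dim_col N. N $$ (c, q) * w q)" by auto
    have "(\<Sum>q<dim_col M. ?N $$ (c, q) * w q) = (\<Sum>q<dim_col N. N $$ (c, q) * w q)" if "c < dim_col M" for c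
      by (rule sum.mono_neutral_cong_right) (use le that in auto)
    then show ?thesis using w by (intro exI[of _ w]) simp
  qed
  ultimately show ?thesis unfolding spans_kernel_def by simp
qed

text \<open>The number of columns of a basis is not known in advance, so the padding is computed in a branch for each
  possible number.\<close>

lemma solvable_spans_kernel:
  assumes x: "x < n" and dim: "\<And>T \<rho>. length \<rho> = n \<Longrightarrow> P T \<rho> \<Longrightarrow> dim_col (\<rho> ! x) = d"
    and cont: "solvable G (n + 2) (\<lambda>T \<rho>. P T (take n \<rho>) \<and> spans_kernel (\<rho> ! x) (\<rho> ! (n + 1)))"
  shows "solvable G n P"
proof (rule solvable_null_basis[OF x])
  let ?P = "\<lambda>T \<rho>. P T (take n \<rho>) \<and> is_null_basis (\<rho> ! x) (\<rho> ! n)"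
  have dimx: "dim_col (\<rho> ! x) = d" if "length \<rho> = Suc n" "?P T \<rho>" for T \<rho>
    using dim[of "take n \<rho>" T] that x by simp
  show "solvable G (Suc n) ?P"
  proof (rule solvable_cases_cols[where x=n and d="Suc d"])
    show "dim_col (\<rho> ! n) < Suc d" if "length \<rho> = Suc n" "?P T \<rho>" for T \<rho>
      using null_basis_dim_col_le[of "\<rho> ! x" "\<rho> ! n"] dimx[OF that] that by simp
    fix k assume k: "k < Suc d"
    let ?Pk = "\<lambda>T \<rho>. ?P T \<rho> \<and> dim_col (\<rho> ! n) = k"
    let ?f = "\<lambda>i j (T :: tensor) (\<rho> :: real mat list). if j < k then (\<rho> ! n) $$ (i, j) else 0"
    show "solvable G (Suc n) ?Pk"
    proof (rule solvable_compute[where f="?f" and nr=d and nc=d])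
      fix i j assume ij: "i < d" "j < d"
      have "computable (\<lambda>T \<rho>. length \<rho> = Suc n \<and> ?Pk T \<rho>) (\<lambda>T \<rho>. (\<rho> ! n) $$ (i, j))" if "j < k"
        by (rule computable_entry) (use that ij dimx in \<open>auto simp: is_null_basis_def\<close>)
      then show "computable (\<lambda>T \<rho>. length \<rho> = Suc n \<and> ?Pk T \<rho>) (?f i j)"
        by (cases "j < k") (simp_all add: computable_0)
    next
      show "solvable G (Suc (Suc n)) (\<lambda>T \<rho>. ?Pk T (take (Suc n) \<rho>) \<and>
          \<rho> ! Suc n = mat d d (\<lambda>(i, j). ?f i j T (take (Suc n) \<rho>)))"
      proof (rule solvable_mono[OF cont[unfolded add_2_eq_Suc']])
        fix T \<rho>
        assume len: "length \<rho> = Suc (Suc n)" and P: "?Pk T (take (Suc n) \<rho>) \<and>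
          \<rho> ! Suc n = mat d d (\<lambda>(i, j). ?f i j T (take (Suc n) \<rho>))"
        have "dim_col (\<rho> ! x) = d" using dimx[of "take (Suc n) \<rho>" T] P len x by simp
        moreover have "is_null_basis (\<rho> ! x) (\<rho> ! n)" "dim_col (\<rho> ! n) = k" using P len x by simp_all
        moreover have "take (Suc n) \<rho> ! n = \<rho> ! n" by simp
        then have "\<rho> ! Suc n = mat d d (\<lambda>(i, j). if j < k then (\<rho> ! n) $$ (i, j) else 0)"
          using P by (simp only:)
        ultimately have "spans_kernel (\<rho> ! x) (\<rho> ! Suc n)"
          using spans_kernel_padded[of "\<rho> ! x" "\<rho> ! n"] by (simp only:)
        then show "P T (take n \<rho>) \<and> spans_kernel (\<rho> ! x) (\<rho> ! (n + 1))"
          using P by (simp add: min_def)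
      qed
    qed
  qed simp
qed

text \<open>The null spaces of \<open>N\<close> matrices, three registers for each of them: the matrix, a basis and the padded
  basis.\<close>

lemma solvable_spans_kernels:
  assumes comp: "\<And>q i j. q < N \<Longrightarrow> i < nr \<Longrightarrow> j < nc \<Longrightarrow>
      computable (\<lambda>T \<rho>. length \<rho> = n \<and> P T \<rho>) (f q i j)"
    and cont: "solvable G (n + 3 * N) (\<lambda>T \<rho>. P T (take n \<rho>) \<and>
      (\<forall>q<N. spans_kernel (mat nr nc (\<lambda>(i, j). f q i j T (take n \<rho>))) (\<rho> ! (n + 3 * q + 2))))"
  shows "solvable G n P"
proof -
  define M where "M q T \<rho> = mat nr nc (\<lambda>(i, j). f q i j T (take n \<rho>))" for q T \<rho>
  define P' where "P' N T \<rho> \<longleftrightarrow> P T (take n \<rho>) \<and> (\<forall>q<N. spans_kernel (M q T \<rho>) (\<rho> ! (n + 3 * q + 2)))" for N T \<rho>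
  have "solvable G (n + 3 * N') (P' N') \<Longrightarrow> solvable G n P" if "N' \<le> N" for N'
    using that
  proof (induction N')
    case 0
    then have "solvable G n (P' 0)" by simp
    then show ?case by (rule solvable_mono) (simp add: P'_def)
  next
    case (Suc N')
    let ?n = "n + 3 * N'"
    have "solvable G ?n (P' N')"
    proof (rule solvable_compute[where nr=nr and nc=nc and f="\<lambda>i j T \<rho>. f N' i j T (take n \<rho>)"])
      fix i j assume "i < nr" "j < nc"
      then have "computable (\<lambda>T \<rho>. length \<rho> = n \<and> P T \<rho>) (f N' i j)" using comp Suc.prems by simp
      from computable_take[OF this]
      show "computable (\<lambda>T \<rho>. length \<rho> = ?n \<and> P' N' T \<rho>) (\<lambda>T \<rho>. f N' i j T (take n \<rho>))"
        by (rule computable_mono) (simp add: P'_def)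
    next
      let ?P = "\<lambda>T \<rho>. P' N' T (take ?n \<rho>) \<and> \<rho> ! ?n = mat nr nc (\<lambda>(i, j). f N' i j T (take n (take ?n \<rho>)))"
      show "solvable G (Suc ?n) ?P"
      proof (rule solvable_spans_kernel[where x="?n" and d=nc])
        show "solvable G (Suc ?n + 2) (\<lambda>T \<rho>. ?P T (take (Suc ?n) \<rho>) \<and> spans_kernel (\<rho> ! ?n) (\<rho> ! (Suc ?n + 1)))"
        proof (rule solvable_mono)
          have "n + 3 * Suc N' = Suc ?n + 2" by simp
          then show "solvable G (Suc ?n + 2) (P' (Suc N'))" using Suc.prems(1) by (simp only:)
          fix T \<rho> assume len: "length \<rho> = Suc ?n + 2"
            and P: "?P T (take (Suc ?n) \<rho>) \<and> spans_kernel (\<rho> ! ?n) (\<rho> ! (Suc ?n + 1))"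
          have take: "take n (take k \<rho>) = take n \<rho>" if "n \<le> k" for k using that by (simp add: min_def)
          have old: "P' N' T (take ?n \<rho>)" using P by (simp add: min_def)
          have M: "M q T (take ?n \<rho>) = M q T \<rho>" for q by (simp add: M_def take)
          have "spans_kernel (M q T \<rho>) (\<rho> ! (n + 3 * q + 2))" if "q < Suc N'" for q
          proof (cases "q < N'")
            case True
            then show ?thesis using old M unfolding P'_def by simp
          next
            case False
            then have q: "q = N'" using that by simp
            have entry: "\<rho> ! ?n = M N' T \<rho>" using P by (simp add: M_def take)
            have idx: "n + 3 * N' + 2 = Suc ?n + 1" by simp
            show ?thesis using P unfolding q idx entry by blast
          qed
          moreover have "P T (take n \<rho>)" using old unfolding P'_def by (simp add: take)
          ultimately show "P' (Suc N') T \<rho>" unfolding P'_def by blast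
        qed
      qed auto
    qed
    then show ?case using Suc by simp
  qed
  from this[of N] cont show ?thesis unfolding P'_def M_def by simp
qed

text \<open>Backtracking over finitely many guesses. An attempt may fail only if the guess is not good, which is
  a property of the first \<open>n0\<close> registers. The registers that it has filled are then left alone.\<close>

lemma solvable_search:
  assumes fin: "finite A"
    and attempt: "\<And>g n P'. g \<in> A \<Longrightarrow> n0 \<le> n \<Longrightarrow> (\<And>T \<rho>. P' T \<rho> \<Longrightarrow> P T \<rho>) \<Longrightarrow>
      (\<And>n'. n \<le> n' \<Longrightarrow> solvable G n' (\<lambda>T \<rho>. P' T (take n0 \<rho>) \<and> \<not> good g T (take n0 \<rho>))) \<Longrightarrow>
      solvable G n (\<lambda>T \<rho>. P' T (take n0 \<rho>))"
    and n: "n0 \<le> n"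
    and fallback: "\<And>n'. n \<le> n' \<Longrightarrow>
      solvable G n' (\<lambda>T \<rho>. P T (take n0 \<rho>) \<and> (\<forall>g\<in>A. \<not> good g T (take n0 \<rho>)))"
  shows "solvable G n (\<lambda>T \<rho>. P T (take n0 \<rho>))"
proof -
  have "solvable G n (\<lambda>T \<rho>. P' T (take n0 \<rho>))"
    if "F \<subseteq> A" "n0 \<le> n" "\<And>T \<rho>. P' T \<rho> \<Longrightarrow> P T \<rho>"
      "\<And>n'. n \<le> n' \<Longrightarrow> solvable G n' (\<lambda>T \<rho>. P' T (take n0 \<rho>) \<and> (\<forall>g\<in>F. \<not> good g T (take n0 \<rho>)))"
    for F n P'
    using finite_subset[OF that(1) fin] that
  proof (induction F arbitrary: n P' rule: finite_induct)
    case empty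
    then show ?case using empty.prems(4)[of n] by simp
  next
    case (insert g F)
    show ?case
    proof (rule attempt[of g n P'])
      fix n' assume n': "n \<le> n'"
      show "solvable G n' (\<lambda>T \<rho>. P' T (take n0 \<rho>) \<and> \<not> good g T (take n0 \<rho>))"
      proof (rule insert.IH[where P'="\<lambda>T \<rho>. P' T \<rho> \<and> \<not> good g T \<rho>"])
        show "F \<subseteq> A" "n0 \<le> n'" using insert.prems(1,2) n' by auto
        show "P T \<rho>" if "P' T \<rho> \<and> \<not> good g T \<rho>" for T \<rho> using insert.prems(3) that by blast
        fix n'' assume "n' \<le> n''"
        then have "solvable G n'' (\<lambda>T \<rho>. P' T (take n0 \<rho>) \<and> (\<forall>g\<in>insert g F. \<not> good g T (take n0 \<rho>)))"
          using insert.prems(4)[of n''] n' by simp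
        then show "solvable G n'' (\<lambda>T \<rho>. (P' T (take n0 \<rho>) \<and> \<not> good g T (take n0 \<rho>)) \<and>
            (\<forall>g\<in>F. \<not> good g T (take n0 \<rho>)))"
          by (rule solvable_mono) simp
      qed
    qed (use insert.prems in auto)
  qed
  from this[of A n P] n fallback show ?thesis by simp
qed

section \<open>Recovering the points of low rank by an eigenvalue decomposition\<close>

text \<open>Points of the moment curve have integer coordinates, and finitely many of them suffice to avoid any given
  number of hyperplanes.\<close>

definition moment :: "nat \<Rightarrow> nat \<Rightarrow> real" where
  "moment t k = real (t ^ k)"

definition moment_form :: "nat \<Rightarrow> nat \<Rightarrow> (nat \<Rightarrow> real) \<Rightarrow> real" where
  "moment_form K t x = (\<Sum>k<K. moment t k * x k)"

text \<open>A hyperplane contains fewer than \<open>K\<close> points of the moment curve.\<close>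

lemma moment_avoids_hyperplanes:
  assumes nz: "\<And>i. i < N \<Longrightarrow> nonzero K (x i)"
  shows "\<exists>t\<le>N * K. \<forall>i<N. moment_form K t (x i) \<noteq> 0"
proof (rule ccontr)
  assume none: "\<not> ?thesis"
  define bad where "bad i = {t. moment_form K t (x i) = 0}" for i
  have bad: "finite (bad i) \<and> card (bad i) \<le> K" if i: "i < N" for i
  proof -
    define p where "p = (\<Sum>k<K. monom (x i k) k)"
    have coeff: "coeff p k = x i k" if "k < K" for k
      using that by (simp add: p_def coeff_sum if_distrib cong: if_cong)
    have "p \<noteq> 0" using nz[OF i] coeff by (metis coeff_0)
    moreover have "degree p \<le> K" unfolding p_def
      by (rule degree_sum_le) (auto intro: order_trans[OF degree_monom_le])
    ultimately have roots: "finite {z. poly p z = 0}" "card {z. poly p z = 0} \<le> K"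
      using poly_roots_finite[of p] card_poly_roots_bound[of p] by auto
    have "poly p (real t) = moment_form K t (x i)" for t
      by (simp add: p_def poly_sum poly_monom moment_form_def moment_def mult.commute)
    then have sub: "real ` bad i \<subseteq> {z. poly p z = 0}" by (auto simp: bad_def)
    have inj: "inj_on real (bad i)" by (simp add: inj_on_def)
    have "finite (real ` bad i)" using sub roots(1) finite_subset by blast
    then have "finite (bad i)" using inj finite_imageD by blast
    moreover have "card (bad i) \<le> card {z. poly p z = 0}"
      using card_mono[OF roots(1) sub] card_image[OF inj] by simp
    ultimately show ?thesis using roots(2) by simp
  qed
  have "{..N * K} \<subseteq> (\<Union>i<N. bad i)" using none by (auto simp: bad_def)
  moreover have "finite (\<Union>i<N. bad i)" using bad by simp
  ultimately have "card {..N * K} \<le> card (\<Union>i<N. bad i)" by (intro card_mono)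
  also have "\<dots> \<le> (\<Sum>i<N. card (bad i))" by (rule card_UN_le) simp
  also have "\<dots> \<le> (\<Sum>i<N. K)" by (rule sum_mono) (use bad in simp)
  finally show False by simp
qed

text \<open>\<open>contract_first\<close> contracts the first mode of the tensor in column \<open>q\<close> of \<open>W\<close> with a point of the moment
  curve, and \<open>contract_rest\<close> all other modes.\<close>

definition contract_first :: "nat \<Rightarrow> nat \<Rightarrow> real mat \<Rightarrow> nat \<Rightarrow> nat \<Rightarrow> nat \<Rightarrow> real" where
  "contract_first K N W t d q = (\<Sum>k<K. moment t k * W $$ (k * K ^ N + d, q))"

definition contract_rest :: "nat \<Rightarrow> nat \<Rightarrow> real mat \<Rightarrow> nat \<Rightarrow> nat \<Rightarrow> nat \<Rightarrow> real" where
  "contract_rest K N W t k q = (\<Sum>d<K ^ N. power_entry K N (moment t) d * W $$ (k * K ^ N + d, q))"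

text \<open>Multiplication by a transpose makes the contracted basis square. It keeps the eigenvectors because
  the contraction with \<open>t\<close> is injective for suitable \<open>t\<close>.\<close>

definition pencil :: "nat \<Rightarrow> nat \<Rightarrow> nat \<Rightarrow> real mat \<Rightarrow> nat \<Rightarrow> nat \<Rightarrow> real mat" where
  "pencil K N Q W s t = mat Q Q (\<lambda>(q, q'). \<Sum>d<K ^ N. contract_first K N W t d q * contract_first K N W s d q')"

text \<open>If column \<open>q\<close> of \<open>W X\<close> is a multiple of the power of some point, then column \<open>q\<close> here is a multiple of that point.\<close>

definition recovered_points :: "nat \<Rightarrow> nat \<Rightarrow> nat \<Rightarrow> real mat \<Rightarrow> real mat \<Rightarrow> nat \<Rightarrow> real mat" where
  "recovered_points K N Q W X t = mat K Q (\<lambda>(k, q). \<Sum>q'<Q. contract_rest K N W t k q' * X $$ (q', q))"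

text \<open>The generalized eigenvalues of the pencil are finite and distinct.\<close>

definition separates :: "nat \<Rightarrow> nat \<Rightarrow> (nat \<Rightarrow> nat \<Rightarrow> real) \<Rightarrow> nat \<Rightarrow> nat \<Rightarrow> bool" where
  "separates K Q xs s t \<longleftrightarrow> (\<forall>q<Q. moment_form K t (xs q) \<noteq> 0) \<and>
     (\<forall>q<Q. \<forall>q'<Q. q \<noteq> q' \<longrightarrow>
        moment_form K s (xs q) * moment_form K t (xs q') \<noteq> moment_form K s (xs q') * moment_form K t (xs q))"

lemma mat_mult_index:
  "A \<in> carrier_mat n m \<Longrightarrow> B \<in> carrier_mat m p \<Longrightarrow> i < n \<Longrightarrow> j < p \<Longrightarrow>
    (A * B) $$ (i, j) = (\<Sum>k<m. A $$ (i, k) * B $$ (k, j) :: real)"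
  by (auto simp: scalar_prod_def atLeast0LessThan intro!: sum.cong)

lemma digits_less:
  fixes k K d N :: nat
  shows "k < K \<Longrightarrow> d < K ^ N \<Longrightarrow> k * K ^ N + d < K ^ Suc N"
proof -
  assume k: "k < K" and d: "d < K ^ N"
  then have "k * K ^ N + d < Suc k * K ^ N" by simp
  also have "\<dots> \<le> K * K ^ N" using k by (intro mult_le_mono1) simp
  finally show ?thesis by simp
qed

context tensor_frame
begin

definition N :: nat where
  "N = m + l - 1"

lemma Suc_N: "m + l = Suc N" and N_eq: "N = m - 1 + l"
  unfolding N_def using m by simp_all

text \<open>Once \<open>t\<close> is fixed, the eigenvalues of two points coincide only if \<open>s\<close> lies on a certain hyperplane.\<close>

lemma separates_exists: "\<exists>s t. s \<le> Q * Q * K \<and> t \<le> Q * Q * K \<and> separates K Q xs s t"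
proof -
  obtain t where t: "t \<le> Q * K" "\<forall>q<Q. moment_form K t (xs q) \<noteq> 0"
    using moment_avoids_hyperplanes[of Q K xs] xs(1) by blast
  define v where "v = (\<lambda>q. moment_form K t (xs q))"
  \<comment> \<open>\<open>i\<close> encodes the pair of \<open>i div Q\<close> and \<open>i mod Q\<close>; on the diagonal any nonzero vector will do.\<close>
  define y where "y i = (if i div Q = i mod Q then xs 0 else
    (\<lambda>k. v (i mod Q) * xs (i div Q) k + (- v (i div Q)) * xs (i mod Q) k))" for i
  have nz: "nonzero K (y i)" if i: "i < Q * Q" for i
  proof -
    have Q0: "0 < Q" using i by (cases Q) auto
    have d: "i div Q < Q" "i mod Q < Q" using i Q0 by (auto simp: less_mult_imp_div_less)
    show ?thesis
    proof (cases "i div Q = i mod Q")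
      case True
      then show ?thesis using xs(1)[OF Q0] by (simp add: y_def)
    next
      case False
      have "v (i mod Q) \<noteq> 0" using t(2) d(2) by (simp add: v_def)
      then have "nonzero K (\<lambda>k. v (i mod Q) * xs (i div Q) k + (- v (i div Q)) * xs (i mod Q) k)"
        using xs_independent[OF d False] by blast
      then show ?thesis using False by (simp add: y_def)
    qed
  qed
  obtain s where s: "s \<le> Q * Q * K" "\<forall>i<Q * Q. moment_form K s (y i) \<noteq> 0"
    using moment_avoids_hyperplanes[of "Q * Q" K y] nz by blast
  have "moment_form K s (xs q) * v q' \<noteq> moment_form K s (xs q') * v q" if q: "q < Q" "q' < Q" "q \<noteq> q'" for q q'
  proof -
    let ?i = "q * Q + q'"
    have "?i < Suc q * Q" using q by simp
    also have "\<dots> \<le> Q * Q" using q by (intro mult_le_mono1) simp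
    finally have "?i < Q * Q" .
    then have "moment_form K s (y ?i) \<noteq> 0" using s by blast
    moreover have "y ?i = (\<lambda>k. v q' * xs q k + (- v q) * xs q' k)" using q by (simp add: y_def)
    moreover have "moment_form K s (\<lambda>k. v q' * xs q k + (- v q) * xs q' k) =
        v q' * moment_form K s (xs q) - v q * moment_form K s (xs q')"
      by (simp add: moment_form_def sum_distrib_left sum_subtractf algebra_simps)
    ultimately show ?thesis by (auto simp: mult.commute)
  qed
  then have "separates K Q xs s t" unfolding separates_def using t(2) by (simp add: v_def)
  moreover have "t \<le> Q * Q * K" using t(1) by (cases Q) (auto intro: le_trans)
  ultimately show ?thesis using s(1) by blast
qed

lemma null_basis_cols:
  assumes "is_null_basis (kernel_system I J K m l T) W"
  shows "dim_row W = K ^ (m + l)" "dim_col W = Q"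
  using assms null_basis_dim[OF assms] dim by (auto simp: is_null_basis_def dim_kernel_system)

text \<open>A basis of the kernel and the powers of the labelled points can be expressed in terms of each other.\<close>

lemma exists_coefficients:
  assumes W: "is_null_basis (kernel_system I J K m l T) W"
  shows "\<exists>w w'. (\<forall>q<Q. \<forall>c<K ^ (m + l). W $$ (c, q) = (\<Sum>p<Q. power_entry K (m + l) (xs p) c * w p q)) \<and>
    (\<forall>p<Q. \<forall>p'<Q. (\<Sum>q<Q. w p q * w' q p') = (if p = p' then 1 else 0))"
proof -
  let ?n = "m + l"
  have dimW: "dim_row W = K ^ ?n" "dim_col W = Q" by (rule null_basis_cols[OF W])+
  have "\<exists>w. q < Q \<longrightarrow> (\<forall>c<K ^ ?n. W $$ (c, q) = (\<Sum>p<Q. power_entry K ?n (xs p) c * w p))" for q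
  proof (cases "q < Q")
    case True
    then have "col W q \<in> mat_kernel (kernel_system I J K m l T)"
      using null_basis_col_in_kernel[OF W] dimW by simp
    from kernel_spanned_by_powers[OF this] show ?thesis using True dimW by simp
  qed simp
  then have "\<forall>q. \<exists>w. q < Q \<longrightarrow> (\<forall>c<K ^ ?n. W $$ (c, q) = (\<Sum>p<Q. power_entry K ?n (xs p) c * w p))" ..
  from choice[OF this] obtain w0 where
    w0: "\<forall>q. q < Q \<longrightarrow> (\<forall>c<K ^ ?n. W $$ (c, q) = (\<Sum>p<Q. power_entry K ?n (xs p) c * w0 q p))" ..
  have "\<exists>w'. p < Q \<longrightarrow> (\<forall>c<K ^ ?n. power_entry K ?n (xs p) c = (\<Sum>q<Q. W $$ (c, q) * w' q))" for p
  proof (cases "p < Q")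
    case True
    have "vec (K ^ ?n) (power_entry K ?n (xs p)) \<in> mat_kernel (kernel_system I J K m l T)"
      by (rule power_in_kernel[OF _ low_rank_at_xs[OF True]]) (use K2 in simp)
    from null_basis_expand[OF W this] show ?thesis unfolding dim_kernel_system dimW by simp
  qed simp
  then have "\<forall>p. \<exists>w'. p < Q \<longrightarrow> (\<forall>c<K ^ ?n. power_entry K ?n (xs p) c = (\<Sum>q<Q. W $$ (c, q) * w' q))" ..
  from choice[OF this] obtain w1 where
    w1: "\<forall>p. p < Q \<longrightarrow> (\<forall>c<K ^ ?n. power_entry K ?n (xs p) c = (\<Sum>q<Q. W $$ (c, q) * w1 p q))" ..
  define w where "w p q = w0 q p" for p q
  define w' where "w' q p = w1 p q" for p q
  have "(\<Sum>q<Q. w p q * w' q p') = (if p = p' then 1 else 0)" if p': "p' < Q" and p: "p < Q" for p p'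
  proof -
    define y where "y p = (\<Sum>q<Q. w p q * w' q p') - (if p = p' then 1 else 0)" for p
    have "(\<Sum>p<Q. power_entry K ?n (xs p) c * y p) = 0" if c: "c < K ^ ?n" for c
    proof -
      have "power_entry K ?n (xs p') c = (\<Sum>q<Q. W $$ (c, q) * w' q p')"
        using w1 p' c by (simp add: w'_def)
      also have "\<dots> = (\<Sum>q<Q. (\<Sum>p<Q. power_entry K ?n (xs p) c * w p q) * w' q p')"
        using w0 c by (simp add: w_def)
      also have "\<dots> = (\<Sum>p<Q. power_entry K ?n (xs p) c * (\<Sum>q<Q. w p q * w' q p'))"
        using outer_sum_kernel[where f="\<lambda>p c. power_entry K ?n (xs p) c" and g=w] by simp
      finally have 1: "(\<Sum>p<Q. power_entry K ?n (xs p) c * (\<Sum>q<Q. w p q * w' q p')) = power_entry K ?n (xs p') c" ..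
      have 2: "(\<Sum>p<Q. power_entry K ?n (xs p) c * (if p = p' then 1 else 0)) = power_entry K ?n (xs p') c"
        using p' by (simp add: if_distrib cong: if_cong)
      show ?thesis unfolding y_def right_diff_distrib sum_subtractf 1 2 by simp
    qed
    then have "\<forall>p<Q. y p = 0" by (intro powers_independent[of ?n "Suc l"]) (use m in auto)
    then have "y p = 0" using p by blast
    then show ?thesis unfolding y_def by simp
  qed
  then show ?thesis using w0 by (intro exI[of _ w] exI[of _ w']) (simp add: w_def)
qed

end

text \<open>\<open>w\<close> expresses the basis by the powers of the labelled points, and \<open>w'\<close> inverts it.\<close>

locale kernel_basis = tensor_frame +
  fixes W :: "real mat" and w w' :: "nat \<Rightarrow> nat \<Rightarrow> real"
  assumes w: "\<And>q c. q < Q \<Longrightarrow> c < K ^ (m + l) \<Longrightarrow>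
      W $$ (c, q) = (\<Sum>p<Q. power_entry K (m + l) (xs p) c * w p q)"
    and w_w': "\<And>p p'. p < Q \<Longrightarrow> p' < Q \<Longrightarrow> (\<Sum>q<Q. w p q * w' q p') = (if p = p' then 1 else 0)"
begin

abbreviation "pw \<equiv> \<lambda>p. power_entry K N (xs p)"

lemma W_split:
  assumes "q < Q" "k < K" "d < K ^ N"
  shows "W $$ (k * K ^ N + d, q) = (\<Sum>p<Q. xs p k * pw p d * w p q)"
  using w[OF assms(1), of "k * K ^ N + d"] digits_less[OF assms(2,3)] power_entry_Suc[OF assms(2,3)]
  unfolding Suc_N by simp

lemma contract_first_W:
  assumes "q < Q" "d < K ^ N"
  shows "contract_first K N W t d q = (\<Sum>p<Q. pw p d * (moment_form K t (xs p) * w p q))"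
proof -
  have "contract_first K N W t d q = (\<Sum>k<K. \<Sum>p<Q. moment t k * (xs p k * pw p d * w p q))"
    unfolding contract_first_def
    by (intro sum.cong refl) (simp add: W_split assms sum_distrib_left)
  also have "\<dots> = (\<Sum>p<Q. \<Sum>k<K. moment t k * (xs p k * pw p d * w p q))" by (rule sum.swap)
  finally show ?thesis
    by (simp add: moment_form_def sum_distrib_left sum_distrib_right mult_ac)
qed

lemma contract_rest_W:
  assumes "q < Q" "k < K"
  shows "contract_rest K N W t k q = (\<Sum>p<Q. (xs p k * moment_form K t (xs p) ^ N) * w p q)"
proof -
  have eval: "(\<Sum>d<K ^ N. power_entry K N (moment t) d * pw p d) = moment_form K t (xs p) ^ N" for p
    unfolding power_entry_def[of _ _ "moment t"] sum_prod_power_entry[where d="\<lambda>p. moment t"]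
    by (simp add: moment_form_def)
  have "contract_rest K N W t k q =
      (\<Sum>d<K ^ N. \<Sum>p<Q. power_entry K N (moment t) d * (xs p k * pw p d * w p q))"
    unfolding contract_rest_def
    by (intro sum.cong refl) (simp add: W_split assms sum_distrib_left)
  also have "\<dots> = (\<Sum>p<Q. \<Sum>d<K ^ N. power_entry K N (moment t) d * (xs p k * pw p d * w p q))" by (rule sum.swap)
  also have "\<dots> = (\<Sum>p<Q. xs p k * w p q * (\<Sum>d<K ^ N. power_entry K N (moment t) d * pw p d))"
    by (simp add: sum_distrib_left mult_ac)
  finally show ?thesis unfolding eval by (simp add: mult_ac)
qed

lemma contract_first_combination:
  assumes "d < K ^ N"
  shows "(\<Sum>q<Q. contract_first K N W t d q * y q) =
    (\<Sum>p<Q. pw p d * (moment_form K t (xs p) * (\<Sum>q<Q. w p q * y q)))"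
proof -
  have "(\<Sum>q<Q. contract_first K N W t d q * y q) =
      (\<Sum>q<Q. (\<Sum>p<Q. pw p d * (moment_form K t (xs p) * w p q)) * y q)"
    using assms by (simp add: contract_first_W)
  also have "\<dots> = (\<Sum>p<Q. pw p d * (\<Sum>q<Q. (moment_form K t (xs p) * w p q) * y q))"
    using outer_sum_kernel[where f="\<lambda>p d. pw p d" and g="\<lambda>p q. moment_form K t (xs p) * w p q"] by simp
  finally show ?thesis by (simp add: sum_distrib_left mult.assoc)
qed

lemma pencil_mult:
  assumes "X \<in> carrier_mat Q Q" "q < Q" "i < Q"
  shows "(pencil K N Q W s t * X) $$ (q, i) =
    (\<Sum>d<K ^ N. contract_first K N W t d q *
      (\<Sum>p<Q. pw p d * (moment_form K s (xs p) * (\<Sum>q'<Q. w p q' * X $$ (q', i)))))"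
proof -
  have "(pencil K N Q W s t * X) $$ (q, i) =
      (\<Sum>q'<Q. (\<Sum>d<K ^ N. contract_first K N W t d q * contract_first K N W s d q') * X $$ (q', i))"
    using assms by (subst mat_mult_index[of _ Q Q _ Q]) (auto simp: pencil_def)
  also have "\<dots> = (\<Sum>d<K ^ N. contract_first K N W t d q * (\<Sum>q'<Q. contract_first K N W s d q' * X $$ (q', i)))"
    using outer_sum_kernel[where f="\<lambda>d q. contract_first K N W t d q" and g="\<lambda>d q'. contract_first K N W s d q'"]
    by simp
  finally show ?thesis by (simp add: contract_first_combination)
qed

lemma mult_diagonal:
  fixes A D :: "real mat"
  assumes "A \<in> carrier_mat Q Q" "D \<in> carrier_mat Q Q" "diagonal_mat D" "q < Q" "i < Q"
  shows "(A * D) $$ (q, i) = A $$ (q, i) * D $$ (i, i)"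
proof -
  have "(A * D) $$ (q, i) = (\<Sum>k<Q. A $$ (q, k) * D $$ (k, i))" by (rule mat_mult_index) (use assms in auto)
  also have "\<dots> = (\<Sum>k\<in>{i}. A $$ (q, k) * D $$ (k, i))"
    by (rule sum.mono_neutral_right) (use assms in \<open>auto simp: diagonal_mat_def\<close>)
  finally show ?thesis by simp
qed

text \<open>The inverse of \<open>w\<close> diagonalizes both matrices of the pencil at once.\<close>

lemma gevd_exists: "\<exists>X D E. is_gevd (pencil K N Q W s t) (pencil K N Q W t t) X D E"
proof -
  define u where "u p = moment_form K s (xs p)" for p
  define v where "v p = moment_form K t (xs p)" for p
  define X where "X = mat Q Q (\<lambda>(q, p). w' q p)"
  define D where "D = mat Q Q (\<lambda>(p, p'). if p = p' then (if u p = 0 \<and> v p = 0 then 1 else u p) else 0)"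
  define E where "E = mat Q Q (\<lambda>(p, p'). if p = p' then (if u p = 0 \<and> v p = 0 then 1 else v p) else 0)"
  have car: "X \<in> carrier_mat Q Q" "D \<in> carrier_mat Q Q" "E \<in> carrier_mat Q Q"
    "pencil K N Q W s t \<in> carrier_mat Q Q" "pencil K N Q W t t \<in> carrier_mat Q Q"
    by (auto simp: X_def D_def E_def pencil_def)
  have dD: "diagonal_mat D" and dE: "diagonal_mat E" by (auto simp: diagonal_mat_def D_def E_def)
  have wX: "mat Q Q (\<lambda>(p, q). w p q) * X = 1\<^sub>m Q"
  proof (rule eq_matI)
    fix i j assume "i < dim_row (1\<^sub>m Q :: real mat)" "j < dim_col (1\<^sub>m Q :: real mat)"
    then have ij: "i < Q" "j < Q" by auto
    have "(mat Q Q (\<lambda>(p, q). w p q) * X) $$ (i, j) = (\<Sum>k<Q. mat Q Q (\<lambda>(p, q). w p q) $$ (i, k) * X $$ (k, j))"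
      by (rule mat_mult_index) (use ij car in auto)
    then show "(mat Q Q (\<lambda>(p, q). w p q) * X) $$ (i, j) = 1\<^sub>m Q $$ (i, j)"
      using w_w'[OF ij] ij by (simp add: X_def)
  qed (auto simp: X_def)
  have "X * mat Q Q (\<lambda>(p, q). w p q) = 1\<^sub>m Q"
    by (rule mat_mult_left_right_inverse[OF _ car(1) wX]) simp
  then have inv: "invertible_mat X"
    using wX car unfolding invertible_mat_def inverts_mat_def
    by (intro conjI exI[of _ "mat Q Q (\<lambda>(p, q). w p q)"]) auto
  have mult: "(pencil K N Q W r t * X) $$ (q, i) = (\<Sum>d<K ^ N. contract_first K N W t d q * pw i d) * moment_form K r (xs i)"
    if q: "q < Q" "i < Q" for q i r
  proof -
    have "(\<Sum>p<Q. pw p d * (moment_form K r (xs p) * (\<Sum>q'<Q. w p q' * X $$ (q', i)))) = pw i d * moment_form K r (xs i)" for d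
    proof -
      have "(\<Sum>p<Q. pw p d * (moment_form K r (xs p) * (\<Sum>q'<Q. w p q' * X $$ (q', i)))) =
          (\<Sum>p<Q. pw p d * (moment_form K r (xs p) * (if p = i then 1 else 0)))"
        by (rule sum.cong[OF refl]) (use w_w' q in \<open>simp add: X_def\<close>)
      also have "\<dots> = (\<Sum>p\<in>{i}. pw p d * moment_form K r (xs p))"
        by (rule sum.mono_neutral_cong_right) (use q in auto)
      finally show ?thesis by simp
    qed
    then show ?thesis unfolding pencil_mult[OF car(1) q] by (simp add: sum_distrib_right mult.assoc)
  qed
  have "pencil K N Q W s t * X * E = pencil K N Q W t t * X * D"
  proof (rule eq_matI)
    fix q i assume "q < dim_row (pencil K N Q W t t * X * D)" "i < dim_col (pencil K N Q W t t * X * D)"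
    then have q: "q < Q" "i < Q" using car by auto
    have "(pencil K N Q W s t * X * E) $$ (q, i) = (pencil K N Q W s t * X) $$ (q, i) * E $$ (i, i)"
      by (rule mult_diagonal) (use car dE q in auto)
    moreover have "(pencil K N Q W t t * X * D) $$ (q, i) = (pencil K N Q W t t * X) $$ (q, i) * D $$ (i, i)"
      by (rule mult_diagonal) (use car dD q in auto)
    ultimately show "(pencil K N Q W s t * X * E) $$ (q, i) = (pencil K N Q W t t * X * D) $$ (q, i)"
      using mult[OF q, of s] mult[OF q, of t] q by (simp add: D_def E_def u_def v_def)
  qed (use car in auto)
  then have "is_gevd (pencil K N Q W s t) (pencil K N Q W t t) X D E"
    unfolding is_gevd_def using car inv dD dE by (intro exI[of _ Q]) (auto simp: D_def E_def)
  then show ?thesis by blast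
qed

text \<open>Conversely, an eigenvector for which \<open>E q / D q\<close> separates the points is a column of the inverse of
  \<open>w\<close>, up to scaling. The combination \<open>h\<close> below lies in the range of the contracted basis and is orthogonal
  to it, hence it vanishes.\<close>

lemma gevd_columns:
  assumes sep: "separates K Q xs s t"
    and gevd: "is_gevd (pencil K N Q W s t) (pencil K N Q W t t) X D E" and p: "p < Q"
  shows "\<exists>q<Q. \<exists>\<mu>. \<mu> \<noteq> 0 \<and> (\<forall>p'<Q. (\<Sum>q'<Q. w p' q' * X $$ (q', q)) = (if p' = p then \<mu> else 0))"
proof -
  obtain n where n: "{pencil K N Q W s t, pencil K N Q W t t, X, D, E} \<subseteq> carrier_mat n n"
    and inv: "invertible_mat X" and dD: "diagonal_mat D" and dE: "diagonal_mat E"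
    and DE: "\<forall>i<n. D $$ (i, i) \<noteq> 0 \<or> E $$ (i, i) \<noteq> 0"
    and eq: "pencil K N Q W s t * X * E = pencil K N Q W t t * X * D"
    using gevd unfolding is_gevd_def by blast
  have nQ: "n = Q" using n by (auto simp: pencil_def)
  have car: "X \<in> carrier_mat Q Q" "D \<in> carrier_mat Q Q" "E \<in> carrier_mat Q Q"
    "pencil K N Q W s t \<in> carrier_mat Q Q" "pencil K N Q W t t \<in> carrier_mat Q Q"
    using n unfolding nQ by auto
  define u where "u p = moment_form K s (xs p)" for p
  define v where "v p = moment_form K t (xs p)" for p
  define Y where "Y p q = (\<Sum>q'<Q. w p q' * X $$ (q', q))" for p q
  have v0: "v p \<noteq> 0" if "p < Q" for p using sep that by (simp add: separates_def v_def)
  have sepD: "u p * v p' \<noteq> u p' * v p" if "p < Q" "p' < Q" "p \<noteq> p'" for p p'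
    using sep that by (simp add: separates_def u_def v_def)
  have eig: "(E $$ (q, q) * u p - D $$ (q, q) * v p) * Y p q = 0" if q: "q < Q" and p: "p < Q" for p q
  proof -
    define \<delta> where "\<delta> p = (E $$ (q, q) * u p - D $$ (q, q) * v p) * Y p q" for p
    define h where "h d = (\<Sum>p<Q. pw p d * \<delta> p)" for d
    have orth: "(\<Sum>d<K ^ N. contract_first K N W t d q'' * h d) = 0" if q'': "q'' < Q" for q''
    proof -
      have "(pencil K N Q W s t * X) $$ (q'', q) * E $$ (q, q) = (pencil K N Q W t t * X) $$ (q'', q) * D $$ (q, q)"
        using arg_cong[OF eq, of "\<lambda>A. A $$ (q'', q)"]
          mult_diagonal[of "pencil K N Q W s t * X" E q'' q] mult_diagonal[of "pencil K N Q W t t * X" D q'' q]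
          car dD dE q q'' by simp
      then have "0 = (\<Sum>d<K ^ N. contract_first K N W t d q'' * (\<Sum>p<Q. pw p d * (u p * Y p q))) * E $$ (q, q) -
          (\<Sum>d<K ^ N. contract_first K N W t d q'' * (\<Sum>p<Q. pw p d * (v p * Y p q))) * D $$ (q, q)"
        unfolding pencil_mult[OF car(1) q'' q] u_def v_def Y_def by simp
      also have "\<dots> = (\<Sum>d<K ^ N. contract_first K N W t d q'' * h d)"
        by (simp add: h_def \<delta>_def sum_distrib_left sum_distrib_right sum_subtractf[symmetric] algebra_simps)
      finally show ?thesis ..
    qed
    define y where "y q = (\<Sum>p<Q. w' q p * (\<delta> p / v p))" for q
    have wy: "(\<Sum>q<Q. w p q * y q) = \<delta> p / v p" if p: "p < Q" for p
    proof -
      have "(\<Sum>q<Q. w p q * y q) = (\<Sum>q<Q. \<Sum>p'<Q. w p q * w' q p' * (\<delta> p' / v p'))"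
        by (simp add: y_def sum_distrib_left mult.assoc)
      also have "\<dots> = (\<Sum>p'<Q. \<Sum>q<Q. w p q * w' q p' * (\<delta> p' / v p'))" by (rule sum.swap)
      also have "\<dots> = (\<Sum>p'<Q. (if p = p' then 1 else 0) * (\<delta> p' / v p'))"
      proof (rule sum.cong[OF refl])
        fix p' assume "p' \<in> {..<Q}"
        then have "(\<Sum>q<Q. w p q * w' q p') = (if p = p' then 1 else 0)" using w_w'[OF p] by simp
        then show "(\<Sum>q<Q. w p q * w' q p' * (\<delta> p' / v p')) = (if p = p' then 1 else 0) * (\<delta> p' / v p')"
          by (simp only: sum_distrib_right[symmetric])
      qed
      also have "\<dots> = (\<Sum>p'\<in>{p}. \<delta> p' / v p')"
        by (rule sum.mono_neutral_cong_right) (use p in auto)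
      finally show ?thesis by simp
    qed
    have range: "h d = (\<Sum>q<Q. contract_first K N W t d q * y q)" if "d < K ^ N" for d
      unfolding contract_first_combination[OF that] h_def
      by (rule sum.cong[OF refl]) (use wy v0 in \<open>simp add: v_def\<close>)
    have "(\<Sum>d<K ^ N. h d * h d) = (\<Sum>d<K ^ N. \<Sum>q<Q. contract_first K N W t d q * h d * y q)"
      by (rule sum.cong[OF refl]) (simp add: range sum_distrib_right sum_distrib_left mult_ac)
    also have "\<dots> = (\<Sum>q<Q. \<Sum>d<K ^ N. contract_first K N W t d q * h d * y q)" by (rule sum.swap)
    also have "\<dots> = 0" using orth by (simp add: sum_distrib_right[symmetric])
    finally have "(\<Sum>d<K ^ N. h d * h d) = 0" .
    then have "\<forall>d<K ^ N. (\<Sum>p<Q. pw p d * \<delta> p) = 0"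
      by (subst (asm) sum_nonneg_eq_0_iff) (auto simp: h_def)
    then have "\<forall>p<Q. \<delta> p = 0" by (intro powers_independent[OF N_eq]) auto
    then have "\<delta> p = 0" using p by blast
    then show ?thesis by (simp add: \<delta>_def)
  qed
  obtain X' where X': "X' \<in> carrier_mat Q Q" "X * X' = 1\<^sub>m Q"
  proof -
    obtain B where B: "inverts_mat X B" "inverts_mat B X" using inv unfolding invertible_mat_def by blast
    have XB: "X * B = 1\<^sub>m Q" using B(1) car(1) by (simp add: inverts_mat_def)
    have "dim_col B = Q" using arg_cong[OF XB, of dim_col] by simp
    moreover have "dim_row B = Q"
      using arg_cong[OF B(2)[unfolded inverts_mat_def], of dim_col] car(1) by simp
    ultimately show thesis using that[of B] XB by auto
  qed
  have "\<exists>q<Q. Y p q \<noteq> 0"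
  proof (rule ccontr)
    assume "\<not> ?thesis"
    then have 0: "Y p q = 0" if "q < Q" for q using that by blast
    have "w p q' = 0" if q': "q' < Q" for q'
    proof -
      have "w p q' = (\<Sum>q''<Q. w p q'' * (X * X') $$ (q'', q'))"
        unfolding X'(2) using q' by (simp add: if_distrib cong: if_cong)
      also have "\<dots> = (\<Sum>q''<Q. \<Sum>q<Q. w p q'' * X $$ (q'', q) * X' $$ (q, q'))"
        by (rule sum.cong[OF refl])
          (use mat_mult_index[OF car(1) X'(1)] q' in \<open>simp add: sum_distrib_left mult.assoc\<close>)
      also have "\<dots> = (\<Sum>q<Q. \<Sum>q''<Q. w p q'' * X $$ (q'', q) * X' $$ (q, q'))" by (rule sum.swap)
      also have "\<dots> = 0" using 0 by (simp add: Y_def sum_distrib_right[symmetric])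
      finally show ?thesis .
    qed
    then show False using w_w'[OF p p] by simp
  qed
  then obtain q where q: "q < Q" "Y p q \<noteq> 0" by blast
  have e: "E $$ (q, q) * u p = D $$ (q, q) * v p" using eig[OF q(1) p] q(2) by simp
  have "Y p' q = 0" if p': "p' < Q" "p' \<noteq> p" for p'
  proof (rule ccontr)
    assume "Y p' q \<noteq> 0"
    then have e': "E $$ (q, q) * u p' = D $$ (q, q) * v p'" using eig[OF q(1) p'(1)] by simp
    show False
    proof (cases "E $$ (q, q) = 0")
      case True
      then show ?thesis using e v0[OF p] DE q(1) nQ by auto
    next
      case False
      have "E $$ (q, q) * (u p * v p') = D $$ (q, q) * v p * v p'" using e by simp
      also have "\<dots> = E $$ (q, q) * (u p' * v p)" using e' by simp
      finally show ?thesis using False sepD[OF p p'(1)] p'(2) by simp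
    qed
  qed
  then have "(\<Sum>q'<Q. w p' q' * X $$ (q', q)) = (if p' = p then Y p q else 0)" if "p' < Q" for p'
    using that by (simp add: Y_def)
  then show ?thesis using q by blast
qed

lemma recovered_points_proportional:
  assumes sep: "separates K Q xs s t"
    and gevd: "is_gevd (pencil K N Q W s t) (pencil K N Q W t t) X D E" and p: "p < Q"
  shows "\<exists>q<Q. \<exists>\<mu>. \<mu> \<noteq> 0 \<and> (\<forall>k<K. recovered_points K N Q W X t $$ (k, q) = \<mu> * xs p k)"
proof -
  obtain q \<mu> where q: "q < Q" "\<mu> \<noteq> 0"
    and Y: "\<forall>p'<Q. (\<Sum>q'<Q. w p' q' * X $$ (q', q)) = (if p' = p then \<mu> else 0)"
    using gevd_columns[OF assms] by blast
  let ?v = "\<lambda>p. moment_form K t (xs p)"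
  have "recovered_points K N Q W X t $$ (k, q) = \<mu> * ?v p ^ N * xs p k" if k: "k < K" for k
  proof -
    have "recovered_points K N Q W X t $$ (k, q) = (\<Sum>q'<Q. contract_rest K N W t k q' * X $$ (q', q))"
      using k q by (simp add: recovered_points_def)
    also have "\<dots> = (\<Sum>q'<Q. (\<Sum>p'<Q. (xs p' k * ?v p' ^ N) * w p' q') * X $$ (q', q))"
      using k by (simp add: contract_rest_W)
    also have "\<dots> = (\<Sum>p'<Q. (xs p' k * ?v p' ^ N) * (\<Sum>q'<Q. w p' q' * X $$ (q', q)))"
      using outer_sum_kernel[where f="\<lambda>p' k. xs p' k * ?v p' ^ N" and g=w] by simp
    also have "\<dots> = (\<Sum>p'<Q. (xs p' k * ?v p' ^ N) * (if p' = p then \<mu> else 0))"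
      using Y by simp
    also have "\<dots> = (\<Sum>p'\<in>{p}. (xs p' k * ?v p' ^ N) * \<mu>)"
      by (rule sum.mono_neutral_cong_right) (use p in auto)
    finally show ?thesis by simp
  qed
  moreover have "\<mu> * ?v p ^ N \<noteq> 0" using q(2) sep p by (simp add: separates_def)
  ultimately show ?thesis using q(1) by blast
qed

end

section \<open>Recovering the factors\<close>

lemma spans_kernel_zero:
  assumes "spans_kernel M N" "dim_row M = nr" "dim_col M = nc" "q < nc" "a < nr"
  shows "(\<Sum>c<nc. M $$ (a, c) * N $$ (c, q)) = 0"
  using assms unfolding spans_kernel_def by blast

lemma spans_kernel_expand:
  assumes "spans_kernel M N" "dim_row M = nr" "dim_col M = nc"
    and "\<forall>a<nr. (\<Sum>c<nc. M $$ (a, c) * v c) = 0"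
  shows "\<exists>w. \<forall>c<nc. v c = (\<Sum>q<nc. N $$ (c, q) * w q)"
  using assms unfolding spans_kernel_def by blast

text \<open>The columns of a bordered matrix are the rank-one matrices of \<open>a\<close> and \<open>b\<close> and, at last, a further matrix
  \<open>t\<close>. A null vector with a nonzero last entry expresses \<open>t\<close> by the others.\<close>

definition bordered ::
  "nat \<Rightarrow> nat \<Rightarrow> nat \<Rightarrow> (nat \<Rightarrow> nat \<Rightarrow> real) \<Rightarrow> (nat \<Rightarrow> nat \<Rightarrow> real) \<Rightarrow> (nat \<Rightarrow> nat \<Rightarrow> real) \<Rightarrow> real mat" where
  "bordered I J R a b t = mat (I * J) (Suc R)
     (\<lambda>(x, r). if r < R then a r (x div J) * b r (x mod J) else t (x div J) (x mod J))"

text \<open>The sum of squares detects a nonzero last entry in any column of \<open>N\<close>, without choosing a column. The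
  combination of the columns with their last entries as weights is a null vector with this sum as its
  last entry.\<close>

definition border_norm :: "nat \<Rightarrow> real mat \<Rightarrow> real" where
  "border_norm R N = (\<Sum>q<Suc R. N $$ (R, q) * N $$ (R, q))"

definition border_coeff :: "nat \<Rightarrow> real mat \<Rightarrow> nat \<Rightarrow> real" where
  "border_coeff R N r = - (\<Sum>q<Suc R. N $$ (r, q) * N $$ (R, q)) / border_norm R N"

lemma sum_bordered:
  assumes "x < I * J"
  shows "(\<Sum>r<Suc R. bordered I J R a b t $$ (x, r) * v r) =
    (\<Sum>r<R. a r (x div J) * b r (x mod J) * v r) + t (x div J) (x mod J) * v R"
  using assms by (simp add: bordered_def)

lemma bordered_solution:
  assumes N: "spans_kernel (bordered I J R a b t) N" and nz: "border_norm R N \<noteq> 0" and ij: "i < I" "j < J"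
  shows "t i j = (\<Sum>r<R. a r i * b r j * border_coeff R N r)"
proof -
  let ?s = "border_norm R N"
  have "i * J + j < Suc i * J" using ij by simp
  also have "\<dots> \<le> I * J" using ij by (intro mult_le_mono1) simp
  finally have x: "i * J + j < I * J" .
  have d: "(i * J + j) div J = i" "(i * J + j) mod J = j" using ij by simp_all
  have zero: "(\<Sum>r<R. a r i * b r j * N $$ (r, q)) + t i j * N $$ (R, q) = 0" if q: "q < Suc R" for q
  proof -
    have "(\<Sum>r<Suc R. bordered I J R a b t $$ (i * J + j, r) * N $$ (r, q)) = 0"
      by (rule spans_kernel_zero[OF N]) (use x q in \<open>auto simp: bordered_def\<close>)
    then show ?thesis unfolding sum_bordered[OF x] d .
  qed
  have coeff: "border_coeff R N r * ?s = - (\<Sum>q<Suc R. N $$ (r, q) * N $$ (R, q))" for r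
    unfolding border_coeff_def using nz by (simp del: sum.lessThan_Suc)
  have "0 = (\<Sum>q<Suc R. ((\<Sum>r<R. a r i * b r j * N $$ (r, q)) + t i j * N $$ (R, q)) * N $$ (R, q))"
    using zero by (simp del: sum.lessThan_Suc)
  also have "\<dots> = (\<Sum>q<Suc R. (\<Sum>r<R. a r i * b r j * N $$ (r, q)) * N $$ (R, q)) + t i j * ?s"
    unfolding distrib_right sum.distrib border_norm_def sum_distrib_left by (simp only: mult.assoc)
  also have "(\<Sum>q<Suc R. (\<Sum>r<R. a r i * b r j * N $$ (r, q)) * N $$ (R, q)) =
      (\<Sum>r<R. a r i * b r j * (\<Sum>q<Suc R. N $$ (r, q) * N $$ (R, q)))"
    by (rule outer_sum_kernel[where f="\<lambda>r _. a r i * b r j" and g="\<lambda>r q. N $$ (r, q)"])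
  finally have "t i j * ?s = - (\<Sum>r<R. a r i * b r j * (\<Sum>q<Suc R. N $$ (r, q) * N $$ (R, q)))" by linarith
  also have "\<dots> = (\<Sum>r<R. a r i * b r j * border_coeff R N r) * ?s"
    unfolding sum_distrib_right mult.assoc coeff by (simp only: mult_minus_right sum_negf)
  finally show ?thesis using nz by simp
qed

lemma border_norm_nonzero:
  assumes N: "spans_kernel (bordered I J R a b t) N"
    and t: "\<And>i j. i < I \<Longrightarrow> j < J \<Longrightarrow> t i j = (\<Sum>r<R. a r i * b r j * c r)"
  shows "border_norm R N \<noteq> 0"
proof
  assume "border_norm R N = 0"
  then have 0: "N $$ (R, q) = 0" if "q < Suc R" for q
    unfolding border_norm_def using that by (subst (asm) sum_nonneg_eq_0_iff) auto
  define v where "v r = (if r < R then c r else - 1)" for r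
  have zero: "(\<Sum>r<Suc R. bordered I J R a b t $$ (x, r) * v r) = 0" if x: "x < I * J" for x
  proof -
    have "x div J < I" using x by (simp add: less_mult_imp_div_less)
    moreover have "x mod J < J" using x by (cases "J = 0") auto
    ultimately show ?thesis unfolding sum_bordered[OF x] by (simp add: t v_def)
  qed
  have "\<exists>w. \<forall>r<Suc R. v r = (\<Sum>q<Suc R. N $$ (r, q) * w q)"
  proof (rule spans_kernel_expand[OF N])
    show "\<forall>x<I * J. (\<Sum>r<Suc R. bordered I J R a b t $$ (x, r) * v r) = 0" using zero by blast
  qed (simp_all add: bordered_def)
  then obtain w where "\<forall>r<Suc R. v r = (\<Sum>q<Suc R. N $$ (r, q) * w q)" by blast
  then have "v R = (\<Sum>q<Suc R. N $$ (R, q) * w q)" by blast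
  also have "\<dots> = 0" by (rule sum.neutral) (use 0 in auto)
  finally show False by (simp add: v_def)
qed

text \<open>Given the first two factors up to scaling, the third one solves linear systems. A failure shows that
  they are not the factors of a decomposition.\<close>

lemma solvable_third_factor:
  fixes \<alpha> \<beta> :: "nat \<Rightarrow> nat \<Rightarrow> tensor \<Rightarrow> real mat list \<Rightarrow> real"
  assumes comp\<alpha>: "\<And>r i. r < R \<Longrightarrow> i < I \<Longrightarrow> computable (\<lambda>T \<rho>. length \<rho> = n0 \<and> P T \<rho>) (\<alpha> r i)"
    and comp\<beta>: "\<And>r j. r < R \<Longrightarrow> j < J \<Longrightarrow> computable (\<lambda>T \<rho>. length \<rho> = n0 \<and> P T \<rho>) (\<beta> r j)"
    and compT: "\<And>i j k. i < I \<Longrightarrow> j < J \<Longrightarrow> k < K \<Longrightarrow>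
      computable (\<lambda>T \<rho>. length \<rho> = n0 \<and> P T \<rho>) (\<lambda>T \<rho>. T i j k)"
    and rank: "\<And>T \<rho>. P T \<rho> \<Longrightarrow> tensor_rank I J K T = R"
    and n: "n0 \<le> n" and P': "\<And>T \<rho>. P' T \<rho> \<Longrightarrow> P T \<rho>"
    and fallback: "\<And>n'. n \<le> n' \<Longrightarrow> solvable (is_cpd I J K) n' (\<lambda>T \<rho>. P' T (take n0 \<rho>) \<and>
      \<not> (\<exists>c. decomposes I J K R T (\<lambda>r i. \<alpha> r i T (take n0 \<rho>)) (\<lambda>r j. \<beta> r j T (take n0 \<rho>)) c))"
  shows "solvable (is_cpd I J K) n (\<lambda>T \<rho>. P' T (take n0 \<rho>))"
proof -
  let ?G = "is_cpd I J K"
  define a where "a T \<rho> r i = \<alpha> r i T (take n0 \<rho>)" for T \<rho> r i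
  define b where "b T \<rho> r j = \<beta> r j T (take n0 \<rho>)" for T \<rho> r j
  have take: "take n0 (take k \<rho>) = take n0 \<rho>" if "n0 \<le> k" for k and \<rho> :: "real mat list"
    using that by (simp add: min_def)
  have ab_take: "a T (take k \<rho>) = a T \<rho>" "b T (take k \<rho>) = b T \<rho>" if "n0 \<le> k" for k T \<rho>
    using take[OF that] by (intro ext, simp add: a_def b_def)+
  have compa: "computable (\<lambda>T \<rho>. n0 \<le> length \<rho> \<and> P T (take n0 \<rho>)) (\<lambda>T \<rho>. a T \<rho> r i)" if "r < R" "i < I" for r i
    unfolding a_def by (rule computable_take[OF comp\<alpha>[OF that]])
  have compb: "computable (\<lambda>T \<rho>. n0 \<le> length \<rho> \<and> P T (take n0 \<rho>)) (\<lambda>T \<rho>. b T \<rho> r j)" if "r < R" "j < J" for r j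
    unfolding b_def by (rule computable_take[OF comp\<beta>[OF that]])
  have compT': "computable (\<lambda>T \<rho>. n0 \<le> length \<rho> \<and> P T (take n0 \<rho>)) (\<lambda>T \<rho>. T i j k)" if "i < I" "j < J" "k < K" for i j k
    by (rule computable_take[OF compT[OF that]])
  define n2 where "n2 = n + 2 + 3 * K"
  define reg where "reg k = n + 2 + 3 * k + 2" for k
  have reg: "reg k < n2" if "k < K" for k using that by (simp add: reg_def n2_def)
  \<comment> \<open>The states after the computation of the first factor, of the second one, and of the null spaces.\<close>
  define SA where "SA T \<rho> \<longleftrightarrow> P' T (take n0 \<rho>) \<and> \<rho> ! n = mat I R (\<lambda>(i, r). a T \<rho> r i)" for T \<rho>
  define SB where "SB T \<rho> \<longleftrightarrow> SA T \<rho> \<and> \<rho> ! (n + 1) = mat J R (\<lambda>(j, r). b T \<rho> r j)" for T \<rho>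
  define M where "M T \<rho> k = bordered I J R (a T \<rho>) (b T \<rho>) (\<lambda>i j. T i j k)" for T \<rho> k
  define SN where "SN T \<rho> \<longleftrightarrow> SB T \<rho> \<and> (\<forall>k<K. spans_kernel (M T \<rho> k) (\<rho> ! reg k))" for T \<rho>
  define ok where "ok \<rho> = (\<Prod>k<K. border_norm R (\<rho> ! reg k))" for \<rho>
  have SA_take: "SA T (take k \<rho>) \<longleftrightarrow> SA T \<rho>" if "n < k" for k T \<rho>
    using that n by (simp add: SA_def ab_take take)
  have SB_take: "SB T (take k \<rho>) \<longleftrightarrow> SB T \<rho>" if "n + 1 < k" for k T \<rho>
    using that n by (simp add: SB_def SA_take ab_take)
  have M_take: "M T (take k \<rho>) = M T \<rho>" if "n0 \<le> k" for k T \<rho>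
    using that by (intro ext) (simp add: M_def ab_take)
  have SN_take: "SN T (take n2 \<rho>) \<longleftrightarrow> SN T \<rho>" for T \<rho>
    using n reg by (simp add: SN_def SB_take M_take) (simp add: n2_def SB_take M_take)
  have ok_take: "ok (take n2 \<rho>) = ok \<rho>" for \<rho> using reg by (simp add: ok_def)
  have SN_P: "P T (take n0 \<rho>)" if "SN T \<rho>" for T \<rho>
    using that P' by (simp add: SN_def SB_def SA_def)
  have dimN: "\<rho> ! reg k \<in> carrier_mat (Suc R) (Suc R)" if "SN T \<rho>" "k < K" for T \<rho> k
    using that by (auto simp: SN_def spans_kernel_def M_def bordered_def)
  have compN: "computable (\<lambda>T \<rho>. length \<rho> = n2 \<and> SN T \<rho>) (\<lambda>T \<rho>. (\<rho> ! reg k) $$ (r, q))"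
    if "k < K" "r < Suc R" "q < Suc R" for k r q
    by (rule computable_entry) (use reg dimN that in fastforce)
  have comp_norm: "computable (\<lambda>T \<rho>. length \<rho> = n2 \<and> SN T \<rho>) (\<lambda>T \<rho>. border_norm R (\<rho> ! reg k))" if "k < K" for k
    unfolding border_norm_def
    by (intro computable_sum computable_mult compN) (use that in auto)
  have return: "solvable ?G (Suc n2) (\<lambda>T \<rho>. SN T \<rho> \<and> ok \<rho> \<noteq> 0 \<and>
      \<rho> ! n2 = mat K R (\<lambda>(k, r). border_coeff R (\<rho> ! reg k) r))"
  proof (rule solvable_return[of n _ "n + 1" n2])
    fix T \<rho> assume "SN T \<rho> \<and> ok \<rho> \<noteq> 0 \<and> \<rho> ! n2 = mat K R (\<lambda>(k, r). border_coeff R (\<rho> ! reg k) r)"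
    then have SN: "SN T \<rho>" and ok: "ok \<rho> \<noteq> 0" and C: "\<rho> ! n2 = mat K R (\<lambda>(k, r). border_coeff R (\<rho> ! reg k) r)"
      by blast+
    have A: "\<rho> ! n = mat I R (\<lambda>(i, r). a T \<rho> r i)" and B: "\<rho> ! (n + 1) = mat J R (\<lambda>(j, r). b T \<rho> r j)"
      using SN by (auto simp: SN_def SB_def SA_def)
    have "T i j k = (\<Sum>r<R. a T \<rho> r i * b T \<rho> r j * border_coeff R (\<rho> ! reg k) r)"
      if ijk: "i < I" "j < J" "k < K" for i j k
    proof (rule bordered_solution[OF _ _ ijk(1,2)])
      show "spans_kernel (bordered I J R (a T \<rho>) (b T \<rho>) (\<lambda>i j. T i j k)) (\<rho> ! reg k)"
        using SN ijk(3) by (simp add: SN_def M_def)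
      show "border_norm R (\<rho> ! reg k) \<noteq> 0" using ok ijk(3) by (simp add: ok_def)
    qed
    then have "is_pd I J K R T (\<rho> ! n) (\<rho> ! (n + 1)) (\<rho> ! n2)"
      unfolding is_pd_def A B C by simp
    then show "is_cpd I J K T (\<rho> ! n) (\<rho> ! (n + 1)) (\<rho> ! n2)"
      unfolding is_cpd_def rank[OF SN_P[OF SN]] .
  qed (auto simp: n2_def)
  have success: "solvable ?G n2 (\<lambda>T \<rho>. SN T \<rho> \<and> ok \<rho> \<noteq> 0)"
  proof (rule solvable_compute[where nr=K and nc=R and f="\<lambda>k r T \<rho>. border_coeff R (\<rho> ! reg k) r"])
    fix k r assume kr: "k < K" "r < R"
    show "computable (\<lambda>T \<rho>. length \<rho> = n2 \<and> SN T \<rho> \<and> ok \<rho> \<noteq> 0) (\<lambda>T \<rho>. border_coeff R (\<rho> ! reg k) r)"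
      unfolding border_coeff_def
    proof (rule computable_divide)
      show "computable (\<lambda>T \<rho>. length \<rho> = n2 \<and> SN T \<rho> \<and> ok \<rho> \<noteq> 0)
          (\<lambda>T \<rho>. - (\<Sum>q<Suc R. (\<rho> ! reg k) $$ (r, q) * (\<rho> ! reg k) $$ (R, q)))"
        by (rule computable_mono[OF computable_uminus[OF computable_sum[OF _ computable_mult[OF compN compN]]]])
          (use kr in auto)
      show "computable (\<lambda>T \<rho>. length \<rho> = n2 \<and> SN T \<rho> \<and> ok \<rho> \<noteq> 0) (\<lambda>T \<rho>. border_norm R (\<rho> ! reg k))"
        by (rule computable_mono[OF comp_norm[OF kr(1)]]) blast
      show "border_norm R (\<rho> ! reg k) \<noteq> 0" if "length \<rho> = n2 \<and> SN T \<rho> \<and> ok \<rho> \<noteq> 0" for T \<rho>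
        using that kr(1) by (simp add: ok_def)
    qed
  next
    show "solvable ?G (Suc n2) (\<lambda>T \<rho>. (SN T (take n2 \<rho>) \<and> ok (take n2 \<rho>) \<noteq> 0) \<and>
        \<rho> ! n2 = mat K R (\<lambda>(k, r). border_coeff R (take n2 \<rho> ! reg k) r))"
    proof (rule solvable_mono[OF return])
      fix T \<rho> assume *: "(SN T (take n2 \<rho>) \<and> ok (take n2 \<rho>) \<noteq> 0) \<and>
        \<rho> ! n2 = mat K R (\<lambda>(k, r). border_coeff R (take n2 \<rho> ! reg k) r)"
      have "mat K R (\<lambda>(k, r). border_coeff R (take n2 \<rho> ! reg k) r) = mat K R (\<lambda>(k, r). border_coeff R (\<rho> ! reg k) r)"
        by (intro eq_matI) (simp_all add: reg)
      then show "SN T \<rho> \<and> ok \<rho> \<noteq> 0 \<and> \<rho> ! n2 = mat K R (\<lambda>(k, r). border_coeff R (\<rho> ! reg k) r)"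
        using * by (simp add: SN_take ok_take)
    qed
  qed
  have failure: "solvable ?G n2 (\<lambda>T \<rho>. SN T \<rho> \<and> ok \<rho> = 0)"
  proof (rule solvable_mono[OF fallback[of n2]])
    fix T \<rho> assume SN: "SN T \<rho> \<and> ok \<rho> = 0"
    then obtain k where k: "k < K" "border_norm R (\<rho> ! reg k) = 0" by (auto simp: ok_def)
    have "\<not> decomposes I J K R T (a T \<rho>) (b T \<rho>) c" for c
    proof
      assume "decomposes I J K R T (a T \<rho>) (b T \<rho>) c"
      then have "T i j k = (\<Sum>r<R. a T \<rho> r i * b T \<rho> r j * c r k)" if "i < I" "j < J" for i j
        using that k(1) by (simp add: decomposes_def)
      moreover have "spans_kernel (bordered I J R (a T \<rho>) (b T \<rho>) (\<lambda>i j. T i j k)) (\<rho> ! reg k)"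
        using SN k(1) by (simp add: SN_def M_def)
      ultimately have "border_norm R (\<rho> ! reg k) \<noteq> 0" by (intro border_norm_nonzero)
      then show False using k(2) by blast
    qed
    moreover have "P' T (take n0 \<rho>)" using SN by (simp add: SN_def SB_def SA_def)
    ultimately show "P' T (take n0 \<rho>) \<and>
        \<not> (\<exists>c. decomposes I J K R T (\<lambda>r i. \<alpha> r i T (take n0 \<rho>)) (\<lambda>r j. \<beta> r j T (take n0 \<rho>)) c)"
      unfolding a_def b_def by blast
  qed (simp add: n2_def)
  have stepN: "solvable ?G n2 SN"
  proof (rule solvable_zero_test[where f="\<lambda>T \<rho>. ok \<rho>"])
    show "computable (\<lambda>T \<rho>. length \<rho> = n2 \<and> SN T \<rho>) (\<lambda>T \<rho>. ok \<rho>)"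
      unfolding ok_def by (intro computable_prod comp_norm) auto
  qed (fact failure, fact success)
  have stepB: "solvable ?G (n + 2) SB"
  proof (rule solvable_spans_kernels[where N=K and nr="I * J" and nc="Suc R" and
      f="\<lambda>k x r T \<rho>. if r < R then a T \<rho> r (x div J) * b T \<rho> r (x mod J) else T (x div J) (x mod J) k"])
    fix k x r assume k: "k < K" and x: "x < I * J" and r: "r < Suc R"
    have ij: "x div J < I" "x mod J < J" using x by (auto simp: less_mult_imp_div_less intro!: mod_less_divisor gr0I)
    have mono: "computable (\<lambda>T \<rho>. length \<rho> = n + 2 \<and> SB T \<rho>) f"
      if "computable (\<lambda>T \<rho>. n0 \<le> length \<rho> \<and> P T (take n0 \<rho>)) f" for f
      by (rule computable_mono[OF that]) (use n P' in \<open>auto simp: SB_def SA_def\<close>)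
    show "computable (\<lambda>T \<rho>. length \<rho> = n + 2 \<and> SB T \<rho>)
        (\<lambda>T \<rho>. if r < R then a T \<rho> r (x div J) * b T \<rho> r (x mod J) else T (x div J) (x mod J) k)"
    proof (cases "r < R")
      case True
      then show ?thesis
        using computable_mult[OF mono[OF compa[OF True ij(1)]] mono[OF compb[OF True ij(2)]]] by simp
    next
      case False
      then show ?thesis using mono[OF compT'[OF ij k]] by simp
    qed
  next
    show "solvable ?G (n + 2 + 3 * K) (\<lambda>T \<rho>. SB T (take (n + 2) \<rho>) \<and>
        (\<forall>k<K. spans_kernel (mat (I * J) (Suc R) (\<lambda>(x, r). if r < R
            then a T (take (n + 2) \<rho>) r (x div J) * b T (take (n + 2) \<rho>) r (x mod J)
            else T (x div J) (x mod J) k)) (\<rho> ! (n + 2 + 3 * k + 2))))"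
    proof (rule solvable_mono[OF stepN[unfolded n2_def]])
      fix T \<rho> assume *: "SB T (take (n + 2) \<rho>) \<and>
        (\<forall>k<K. spans_kernel (mat (I * J) (Suc R) (\<lambda>(x, r). if r < R
            then a T (take (n + 2) \<rho>) r (x div J) * b T (take (n + 2) \<rho>) r (x mod J)
            else T (x div J) (x mod J) k)) (\<rho> ! (n + 2 + 3 * k + 2)))"
      have t: "n0 \<le> n + 2" using n by simp
      have SB: "SB T \<rho>" using *[THEN conjunct1] SB_take[of "n + 2" T \<rho>] by simp
      show "SN T \<rho>"
        using SB *[THEN conjunct2] unfolding SN_def M_def bordered_def reg_def ab_take[OF t] by blast
    qed
  qed
  have stepA: "solvable ?G (Suc n) SA"
  proof (rule solvable_compute[where nr=J and nc=R and f="\<lambda>j r T \<rho>. b T \<rho> r j"])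
    fix j r assume "j < J" "r < R"
    then show "computable (\<lambda>T \<rho>. length \<rho> = Suc n \<and> SA T \<rho>) (\<lambda>T \<rho>. b T \<rho> r j)"
      by (intro computable_mono[OF compb]) (use n P' in \<open>auto simp: SA_def\<close>)
  next
    show "solvable ?G (Suc (Suc n)) (\<lambda>T \<rho>. SA T (take (Suc n) \<rho>) \<and>
        \<rho> ! Suc n = mat J R (\<lambda>(j, r). b T (take (Suc n) \<rho>) r j))"
      by (rule solvable_mono[OF stepB[unfolded add_2_eq_Suc']])
        (use n in \<open>simp add: SB_def SA_take ab_take\<close>)
  qed
  show ?thesis
  proof (rule solvable_compute[where nr=I and nc=R and f="\<lambda>i r T \<rho>. a T \<rho> r i"])
    fix i r assume "i < I" "r < R"
    then show "computable (\<lambda>T \<rho>. length \<rho> = n \<and> P' T (take n0 \<rho>)) (\<lambda>T \<rho>. a T \<rho> r i)"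
      by (intro computable_mono[OF compa]) (use n P' in auto)
  next
    show "solvable ?G (Suc n) (\<lambda>T \<rho>. P' T (take n0 (take n \<rho>)) \<and>
        \<rho> ! n = mat I R (\<lambda>(i, r). a T (take n \<rho>) r i))"
      by (rule solvable_mono[OF stepA]) (use n in \<open>simp add: SA_def take ab_take\<close>)
  qed
qed

lemma contract_scale:
  assumes "\<And>k. k < K \<Longrightarrow> z k = \<mu> * x k" shows "contract K T z i j = \<mu> * contract K T x i j"
  using assms by (simp add: contract_def sum_distrib_left mult_ac)

text \<open>By \<open>contract_kernel\<close> the columns of \<open>N\<close> are mapped to multiples of \<open>a p\<close>, and not all of them to \<open>0\<close>, since they
  span a kernel vector that is not mapped to \<open>0\<close>.\<close>

lemma (in adjacent_points) factor_from_kernel: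
  assumes N: "spans_kernel (mat I J (\<lambda>(i, j). contract K T x' i j)) N"
    and x': "\<mu> \<noteq> 0" "\<And>k. k < K \<Longrightarrow> x' k = \<mu> * x k" and y': "\<nu> \<noteq> 0" "\<And>k. k < K \<Longrightarrow> y' k = \<nu> * y k"
  shows "\<exists>h<J. \<exists>\<kappa>. \<kappa> \<noteq> 0 \<and> (\<forall>i<I. (\<Sum>j<J. contract K T y' i j * N $$ (j, h)) = \<kappa> * a p i)"
proof -
  have cx: "contract K T x' i j = \<mu> * contract K T x i j" for i j by (rule contract_scale) (rule x'(2))
  have cy: "contract K T y' i j = \<nu> * contract K T y i j" for i j by (rule contract_scale) (rule y'(2))
  obtain z where z: "\<forall>i<I. (\<Sum>j<J. contract K T x i j * z j) = 0" "form K c' p y * (\<Sum>j<J. b p j * z j) \<noteq> 0"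
    using exists_kernel_vector by blast
  have "\<forall>i<I. (\<Sum>j<J. mat I J (\<lambda>(i, j). contract K T x' i j) $$ (i, j) * z j) = 0"
    using z(1) by (simp add: cx mult.assoc flip: sum_distrib_left)
  then have "\<exists>w. \<forall>j<J. z j = (\<Sum>h<J. N $$ (j, h) * w h)"
    by (intro spans_kernel_expand[OF N, where nr=I]) simp_all
  then obtain w where w: "\<forall>j<J. z j = (\<Sum>h<J. N $$ (j, h) * w h)" by blast
  have "(\<Sum>j<J. b p j * z j) = (\<Sum>j<J. \<Sum>h<J. b p j * N $$ (j, h) * w h)"
    using w by (simp add: sum_distrib_left mult.assoc)
  also have "\<dots> = (\<Sum>h<J. \<Sum>j<J. b p j * N $$ (j, h) * w h)" by (rule sum.swap)
  also have "\<dots> = (\<Sum>h<J. (\<Sum>j<J. b p j * N $$ (j, h)) * w h)" by (simp add: sum_distrib_right)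
  finally have eq: "(\<Sum>j<J. b p j * z j) = (\<Sum>h<J. (\<Sum>j<J. b p j * N $$ (j, h)) * w h)" .
  have "\<exists>h<J. (\<Sum>j<J. b p j * N $$ (j, h)) \<noteq> 0"
  proof (rule ccontr)
    assume "\<not> ?thesis"
    then have "(\<Sum>h<J. (\<Sum>j<J. b p j * N $$ (j, h)) * w h) = 0" by (intro sum.neutral) auto
    then show False using z(2) eq by simp
  qed
  then obtain h where h: "h < J" "(\<Sum>j<J. b p j * N $$ (j, h)) \<noteq> 0" by blast
  have "(\<Sum>j<J. contract K T x i j * N $$ (j, h)) = 0" if "i < I" for i
  proof -
    have "(\<Sum>j<J. mat I J (\<lambda>(i, j). contract K T x' i j) $$ (i, j) * N $$ (j, h)) = 0"
      using N h(1) that unfolding spans_kernel_def by simp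
    then show ?thesis using that x'(1) by (simp add: cx mult.assoc flip: sum_distrib_left)
  qed
  from contract_kernel[OF this]
  have "(\<Sum>j<J. contract K T y' i j * N $$ (j, h)) =
      \<nu> * (form K c' p y * (\<Sum>j<J. b p j * N $$ (j, h))) * a p i" if "i < I" for i
    using that by (simp add: cy mult.assoc flip: sum_distrib_left)
  moreover have "\<nu> * (form K c' p y * (\<Sum>j<J. b p j * N $$ (j, h))) \<noteq> 0"
    using h(2) y'(1) y_nonzero_form by simp
  ultimately show ?thesis using h(1) by blast
qed

text \<open>The candidates for the first two factors: column \<open>h\<close> or \<open>h'\<close> of a kernel is mapped by another
  contraction.\<close>

definition left_candidate :: "nat \<Rightarrow> nat \<Rightarrow> tensor \<Rightarrow> real mat \<Rightarrow> real mat \<Rightarrow> nat \<Rightarrow> nat \<Rightarrow> nat \<Rightarrow> real" where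
  "left_candidate K J T F N q' h i = (\<Sum>j<J. contract K T (\<lambda>k. F $$ (k, q')) i j * N $$ (j, h))"

definition right_candidate :: "nat \<Rightarrow> nat \<Rightarrow> tensor \<Rightarrow> real mat \<Rightarrow> real mat \<Rightarrow> nat \<Rightarrow> nat \<Rightarrow> nat \<Rightarrow> real" where
  "right_candidate K I T F N q' h j = (\<Sum>i<I. contract K T (\<lambda>k. F $$ (k, q')) i j * N $$ (i, h))"

text \<open>The guess \<open>g r\<close> for the term \<open>r\<close> consists of the columns of \<open>F\<close> for two adjacent points, followed by the columns
  of the kernels that give the left and the right factor.\<close>

lemma (in tensor_frame) candidates_exist:
  assumes F: "\<And>p. p < Q \<Longrightarrow> \<exists>q<Q. \<exists>\<mu>. \<mu> \<noteq> 0 \<and> (\<forall>k<K. F $$ (k, q) = \<mu> * xs p k)"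
    and Nl: "\<And>q. q < Q \<Longrightarrow> spans_kernel (mat I J (\<lambda>(i, j). contract K T (\<lambda>k. F $$ (k, q)) i j)) (Nl q)"
    and Nr: "\<And>q. q < Q \<Longrightarrow> spans_kernel (mat J I (\<lambda>(j, i). contract K T (\<lambda>k. F $$ (k, q)) i j)) (Nr q)"
  shows "\<exists>g\<in>{..<R} \<rightarrow>\<^sub>E ({..<Q} \<times> {..<Q}) \<times> ({..<J} \<times> {..<I}). \<exists>c.
    decomposes I J K R T
      (\<lambda>r i. left_candidate K J T F (Nl (fst (fst (g r)))) (snd (fst (g r))) (fst (snd (g r))) i)
      (\<lambda>r j. right_candidate K I T F (Nr (fst (fst (g r)))) (snd (fst (g r))) (snd (snd (g r))) j) c"
proof -
  define good where "good r t \<longleftrightarrow> t \<in> ({..<Q} \<times> {..<Q}) \<times> ({..<J} \<times> {..<I}) \<and> (\<exists>\<kappa> \<kappa>'. \<kappa> \<noteq> 0 \<and> \<kappa>' \<noteq> 0 \<and>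
      (\<forall>i<I. left_candidate K J T F (Nl (fst (fst t))) (snd (fst t)) (fst (snd t)) i = \<kappa> * a r i) \<and>
      (\<forall>j<J. right_candidate K I T F (Nr (fst (fst t))) (snd (fst t)) (snd (snd t)) j = \<kappa>' * b r j))" for r t
  have "\<exists>t. good r t" if r: "r < R" for r
  proof -
    obtain p p' U s where p: "p < Q" "p' < Q"
      and adj: "adjacent_points I J K R m T c c a b U r s (xs p) (xs p')"
      using adjacent_labels[OF r] by blast
    obtain q \<mu> where q: "q < Q" "\<mu> \<noteq> 0" "\<forall>k<K. F $$ (k, q) = \<mu> * xs p k" using F[OF p(1)] by blast
    obtain q' \<nu> where q': "q' < Q" "\<nu> \<noteq> 0" "\<forall>k<K. F $$ (k, q') = \<nu> * xs p' k" using F[OF p(2)] by blast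
    have 1: "\<exists>h<J. \<exists>\<kappa>. \<kappa> \<noteq> 0 \<and> (\<forall>i<I. (\<Sum>j<J. contract K T (\<lambda>k. F $$ (k, q')) i j * Nl q $$ (j, h)) = \<kappa> * a r i)"
      by (rule adjacent_points.factor_from_kernel[OF adj Nl[OF q(1)] q(2) _ q'(2)]) (use q(3) q'(3) in auto)
    then obtain h \<kappa> where h: "h < J" "\<kappa> \<noteq> 0" "\<forall>i<I. left_candidate K J T F (Nl q) q' h i = \<kappa> * a r i"
      unfolding left_candidate_def by blast
    have M: "spans_kernel (mat J I (\<lambda>(j, i). contract K (swap_modes T) (\<lambda>k. F $$ (k, q)) j i)) (Nr q)"
      using Nr[OF q(1)] by (simp add: contract_swap_modes)
    have "\<exists>h<I. \<exists>\<kappa>. \<kappa> \<noteq> 0 \<and> (\<forall>j<J. (\<Sum>i<I. contract K (swap_modes T) (\<lambda>k. F $$ (k, q')) j i * Nr q $$ (i, h)) = \<kappa> * b r j)"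
      by (rule adjacent_points.factor_from_kernel[OF adj[THEN adjacent_points.adjacent_points_swap_modes] M q(2) _ q'(2)])
        (use q(3) q'(3) in auto)
    then obtain h' \<kappa>' where h': "h' < I" "\<kappa>' \<noteq> 0" "\<forall>j<J. right_candidate K I T F (Nr q) q' h' j = \<kappa>' * b r j"
      unfolding right_candidate_def contract_swap_modes by blast
    have "good r ((q, q'), (h, h'))"
      unfolding good_def using q(1) q'(1) h h' by auto
    then show ?thesis ..
  qed
  then have "\<forall>r. \<exists>t. r < R \<longrightarrow> good r t" by blast
  from choice[OF this] obtain g0 where g0: "\<forall>r. r < R \<longrightarrow> good r (g0 r)" ..
  define g where "g = restrict g0 {..<R}"
  have g: "good r (g r)" if "r < R" for r using g0 that by (simp add: g_def)
  let ?\<alpha> = "\<lambda>r i. left_candidate K J T F (Nl (fst (fst (g r)))) (snd (fst (g r))) (fst (snd (g r))) i"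
  let ?\<beta> = "\<lambda>r j. right_candidate K I T F (Nr (fst (fst (g r)))) (snd (fst (g r))) (snd (snd (g r))) j"
  have "\<forall>r. \<exists>t. r < R \<longrightarrow> fst t \<noteq> 0 \<and> snd t \<noteq> 0 \<and> (\<forall>i<I. ?\<alpha> r i = fst t * a r i) \<and> (\<forall>j<J. ?\<beta> r j = snd t * b r j)"
  proof
    fix r
    show "\<exists>t. r < R \<longrightarrow> fst t \<noteq> 0 \<and> snd t \<noteq> 0 \<and> (\<forall>i<I. ?\<alpha> r i = fst t * a r i) \<and> (\<forall>j<J. ?\<beta> r j = snd t * b r j)"
    proof (cases "r < R")
      case True
      then obtain \<kappa> \<kappa>' where "\<kappa> \<noteq> 0 \<and> \<kappa>' \<noteq> 0 \<and> (\<forall>i<I. ?\<alpha> r i = \<kappa> * a r i) \<and> (\<forall>j<J. ?\<beta> r j = \<kappa>' * b r j)"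
        using g[OF True] unfolding good_def by blast
      then show ?thesis by (intro exI[of _ "(\<kappa>, \<kappa>')"]) simp
    qed simp
  qed
  from choice[OF this] obtain t where t: "\<forall>r. r < R \<longrightarrow> fst (t r) \<noteq> 0 \<and> snd (t r) \<noteq> 0 \<and>
      (\<forall>i<I. ?\<alpha> r i = fst (t r) * a r i) \<and> (\<forall>j<J. ?\<beta> r j = snd (t r) * b r j)" ..
  have "decomposes I J K R T ?\<alpha> ?\<beta> (\<lambda>r k. c r k / (fst (t r) * snd (t r)))"
    unfolding decomposes_def
  proof (intro allI impI)
    fix i j k assume ijk: "i < I" "j < J" "k < K"
    then have "T i j k = (\<Sum>r<R. a r i * b r j * c r k)" using dec by (simp add: decomposes_def)
    also have "\<dots> = (\<Sum>r<R. ?\<alpha> r i * ?\<beta> r j * (c r k / (fst (t r) * snd (t r))))"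
      by (rule sum.cong[OF refl]) (use t ijk in simp)
    finally show "T i j k = \<dots>" .
  qed
  moreover have "g \<in> {..<R} \<rightarrow>\<^sub>E ({..<Q} \<times> {..<Q}) \<times> ({..<J} \<times> {..<I})"
    using g0 unfolding g_def good_def by auto
  ultimately show ?thesis by blast
qed

section \<open>The algorithm\<close>

definition slices :: "nat \<Rightarrow> nat \<Rightarrow> nat \<Rightarrow> tensor \<Rightarrow> real mat list \<Rightarrow> bool" where
  "slices I J K T \<rho> \<longleftrightarrow> (\<forall>k<K. \<rho> ! k = mat I J (\<lambda>(i, j). T i j k))"

lemma slices_take: "K \<le> n \<Longrightarrow> slices I J K T (take n \<rho>) \<longleftrightarrow> slices I J K T \<rho>"
  by (simp add: slices_def)

lemma computable_slices:
  assumes P: "\<And>T \<rho>. P T \<rho> \<Longrightarrow> K \<le> length \<rho> \<and> slices I J K T \<rho>" and ijk: "i < I" "j < J" "k < K"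
  shows "computable P (\<lambda>T \<rho>. T i j k)"
proof (rule computable_cong)
  show "computable P (\<lambda>T \<rho>. (\<rho> ! k) $$ (i, j))"
  proof (rule computable_entry)
    fix T \<rho> assume "P T \<rho>"
    from P[OF this] show "k < length \<rho> \<and> i < dim_row (\<rho> ! k) \<and> j < dim_col (\<rho> ! k)"
      using ijk by (simp add: slices_def)
  qed
  fix T \<rho> assume "P T \<rho>"
  from P[OF this] show "T i j k = (\<rho> ! k) $$ (i, j)" using ijk by (simp add: slices_def)
qed

lemma computable_contract:
  assumes "\<And>k. k < K \<Longrightarrow> computable P (\<lambda>T \<rho>. T i j k)" "\<And>k. k < K \<Longrightarrow> computable P (\<lambda>T \<rho>. x T \<rho> k)"
  shows "computable P (\<lambda>T \<rho>. contract K T (x T \<rho>) i j)"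
  unfolding contract_def by (intro computable_sum computable_mult assms) auto

lemma computable_R_mat:
  assumes T: "\<And>i j k. i < I \<Longrightarrow> j < J \<Longrightarrow> k < K \<Longrightarrow> computable P (\<lambda>T \<rho>. T i j k)"
    and m: "0 < m" and K: "0 < K" and x: "x < I ^ (m + l) * J ^ (m + l)" and c: "c < K ^ (m + l)"
  shows "computable P (\<lambda>T \<rho>. R_mat I J K m l T $$ (x, c))"
proof -
  let ?n = "m + l"
  define i where "i = digit I ?n (x div J ^ ?n)"
  define j where "j = digit J ?n (x mod J ^ ?n)"
  define k where "k = digit K ?n c"
  have IJ: "0 < I" "0 < J" using x m by (auto intro!: gr0I simp: power_0_left)
  have digits: "i p < I" "j p < J" "k p < K" for p
    by (simp_all add: i_def j_def k_def digit_less IJ K)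
  have const: "computable P (\<lambda>T \<rho>. 1 / (fact m * fact ?n))"
    using computable_divide[OF computable_1 computable_of_nat[of P "fact m * fact ?n"]] by simp
  have eq: "R_mat I J K m l T $$ (x, c) = 1 / (fact m * fact ?n) *
      (\<Sum>\<sigma> | \<sigma> permutes {..<?n}. det (mat m m (\<lambda>(u, v). T (i u) (j v) (k (\<sigma> v)))) *
        (\<Prod>p<l. T (i (m + p)) (j (m + p)) (k (\<sigma> (m + p)))))" for T
    using x c unfolding R_mat_def Let_def i_def j_def k_def by simp
  show ?thesis
    unfolding eq
    by (intro computable_mult const computable_sum finite_permutations_lessThan computable_det
        computable_prod T digits) auto
qed

lemma computable_symmetry_defect: "computable P (\<lambda>T \<rho>. symmetry_defect K n c c')"
proof -
  have "computable P (\<lambda>T \<rho>. of_nat (if c = c' then fact n else 0) -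
      of_nat (card {\<sigma>. \<sigma> permutes {..<n} \<and> (\<forall>p<n. digit K n c' (\<sigma> p) = digit K n c p)}))"
    by (intro computable_diff computable_of_nat)
  then show ?thesis by (rule computable_cong) (simp add: symmetry_defect_def)
qed

lemma computable_kernel_system:
  assumes "\<And>i j k. i < I \<Longrightarrow> j < J \<Longrightarrow> k < K \<Longrightarrow> computable P (\<lambda>T \<rho>. T i j k)"
    and "0 < m" "0 < K" "x < I ^ (m + l) * J ^ (m + l) + K ^ (m + l)" "c < K ^ (m + l)"
  shows "computable P (\<lambda>T \<rho>. kernel_system I J K m l T $$ (x, c))"
proof (cases "x < I ^ (m + l) * J ^ (m + l)")
  case True
  then show ?thesis
    by (intro computable_cong[OF computable_R_mat[OF assms(1-3) True assms(5)]])
      (use assms in \<open>simp_all add: kernel_system_def\<close>)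
next
  case False
  show ?thesis
    by (rule computable_cong[OF computable_symmetry_defect[of P K "m + l" "x - I ^ (m + l) * J ^ (m + l)" c]])
      (use False assms in \<open>simp add: kernel_system_def\<close>)
qed

text \<open>The tensors on which the algorithm must succeed, and those on which it succeeds with the points \<open>st\<close> of the
  moment curve. Both are properties of the tensor alone, independent of the choices that the operations
  leave open.\<close>

definition framed :: "nat \<Rightarrow> nat \<Rightarrow> nat \<Rightarrow> nat \<Rightarrow> nat \<Rightarrow> nat \<Rightarrow> nat \<Rightarrow> tensor \<Rightarrow> bool" where
  "framed I J K R m l Q T \<longleftrightarrow> tensor_rank I J K T = R \<and>
     (\<exists>a b c S xs. tensor_frame I J K R m l Q T a b c S xs)"

definition separated ::
  "nat \<Rightarrow> nat \<Rightarrow> nat \<Rightarrow> nat \<Rightarrow> nat \<Rightarrow> nat \<Rightarrow> nat \<Rightarrow> nat \<times> nat \<Rightarrow> tensor \<Rightarrow> bool" where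
  "separated I J K R m l Q st T \<longleftrightarrow>
     (\<exists>a b c S xs. tensor_frame I J K R m l Q T a b c S xs \<and> separates K Q xs (fst st) (snd st))"

lemma (in tensor_frame) kernel_basis_exists:
  assumes "is_null_basis (kernel_system I J K m l T) W"
  shows "\<exists>w w'. kernel_basis I J K R m l Q T a b c S xs W w w'"
proof -
  obtain w w' where "\<forall>q<Q. \<forall>c<K ^ (m + l). W $$ (c, q) = (\<Sum>p<Q. power_entry K (m + l) (xs p) c * w p q)"
    "\<forall>p<Q. \<forall>p'<Q. (\<Sum>q<Q. w p q * w' q p') = (if p = p' then 1 else 0)"
    using exists_coefficients[OF assms] by blast
  then have "kernel_basis I J K R m l Q T a b c S xs W w w'" by unfold_locales auto
  then show ?thesis by blast
qed

lemma framed_null_basis_dims: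
  assumes "framed I J K R m l Q T" "is_null_basis (kernel_system I J K m l T) W"
  shows "dim_row W = K ^ (m + l) \<and> dim_col W = Q \<and> m + l = Suc (tensor_frame.N m l)"
proof -
  obtain a b c S xs where "tensor_frame I J K R m l Q T a b c S xs" using assms(1) unfolding framed_def by blast
  then interpret tensor_frame I J K R m l Q T a b c S xs .
  show ?thesis using null_basis_cols[OF assms(2)] Suc_N by simp
qed

lemma framed_gevd_exists:
  assumes "framed I J K R m l Q T" "is_null_basis (kernel_system I J K m l T) W"
  shows "\<exists>X D E. is_gevd (pencil K (tensor_frame.N m l) Q W s t) (pencil K (tensor_frame.N m l) Q W t t) X D E"
proof -
  obtain a b c S xs where "tensor_frame I J K R m l Q T a b c S xs" using assms(1) unfolding framed_def by blast
  then interpret tensor_frame I J K R m l Q T a b c S xs .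
  obtain w w' where "kernel_basis I J K R m l Q T a b c S xs W w w'" using kernel_basis_exists[OF assms(2)] by blast
  then show ?thesis by (rule kernel_basis.gevd_exists)
qed

lemma separated_recovered_points:
  assumes "separated I J K R m l Q st T" "is_null_basis (kernel_system I J K m l T) W"
    and gevd: "is_gevd (pencil K (tensor_frame.N m l) Q W (fst st) (snd st))
      (pencil K (tensor_frame.N m l) Q W (snd st) (snd st)) X D E"
  shows "\<exists>a b c S xs. tensor_frame I J K R m l Q T a b c S xs \<and> (\<forall>p<Q. \<exists>q<Q. \<exists>\<mu>. \<mu> \<noteq> 0 \<and>
    (\<forall>k<K. recovered_points K (tensor_frame.N m l) Q W X (snd st) $$ (k, q) = \<mu> * xs p k))"
proof -
  obtain a b c S xs where tf: "tensor_frame I J K R m l Q T a b c S xs"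
    and sep: "separates K Q xs (fst st) (snd st)" using assms(1) unfolding separated_def by blast
  interpret tensor_frame I J K R m l Q T a b c S xs by (rule tf)
  obtain w w' where kb: "kernel_basis I J K R m l Q T a b c S xs W w w'"
    using kernel_basis_exists[OF assms(2)] by blast
  have "\<forall>p<Q. \<exists>q<Q. \<exists>\<mu>. \<mu> \<noteq> 0 \<and>
      (\<forall>k<K. recovered_points K (tensor_frame.N m l) Q W X (snd st) $$ (k, q) = \<mu> * xs p k)"
    using kernel_basis.recovered_points_proportional[OF kb sep gevd] by blast
  with tf show ?thesis by blast
qed

text \<open>One attempt, with the points \<open>s\<close> and \<open>t\<close> of the moment curve: eigenvectors, points of low rank, kernels of
  the contractions by these points and a search for the assignment of points to the terms of the
  decomposition.\<close>

lemma solvable_pencil: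
  assumes n: "K + 2 \<le> n"
    and P': "\<And>T \<rho>. P' T \<rho> \<Longrightarrow> framed I J K R m l Q T \<and> slices I J K T \<rho> \<and>
      is_null_basis (kernel_system I J K m l T) (\<rho> ! (K + 1))"
    and fallback: "\<And>n'. n \<le> n' \<Longrightarrow>
      solvable (is_cpd I J K) n' (\<lambda>T \<rho>. P' T (take (K + 2) \<rho>) \<and> \<not> separated I J K R m l Q st T)"
  shows "solvable (is_cpd I J K) n (\<lambda>T \<rho>. P' T (take (K + 2) \<rho>))"
proof -
  let ?G = "is_cpd I J K"
  define N where "N = tensor_frame.N m l"
  define s t where "s = fst st" and "t = snd st"
  \<comment> \<open>Register \<open>K + 1\<close> holds the basis \<open>W\<close>. From register \<open>n\<close> on follow the pencil (2 registers), its eigenvectors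
    and eigenvalues (3), the points (1) and the padded kernels of the contractions (\<open>3 * Q\<close>) and of their
    transposes (\<open>3 * Q\<close>).\<close>
  define B where "B T \<rho> \<longleftrightarrow> P' T (take (K + 2) \<rho>)" for T \<rho>
  define W where "W \<rho> = \<rho> ! (K + 1)" for \<rho> :: "real mat list"
  define F where "F \<rho> = \<rho> ! (n + 5)" for \<rho> :: "real mat list"
  define n1 where "n1 = n + 6 + 6 * Q"
  define r1 where "r1 q = n + 6 + 3 * q + 2" for q
  define r2 where "r2 q = n + 6 + 3 * Q + 3 * q + 2" for q
  have B_take: "B T (take k \<rho>) \<longleftrightarrow> B T \<rho>" if "n \<le> k" for k T \<rho>
    using that n by (simp add: B_def min_def)
  have W_take: "W (take k \<rho>) = W \<rho>" if "n \<le> k" for k \<rho> using that n by (simp add: W_def)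
  have B_framed: "framed I J K R m l Q T" and B_slices: "slices I J K T \<rho>"
    and B_basis: "is_null_basis (kernel_system I J K m l T) (W \<rho>)" if "B T \<rho>" for T \<rho>
    using P'[of T "take (K + 2) \<rho>"] that by (simp_all add: B_def W_def slices_take)
  have dimW: "dim_row (W \<rho>) = K ^ Suc N" "dim_col (W \<rho>) = Q" if "B T \<rho>" for T \<rho>
    using framed_null_basis_dims[OF B_framed[OF that] B_basis[OF that]] by (simp_all add: N_def)
  define SX where "SX T \<rho> \<longleftrightarrow> B T \<rho> \<and> (\<exists>D E. is_gevd (pencil K N Q (W \<rho>) s t) (pencil K N Q (W \<rho>) t t) (\<rho> ! (n + 2)) D E)" for T \<rho>
  define SF where "SF T \<rho> \<longleftrightarrow> B T \<rho> \<and> (\<exists>X D E. is_gevd (pencil K N Q (W \<rho>) s t) (pencil K N Q (W \<rho>) t t) X D E \<and>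
      F \<rho> = recovered_points K N Q (W \<rho>) X t)" for T \<rho>
  define M where "M T \<rho> q i j = contract K T (\<lambda>k. F \<rho> $$ (k, q)) i j" for T \<rho> q i j
  define SL where "SL T \<rho> \<longleftrightarrow> SF T \<rho> \<and> (\<forall>q<Q. spans_kernel (mat I J (\<lambda>(i, j). M T \<rho> q i j)) (\<rho> ! r1 q))" for T \<rho>
  define SR where "SR T \<rho> \<longleftrightarrow> SL T \<rho> \<and> (\<forall>q<Q. spans_kernel (mat J I (\<lambda>(j, i). M T \<rho> q i j)) (\<rho> ! r2 q))" for T \<rho>
  have F_take: "F (take k \<rho>) = F \<rho>" if "n + 6 \<le> k" for k \<rho> using that by (simp add: F_def)
  have SF_take: "SF T (take k \<rho>) \<longleftrightarrow> SF T \<rho>" if "n + 6 \<le> k" for k T \<rho>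
    using that by (simp add: SF_def B_take W_take F_take)
  have M_take: "M T (take k \<rho>) = M T \<rho>" if "n + 6 \<le> k" for k T \<rho>
    using that by (intro ext) (simp add: M_def F_take)
  have SL_take: "SL T (take k \<rho>) \<longleftrightarrow> SL T \<rho>" if "n + 6 + 3 * Q \<le> k" for k T \<rho>
  proof -
    have "take k \<rho> ! r1 q = \<rho> ! r1 q" if "q < Q" for q
      using that \<open>n + 6 + 3 * Q \<le> k\<close> by (simp add: r1_def)
    then show ?thesis using that by (simp add: SL_def SF_take M_take)
  qed
  have SF_B: "SF T \<rho> \<Longrightarrow> B T \<rho>" and SL_SF: "SL T \<rho> \<Longrightarrow> SF T \<rho>" and SR_SL: "SR T \<rho> \<Longrightarrow> SL T \<rho>" for T \<rho>
    by (simp_all add: SF_def SL_def SR_def)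
  have dimF: "dim_row (F \<rho>) = K" "dim_col (F \<rho>) = Q" if "SF T \<rho>" for T \<rho>
    using that by (auto simp: SF_def recovered_points_def)
  have compF: "computable P (\<lambda>T \<rho>. F \<rho> $$ (k, q))"
    if "\<And>T \<rho>. P T \<rho> \<Longrightarrow> n + 6 \<le> length \<rho> \<and> SF T \<rho>" "k < K" "q < Q" for P k q
    unfolding F_def
  proof (rule computable_entry)
    fix T \<rho> assume "P T \<rho>"
    from that(1)[OF this] show "n + 5 < length \<rho> \<and> k < dim_row (\<rho> ! (n + 5)) \<and> q < dim_col (\<rho> ! (n + 5))"
      using dimF[of T \<rho>] that(2,3) by (simp add: F_def)
  qed
  have compM: "computable P (\<lambda>T \<rho>. M T \<rho> q i j)"
    if P: "\<And>T \<rho>. P T \<rho> \<Longrightarrow> n + 6 \<le> length \<rho> \<and> SF T \<rho>" and "q < Q" "i < I" "j < J" for P q i j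
    unfolding M_def
  proof (rule computable_contract)
    fix k assume k: "k < K"
    show "computable P (\<lambda>T \<rho>. T i j k)"
    proof (rule computable_slices[OF _ that(3,4) k])
      fix T \<rho> assume "P T \<rho>"
      from P[OF this] show "K \<le> length \<rho> \<and> slices I J K T \<rho>" using B_slices[OF SF_B, of T \<rho>] n by simp
    qed
    show "computable P (\<lambda>T \<rho>. F \<rho> $$ (k, q))" by (rule compF[OF P k that(2)])
  qed
  have search: "solvable ?G n1 (\<lambda>T \<rho>. SR T (take n1 \<rho>))"
  proof (rule solvable_search[where n0=n1 and P=SR and
        A="{..<R} \<rightarrow>\<^sub>E ({..<Q} \<times> {..<Q}) \<times> ({..<J} \<times> {..<I})" and
        good="\<lambda>g T \<rho>. \<exists>c. decomposes I J K R T
          (\<lambda>r i. left_candidate K J T (F \<rho>) (\<rho> ! r1 (fst (fst (g r)))) (snd (fst (g r))) (fst (snd (g r))) i)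
          (\<lambda>r j. right_candidate K I T (F \<rho>) (\<rho> ! r2 (fst (fst (g r)))) (snd (fst (g r))) (snd (snd (g r))) j) c"])
    show "finite ({..<R} \<rightarrow>\<^sub>E ({..<Q} \<times> {..<Q}) \<times> ({..<J} \<times> {..<I}))"
      by (intro finite_PiE) auto
  next
    fix g n' and P'' :: "tensor \<Rightarrow> real mat list \<Rightarrow> bool"
    assume g: "g \<in> {..<R} \<rightarrow>\<^sub>E ({..<Q} \<times> {..<Q}) \<times> ({..<J} \<times> {..<I})" and n': "n1 \<le> n'"
      and P'': "\<And>T \<rho>. P'' T \<rho> \<Longrightarrow> SR T \<rho>"
      and fb: "\<And>n''. n' \<le> n'' \<Longrightarrow> solvable ?G n'' (\<lambda>T \<rho>. P'' T (take n1 \<rho>) \<and> \<not> (\<exists>c. decomposes I J K R T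
          (\<lambda>r i. left_candidate K J T (F (take n1 \<rho>)) (take n1 \<rho> ! r1 (fst (fst (g r)))) (snd (fst (g r))) (fst (snd (g r))) i)
          (\<lambda>r j. right_candidate K I T (F (take n1 \<rho>)) (take n1 \<rho> ! r2 (fst (fst (g r)))) (snd (fst (g r))) (snd (snd (g r))) j) c))"
    have gr: "fst (fst (g r)) < Q" "snd (fst (g r)) < Q" "fst (snd (g r)) < J" "snd (snd (g r)) < I" if "r < R" for r
    proof -
      have "g r \<in> ({..<Q} \<times> {..<Q}) \<times> ({..<J} \<times> {..<I})" using g that by (auto simp: PiE_iff)
      then show "fst (fst (g r)) < Q" "snd (fst (g r)) < Q" "fst (snd (g r)) < J" "snd (snd (g r)) < I"
        by auto
    qed
    let ?S = "\<lambda>T \<rho>. length \<rho> = n1 \<and> SR T \<rho>"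
    have S_SF: "n + 6 \<le> length \<rho> \<and> SF T \<rho>" if "?S T \<rho>" for T \<rho>
      using that SR_SL SL_SF by (auto simp: n1_def)
    have S_slices: "K \<le> length \<rho> \<and> slices I J K T \<rho>" if "?S T \<rho>" for T \<rho>
      using S_SF[OF that] B_slices[OF SF_B, of T \<rho>] n by simp
    have comp1: "computable ?S (\<lambda>T \<rho>. (\<rho> ! r1 q) $$ (j, h))" if "q < Q" "j < J" "h < J" for q j h
    proof (rule computable_entry)
      fix T \<rho> assume S: "?S T \<rho>"
      then have "spans_kernel (mat I J (\<lambda>(i, j). M T \<rho> q i j)) (\<rho> ! r1 q)" using that SR_SL by (simp add: SL_def)
      then have "\<rho> ! r1 q \<in> carrier_mat J J" by (simp add: spans_kernel_def)
      then show "r1 q < length \<rho> \<and> j < dim_row (\<rho> ! r1 q) \<and> h < dim_col (\<rho> ! r1 q)"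
        using S that by (simp add: r1_def n1_def)
    qed
    have comp2: "computable ?S (\<lambda>T \<rho>. (\<rho> ! r2 q) $$ (i, h))" if "q < Q" "i < I" "h < I" for q i h
    proof (rule computable_entry)
      fix T \<rho> assume S: "?S T \<rho>"
      then have "spans_kernel (mat J I (\<lambda>(j, i). M T \<rho> q i j)) (\<rho> ! r2 q)" using that by (simp add: SR_def)
      then have "\<rho> ! r2 q \<in> carrier_mat I I" by (simp add: spans_kernel_def)
      then show "r2 q < length \<rho> \<and> i < dim_row (\<rho> ! r2 q) \<and> h < dim_col (\<rho> ! r2 q)"
        using S that by (simp add: r2_def n1_def)
    qed
    show "solvable ?G n' (\<lambda>T \<rho>. P'' T (take n1 \<rho>))"
    proof (rule solvable_third_factor[where P=SR, OF _ _ _ _ n' P'' fb])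
      fix r i assume "r < R" "i < I"
      then show "computable ?S (\<lambda>T \<rho>. left_candidate K J T (F \<rho>) (\<rho> ! r1 (fst (fst (g r)))) (snd (fst (g r))) (fst (snd (g r))) i)"
        unfolding left_candidate_def M_def[symmetric]
        by (intro computable_sum computable_mult compM comp1 S_SF gr) auto
    next
      fix r j assume "r < R" "j < J"
      then show "computable ?S (\<lambda>T \<rho>. right_candidate K I T (F \<rho>) (\<rho> ! r2 (fst (fst (g r)))) (snd (fst (g r))) (snd (snd (g r))) j)"
        unfolding right_candidate_def M_def[symmetric]
        by (intro computable_sum computable_mult compM comp2 S_SF gr) auto
    next
      fix i j k assume ijk: "i < I" "j < J" "k < K"
      show "computable ?S (\<lambda>T \<rho>. T i j k)"
        by (rule computable_slices[OF _ ijk]) (rule S_slices)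
    next
      show "tensor_rank I J K T = R" if "SR T \<rho>" for T \<rho>
        using B_framed[OF SF_B[OF SL_SF[OF SR_SL[OF that]]]] by (simp add: framed_def)
    qed
  next
    fix n' assume n': "n1 \<le> n'"
    have "n \<le> n'" using n' by (simp add: n1_def)
    from fallback[OF this]
    show "solvable ?G n' (\<lambda>T \<rho>. SR T (take n1 \<rho>) \<and> (\<forall>g\<in>{..<R} \<rightarrow>\<^sub>E ({..<Q} \<times> {..<Q}) \<times> ({..<J} \<times> {..<I}). \<not> (\<exists>c. decomposes I J K R T
          (\<lambda>r i. left_candidate K J T (F (take n1 \<rho>)) (take n1 \<rho> ! r1 (fst (fst (g r)))) (snd (fst (g r))) (fst (snd (g r))) i)
          (\<lambda>r j. right_candidate K I T (F (take n1 \<rho>)) (take n1 \<rho> ! r2 (fst (fst (g r)))) (snd (fst (g r))) (snd (snd (g r))) j) c)))"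
    proof (rule solvable_mono)
      fix T \<rho>
      assume *: "SR T (take n1 \<rho>) \<and> (\<forall>g\<in>{..<R} \<rightarrow>\<^sub>E ({..<Q} \<times> {..<Q}) \<times> ({..<J} \<times> {..<I}). \<not> (\<exists>c. decomposes I J K R T
          (\<lambda>r i. left_candidate K J T (F (take n1 \<rho>)) (take n1 \<rho> ! r1 (fst (fst (g r)))) (snd (fst (g r))) (fst (snd (g r))) i)
          (\<lambda>r j. right_candidate K I T (F (take n1 \<rho>)) (take n1 \<rho> ! r2 (fst (fst (g r)))) (snd (fst (g r))) (snd (snd (g r))) j) c))"
      define \<tau> where "\<tau> = take n1 \<rho>"
      have SR: "SR T \<tau>" using * by (simp add: \<tau>_def)
      have "\<not> separated I J K R m l Q st T"
      proof
        assume sep: "separated I J K R m l Q st T"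
        obtain X D E where X: "is_gevd (pencil K N Q (W \<tau>) s t) (pencil K N Q (W \<tau>) t t) X D E"
          and F: "F \<tau> = recovered_points K N Q (W \<tau>) X t"
          using SL_SF[OF SR_SL[OF SR]] by (auto simp: SF_def)
        have basis: "is_null_basis (kernel_system I J K m l T) (W \<tau>)"
          by (rule B_basis[OF SF_B[OF SL_SF[OF SR_SL[OF SR]]]])
        obtain a b c S xs where tf: "tensor_frame I J K R m l Q T a b c S xs"
          and pts: "\<forall>p<Q. \<exists>q<Q. \<exists>\<mu>. \<mu> \<noteq> 0 \<and> (\<forall>k<K. F \<tau> $$ (k, q) = \<mu> * xs p k)"
          using separated_recovered_points[OF sep basis X[unfolded N_def s_def t_def]]
          unfolding F N_def s_def t_def by blast
        have "\<exists>g\<in>{..<R} \<rightarrow>\<^sub>E ({..<Q} \<times> {..<Q}) \<times> ({..<J} \<times> {..<I}). \<exists>c. decomposes I J K R T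
          (\<lambda>r i. left_candidate K J T (F \<tau>) (\<tau> ! r1 (fst (fst (g r)))) (snd (fst (g r))) (fst (snd (g r))) i)
          (\<lambda>r j. right_candidate K I T (F \<tau>) (\<tau> ! r2 (fst (fst (g r)))) (snd (fst (g r))) (snd (snd (g r))) j) c"
          by (rule tensor_frame.candidates_exist[OF tf, where Nl="\<lambda>q. \<tau> ! r1 q" and Nr="\<lambda>q. \<tau> ! r2 q"])
            (use pts SR SR_SL[OF SR] in \<open>simp_all add: SR_def SL_def M_def\<close>)
        then show False using * unfolding \<tau>_def by blast
      qed
      moreover have "B T \<tau>" by (rule SF_B[OF SL_SF[OF SR_SL[OF SR]]])
      then have "P' T (take (K + 2) \<rho>)" using B_take[of n1 T \<rho>] by (simp add: \<tau>_def B_def n1_def)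
      ultimately show "P' T (take (K + 2) \<rho>) \<and> \<not> separated I J K R m l Q st T" by blast
    qed
  qed simp
  have stepR: "solvable ?G (n + 6 + 3 * Q) SL"
  proof (rule solvable_spans_kernels[where N=Q and nr=J and nc=I and f="\<lambda>q j i T \<rho>. M T \<rho> q i j"])
    fix q j i assume "q < Q" "j < J" "i < I"
    then show "computable (\<lambda>T \<rho>. length \<rho> = n + 6 + 3 * Q \<and> SL T \<rho>) (\<lambda>T \<rho>. M T \<rho> q i j)"
      by (intro compM) (auto simp: SL_SF)
  next
    let ?n = "n + 6 + 3 * Q"
    have eq: "?n + 3 * Q = n1" by (simp add: n1_def)
    show "solvable ?G (?n + 3 * Q) (\<lambda>T \<rho>. SL T (take ?n \<rho>) \<and>
        (\<forall>q<Q. spans_kernel (mat J I (\<lambda>(j, i). M T (take ?n \<rho>) q i j)) (\<rho> ! (?n + 3 * q + 2))))"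
      unfolding eq
    proof (rule solvable_mono[OF search])
      fix T \<rho> assume len: "length \<rho> = n1" and *: "SL T (take ?n \<rho>) \<and>
        (\<forall>q<Q. spans_kernel (mat J I (\<lambda>(j, i). M T (take ?n \<rho>) q i j)) (\<rho> ! (?n + 3 * q + 2)))"
      have M: "M T (take ?n \<rho>) = M T \<rho>" by (rule M_take) simp
      have "SR T \<rho>" unfolding SR_def r2_def using *[unfolded M] SL_take[of ?n T \<rho>] by simp
      then show "SR T (take n1 \<rho>)" using len by simp
    qed
  qed
  have stepL: "solvable ?G (n + 6) SF"
  proof (rule solvable_spans_kernels[where N=Q and nr=I and nc=J and f="\<lambda>q i j T \<rho>. M T \<rho> q i j"])
    fix q i j assume "q < Q" "i < I" "j < J"
    then show "computable (\<lambda>T \<rho>. length \<rho> = n + 6 \<and> SF T \<rho>) (\<lambda>T \<rho>. M T \<rho> q i j)"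
      by (intro compM) auto
  next
    show "solvable ?G (n + 6 + 3 * Q) (\<lambda>T \<rho>. SF T (take (n + 6) \<rho>) \<and>
        (\<forall>q<Q. spans_kernel (mat I J (\<lambda>(i, j). M T (take (n + 6) \<rho>) q i j)) (\<rho> ! (n + 6 + 3 * q + 2))))"
    proof (rule solvable_mono[OF stepR])
      fix T \<rho> assume *: "SF T (take (n + 6) \<rho>) \<and>
        (\<forall>q<Q. spans_kernel (mat I J (\<lambda>(i, j). M T (take (n + 6) \<rho>) q i j)) (\<rho> ! (n + 6 + 3 * q + 2)))"
      have M: "M T (take (n + 6) \<rho>) = M T \<rho>" by (rule M_take) simp
      show "SL T \<rho>" unfolding SL_def r1_def using *[unfolded M] SF_take[of "n + 6" T \<rho>] by simp
    qed
  qed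
  have compW: "computable P (\<lambda>T \<rho>. W \<rho> $$ (k * K ^ N + d, q))"
    if "\<And>T \<rho>. P T \<rho> \<Longrightarrow> n \<le> length \<rho> \<and> B T \<rho>" "k < K" "d < K ^ N" "q < Q" for P k d q
    unfolding W_def
  proof (rule computable_entry)
    fix T \<rho> assume "P T \<rho>"
    from that(1)[OF this] show "K + 1 < length \<rho> \<and> k * K ^ N + d < dim_row (\<rho> ! (K + 1)) \<and> q < dim_col (\<rho> ! (K + 1))"
      using dimW[of T \<rho>] digits_less[OF that(2,3)] that(4) n by (simp add: W_def)
  qed
  have comp_moment: "computable P (\<lambda>T \<rho>. moment r k)" for P r k
    unfolding moment_def by (rule computable_of_nat)
  have comp_pencil: "computable P (\<lambda>T \<rho>. \<Sum>d<K ^ N. contract_first K N (W \<rho>) t d q * contract_first K N (W \<rho>) r d q')"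
    if "\<And>T \<rho>. P T \<rho> \<Longrightarrow> n \<le> length \<rho> \<and> B T \<rho>" "q < Q" "q' < Q" for P r q q'
    unfolding contract_first_def
    by (intro computable_sum computable_mult comp_moment compW that) auto
  have stepF: "solvable ?G (n + 5) SX"
  proof (rule solvable_compute[where nr=K and nc=Q and
      f="\<lambda>k q T \<rho>. \<Sum>q'<Q. contract_rest K N (W \<rho>) t k q' * (\<rho> ! (n + 2)) $$ (q', q)"])
    fix k q assume kq: "k < K" "q < Q"
    have "computable (\<lambda>T \<rho>. length \<rho> = n + 5 \<and> SX T \<rho>) (\<lambda>T \<rho>. (\<rho> ! (n + 2)) $$ (q', q))" if "q' < Q" for q'
      by (rule computable_entry) (use that kq in \<open>auto simp: SX_def is_gevd_def pencil_def\<close>)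
    then show "computable (\<lambda>T \<rho>. length \<rho> = n + 5 \<and> SX T \<rho>)
        (\<lambda>T \<rho>. \<Sum>q'<Q. contract_rest K N (W \<rho>) t k q' * (\<rho> ! (n + 2)) $$ (q', q))"
      unfolding contract_rest_def power_entry_def
      by (intro computable_sum computable_mult computable_prod comp_moment compW kq) (auto simp: SX_def)
  next
    show "solvable ?G (Suc (n + 5)) (\<lambda>T \<rho>. SX T (take (n + 5) \<rho>) \<and> \<rho> ! (n + 5) =
        mat K Q (\<lambda>(k, q). \<Sum>q'<Q. contract_rest K N (W (take (n + 5) \<rho>)) t k q' * (take (n + 5) \<rho> ! (n + 2)) $$ (q', q)))"
    proof (rule solvable_mono)
      show "solvable ?G (Suc (n + 5)) SF" using stepL by (simp add: eval_nat_numeral)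
      fix T \<rho> assume *: "SX T (take (n + 5) \<rho>) \<and> \<rho> ! (n + 5) =
        mat K Q (\<lambda>(k, q). \<Sum>q'<Q. contract_rest K N (W (take (n + 5) \<rho>)) t k q' * (take (n + 5) \<rho> ! (n + 2)) $$ (q', q))"
      have W: "W (take (n + 5) \<rho>) = W \<rho>" by (rule W_take) simp
      have X: "take (n + 5) \<rho> ! (n + 2) = \<rho> ! (n + 2)" by simp
      have "F \<rho> = recovered_points K N Q (W \<rho>) (\<rho> ! (n + 2)) t"
        using * unfolding W X F_def recovered_points_def by blast
      then show "SF T \<rho>"
        using *[THEN conjunct1] B_take[of "n + 5" T \<rho>] unfolding SX_def SF_def W X by auto
    qed
  qed
  define SG where "SG T \<rho> \<longleftrightarrow> B T \<rho> \<and> \<rho> ! n = pencil K N Q (W \<rho>) s t" for T \<rho>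
  define SH where "SH T \<rho> \<longleftrightarrow> SG T \<rho> \<and> \<rho> ! (n + 1) = pencil K N Q (W \<rho>) t t" for T \<rho>
  have SG_take: "SG T (take k \<rho>) \<longleftrightarrow> SG T \<rho>" if "n + 1 \<le> k" for k T \<rho>
    using that by (simp add: SG_def B_take W_take)
  have SH_take: "SH T (take k \<rho>) \<longleftrightarrow> SH T \<rho>" if "n + 2 \<le> k" for k T \<rho>
    using that by (simp add: SH_def SG_take W_take)
  have stepX: "solvable ?G (n + 2) SH"
  proof (rule solvable_gevd[where x=n and y="n + 1"])
    fix T \<rho> assume SH: "SH T \<rho>"
    then have B: "B T \<rho>" by (simp add: SH_def SG_def)
    show "\<exists>X D E. is_gevd (\<rho> ! n) (\<rho> ! (n + 1)) X D E"
      using framed_gevd_exists[OF B_framed[OF B] B_basis[OF B], where s=s and t=t] SH by (simp add: SH_def SG_def N_def)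
  next
    show "solvable ?G (n + 2 + 3) (\<lambda>T \<rho>. SH T (take (n + 2) \<rho>) \<and>
        is_gevd (\<rho> ! n) (\<rho> ! (n + 1)) (\<rho> ! (n + 2)) (\<rho> ! (n + 2 + 1)) (\<rho> ! (n + 2 + 2)))"
    proof (rule solvable_mono)
      show "solvable ?G (n + 2 + 3) SX" using stepF by (simp add: eval_nat_numeral)
      fix T \<rho> assume *: "SH T (take (n + 2) \<rho>) \<and>
        is_gevd (\<rho> ! n) (\<rho> ! (n + 1)) (\<rho> ! (n + 2)) (\<rho> ! (n + 2 + 1)) (\<rho> ! (n + 2 + 2))"
      then have "B T \<rho>" and pencil: "\<rho> ! n = pencil K N Q (W \<rho>) s t" "\<rho> ! (n + 1) = pencil K N Q (W \<rho>) t t"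
        using SH_take[of "n + 2" T \<rho>] by (simp_all add: SH_def SG_def)
      then show "SX T \<rho>" unfolding SX_def using *[unfolded pencil] by blast
    qed
  qed auto
  have stepH: "solvable ?G (Suc n) SG"
  proof (rule solvable_compute[where nr=Q and nc=Q and
      f="\<lambda>q q' T \<rho>. \<Sum>d<K ^ N. contract_first K N (W \<rho>) t d q * contract_first K N (W \<rho>) t d q'"])
    fix q q' assume "q < Q" "q' < Q"
    then show "computable (\<lambda>T \<rho>. length \<rho> = Suc n \<and> SG T \<rho>)
        (\<lambda>T \<rho>. \<Sum>d<K ^ N. contract_first K N (W \<rho>) t d q * contract_first K N (W \<rho>) t d q')"
      by (intro comp_pencil) (auto simp: SG_def)
  next
    show "solvable ?G (Suc (Suc n)) (\<lambda>T \<rho>. SG T (take (Suc n) \<rho>) \<and> \<rho> ! Suc n = mat Q Q (\<lambda>(q, q').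
        \<Sum>d<K ^ N. contract_first K N (W (take (Suc n) \<rho>)) t d q * contract_first K N (W (take (Suc n) \<rho>)) t d q'))"
      by (rule solvable_mono[OF stepX[unfolded add_2_eq_Suc']])
        (simp add: SH_def SG_take W_take pencil_def)
  qed
  show ?thesis
  proof (rule solvable_compute[where nr=Q and nc=Q and
      f="\<lambda>q q' T \<rho>. \<Sum>d<K ^ N. contract_first K N (W \<rho>) t d q * contract_first K N (W \<rho>) s d q'"])
    fix q q' assume "q < Q" "q' < Q"
    then show "computable (\<lambda>T \<rho>. length \<rho> = n \<and> P' T (take (K + 2) \<rho>))
        (\<lambda>T \<rho>. \<Sum>d<K ^ N. contract_first K N (W \<rho>) t d q * contract_first K N (W \<rho>) s d q')"
      by (intro comp_pencil) (auto simp: B_def)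
  next
    show "solvable ?G (Suc n) (\<lambda>T \<rho>. P' T (take (K + 2) (take n \<rho>)) \<and> \<rho> ! n = mat Q Q (\<lambda>(q, q').
        \<Sum>d<K ^ N. contract_first K N (W (take n \<rho>)) t d q * contract_first K N (W (take n \<rho>)) s d q'))"
    proof (rule solvable_mono[OF stepH])
      fix T \<rho> assume *: "P' T (take (K + 2) (take n \<rho>)) \<and> \<rho> ! n = mat Q Q (\<lambda>(q, q').
        \<Sum>d<K ^ N. contract_first K N (W (take n \<rho>)) t d q * contract_first K N (W (take n \<rho>)) s d q')"
      have W: "W (take n \<rho>) = W \<rho>" by (rule W_take) simp
      show "SG T \<rho>" using * B_take[of n T \<rho>] unfolding SG_def W pencil_def by (simp add: B_def)
    qed
  qed
qed

lemma solvable_framed: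
  assumes m: "0 < m" and K: "0 < K"
  shows "solvable (is_cpd I J K) K (\<lambda>T \<rho>. framed I J K R m l Q T \<and> slices I J K T \<rho>)"
proof -
  let ?G = "is_cpd I J K" and ?ks = "kernel_system I J K m l"
  define P where "P T \<rho> \<longleftrightarrow> framed I J K R m l Q T \<and> slices I J K T \<rho> \<and> is_null_basis (?ks T) (\<rho> ! (K + 1))" for T \<rho>
  have search: "solvable ?G (K + 2) (\<lambda>T \<rho>. P T (take (K + 2) \<rho>))"
  proof (rule solvable_search[where n0="K + 2" and P=P and A="{..Q * Q * K} \<times> {..Q * Q * K}" and
        good="\<lambda>st T \<rho>. separated I J K R m l Q st T"])
    fix st n P' assume "K + 2 \<le> n" "\<And>T \<rho>. P' T \<rho> \<Longrightarrow> P T \<rho>"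
      "\<And>n'. n \<le> n' \<Longrightarrow> solvable ?G n' (\<lambda>T \<rho>. P' T (take (K + 2) \<rho>) \<and> \<not> separated I J K R m l Q st T)"
    then show "solvable ?G n (\<lambda>T \<rho>. P' T (take (K + 2) \<rho>))"
      by (intro solvable_pencil[where st=st]) (auto simp: P_def)
  next
    fix n'
    show "solvable ?G n' (\<lambda>T \<rho>. P T (take (K + 2) \<rho>) \<and>
        (\<forall>st\<in>{..Q * Q * K} \<times> {..Q * Q * K}. \<not> separated I J K R m l Q st T))"
    proof (rule solvable_impossible)
      fix T \<rho>
      show "\<not> (P T (take (K + 2) \<rho>) \<and> (\<forall>st\<in>{..Q * Q * K} \<times> {..Q * Q * K}. \<not> separated I J K R m l Q st T))"
      proof
        assume *: "P T (take (K + 2) \<rho>) \<and> (\<forall>st\<in>{..Q * Q * K} \<times> {..Q * Q * K}. \<not> separated I J K R m l Q st T)"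
        then obtain a b c S xs where tf: "tensor_frame I J K R m l Q T a b c S xs"
          unfolding P_def framed_def by blast
        obtain s t where st: "s \<le> Q * Q * K" "t \<le> Q * Q * K" "separates K Q xs s t"
          using tensor_frame.separates_exists[OF tf] by blast
        have "separated I J K R m l Q (s, t) T" unfolding separated_def fst_conv snd_conv using tf st(3) by blast
        moreover have "(s, t) \<in> {..Q * Q * K} \<times> {..Q * Q * K}" using st by simp
        ultimately show False using * by blast
      qed
    qed
  qed simp_all
  show ?thesis
  proof (rule solvable_compute[where nr="I ^ (m + l) * J ^ (m + l) + K ^ (m + l)" and nc="K ^ (m + l)" and
      f="\<lambda>x c T \<rho>. ?ks T $$ (x, c)"])
    fix x c assume "x < I ^ (m + l) * J ^ (m + l) + K ^ (m + l)" "c < K ^ (m + l)"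
    then show "computable (\<lambda>T \<rho>. length \<rho> = K \<and> framed I J K R m l Q T \<and> slices I J K T \<rho>) (\<lambda>T \<rho>. ?ks T $$ (x, c))"
      by (intro computable_kernel_system computable_slices m K) auto
  next
    let ?P = "\<lambda>T \<rho>. (framed I J K R m l Q T \<and> slices I J K T (take K \<rho>)) \<and>
      \<rho> ! K = mat (I ^ (m + l) * J ^ (m + l) + K ^ (m + l)) (K ^ (m + l)) (\<lambda>(x, c). ?ks T $$ (x, c))"
    have ks: "mat (I ^ (m + l) * J ^ (m + l) + K ^ (m + l)) (K ^ (m + l)) (\<lambda>(x, c). ?ks T $$ (x, c)) = ?ks T" for T
      by (intro eq_matI) (simp_all add: dim_kernel_system)
    show "solvable ?G (Suc K) ?P"
    proof (rule solvable_null_basis[where x=K])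
      show "solvable ?G (Suc (Suc K)) (\<lambda>T \<rho>. ?P T (take (Suc K) \<rho>) \<and> is_null_basis (\<rho> ! K) (\<rho> ! Suc K))"
      proof (rule solvable_mono[OF search[unfolded add_2_eq_Suc']])
        fix T \<rho> assume len: "length \<rho> = Suc (Suc K)"
          and *: "?P T (take (Suc K) \<rho>) \<and> is_null_basis (\<rho> ! K) (\<rho> ! Suc K)"
        have "slices I J K T (take K (take (Suc K) \<rho>))" using * by blast
        then have "slices I J K T \<rho>" by (simp add: slices_take)
        moreover have "\<rho> ! K = ?ks T" using * unfolding ks by simp
        ultimately show "P T (take (Suc (Suc K)) \<rho>)" using * len by (simp add: P_def)
      qed
    qed simp
  qed
qed

text \<open>A matrix of rank one is found from a row and a column that meet in a nonzero entry.\<close>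

lemma solvable_rank_one:
  "solvable (is_cpd I J 1) 1 (\<lambda>T \<rho>. tensor_rank I J 1 T = 1 \<and> slices I J 1 T \<rho> \<and>
    (\<exists>a b c. decomposes I J 1 1 T a b c))"
proof -
  let ?G = "is_cpd I J 1"
  define P where "P T \<rho> \<longleftrightarrow> tensor_rank I J 1 T = 1 \<and> slices I J 1 T \<rho> \<and> (\<exists>a b c. decomposes I J 1 1 T a b c)" for T \<rho>
  let ?good = "\<lambda>g T. \<exists>c. decomposes I J 1 1 T (\<lambda>r i. T i (snd g) 0) (\<lambda>r j. T (fst g) j 0) c"
  have compT: "computable (\<lambda>T \<rho>. length \<rho> = 1 \<and> P T \<rho>) (\<lambda>T \<rho>. T i j k)" if "i < I" "j < J" "k < 1" for i j k
    by (rule computable_slices[OF _ that]) (simp add: P_def)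
  have good: "\<exists>g\<in>{..<I} \<times> {..<J}. ?good g T" if "P T \<rho>" for T \<rho>
  proof -
    obtain a b c where "decomposes I J 1 1 T a b c" using \<open>P T \<rho>\<close> by (auto simp: P_def)
    then have abc: "T i j 0 = a 0 i * b 0 j * c 0 0" if "i < I" "j < J" for i j
      using that by (simp add: decomposes_def)
    have "\<exists>i0<I. \<exists>j0<J. T i0 j0 0 \<noteq> 0"
    proof (rule ccontr)
      assume "\<not> ?thesis"
      then have "is_pd I J 1 0 T (mat I 0 (\<lambda>_. 0)) (mat J 0 (\<lambda>_. 0)) (mat 1 0 (\<lambda>_. 0))"
        by (simp add: is_pd_def)
      then have "\<exists>A B C. is_pd I J 1 0 T A B C" by blast
      then have "tensor_rank I J 1 T \<le> 0" unfolding tensor_rank_def by (rule Least_le)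
      then show False using \<open>P T \<rho>\<close> by (simp add: P_def)
    qed
    then obtain i0 j0 where ij: "i0 < I" "j0 < J" "T i0 j0 0 \<noteq> 0" by blast
    have "decomposes I J 1 1 T (\<lambda>r i. T i j0 0) (\<lambda>r j. T i0 j 0) (\<lambda>r k. 1 / T i0 j0 0)"
      unfolding decomposes_def using ij by (simp add: abc field_simps)
    then show ?thesis using ij by (intro bexI[of _ "(i0, j0)"]) auto
  qed
  have "solvable ?G 1 (\<lambda>T \<rho>. P T (take 1 \<rho>))"
  proof (rule solvable_search[where n0=1 and P=P and A="{..<I} \<times> {..<J}" and good="\<lambda>g T \<rho>. ?good g T"])
    fix g n P' assume g: "g \<in> {..<I} \<times> {..<J}" and n: "1 \<le> n" and P': "\<And>T \<rho>. P' T \<rho> \<Longrightarrow> P T \<rho>"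
      and fb: "\<And>n'. n \<le> n' \<Longrightarrow> solvable ?G n' (\<lambda>T \<rho>. P' T (take 1 \<rho>) \<and> \<not> ?good g T)"
    show "solvable ?G n (\<lambda>T \<rho>. P' T (take 1 \<rho>))"
      by (rule solvable_third_factor[where P=P and \<alpha>="\<lambda>r i T \<rho>. T i (snd g) 0" and \<beta>="\<lambda>r j T \<rho>. T (fst g) j 0" and R=1,
            OF _ _ _ _ n P' fb]) (use g compT in \<open>auto simp: P_def\<close>)
  next
    fix n'
    show "solvable ?G n' (\<lambda>T \<rho>. P T (take 1 \<rho>) \<and> (\<forall>g\<in>{..<I} \<times> {..<J}. \<not> ?good g T))"
      by (rule solvable_impossible) (use good in blast)
  qed simp_all
  then show ?thesis by (rule solvable_mono) (simp add: P_def)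
qed

section \<open>Decompositions given by matrices\<close>

text \<open>\<open>K\<close> independent columns form a square matrix, so its rows are independent as well.\<close>

lemma general_position_if_k_rank:
  assumes C: "C \<in> carrier_mat K R" and k: "k_rank C = K"
  shows "general_position K R (\<lambda>r k. C $$ (k, r))"
  unfolding general_position_def
proof (intro allI impI)
  fix S x assume S: "S \<subseteq> {..<R}" "card S = K" and zero: "\<forall>r\<in>S. form K (\<lambda>r k. C $$ (k, r)) r x = 0"
  let ?ranks = "{k. k \<le> dim_col C \<and> (\<forall>S \<subseteq> {..<dim_col C}. card S = k \<longrightarrow> cols_indpt C S)}"
  have fin: "finite ?ranks" by (rule finite_subset[of _ "{..dim_col C}"]) auto
  have "cols_indpt C {}"
  proof -
    interpret vec_space "TYPE(real)" "dim_row C" .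
    have "\<not> lin_dep {}" unfolding lin_dep_def by auto
    then show ?thesis by (simp add: cols_indpt_def)
  qed
  then have "0 \<in> ?ranks" using finite_subset[of _ "{..<dim_col C}"] by auto
  then have "K \<in> ?ranks" using Max_in[OF fin] k unfolding k_rank_def by auto
  then have indpt: "cols_indpt C S" using S C by auto
  obtain e where e: "bij_betw e {..<K} S"
    using ex_bij_betw_nat_finite[of S] S finite_subset[OF S(1)] by (auto simp: atLeast0LessThan)
  have eS: "e j \<in> S" if "j < K" for j using e that by (auto simp: bij_betw_def)
  have eR: "e j < R" if "j < K" for j using eS[OF that] S(1) by auto
  define D where "D = mat_of_cols K (map (\<lambda>j. col C (e j)) [0..<K])"
  have D: "D \<in> carrier_mat K K" by (auto simp: D_def intro: carrier_matI)
  have cols: "cols D = map (\<lambda>j. col C (e j)) [0..<K]"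
    unfolding D_def by (rule cols_mat_of_cols) (use C in auto)
  have colD: "col D j = col C (e j)" if "j < K" for j
    using arg_cong[OF cols, of "\<lambda>xs. xs ! j"] that D by simp
  have img: "col D ` {..<K} = col C ` S"
  proof -
    have "col D ` {..<K} = (\<lambda>j. col C (e j)) ` {..<K}" using colD by (intro image_cong) auto
    also have "\<dots> = col C ` S" using e by (simp add: bij_betw_def image_image[symmetric])
    finally show ?thesis .
  qed
  have "inj_on (col D) {..<K}"
  proof -
    have "inj_on (col C \<circ> e) {..<K}"
      using comp_inj_on[of e "{..<K}" "col C"] e indpt by (auto simp: cols_indpt_def bij_betw_def)
    then show ?thesis using colD by (simp add: inj_on_def)
  qed
  then have "full_column_rank D"
    using indpt D C img unfolding full_column_rank_def cols_indpt_def by simp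
  then have inj: "\<forall>c<K. (\<Sum>q<K. D $$ (c, q) * w q) = 0 \<Longrightarrow> q < K \<Longrightarrow> w q = 0" for w q
    using full_column_rank_indep[of D w q] D by simp
  have entry: "D $$ (i, j) = C $$ (i, e j)" if "i < K" "j < K" for i j
    using arg_cong[OF colD[OF that(2)], of "\<lambda>v. v $ i"] that D C eR by simp
  have "det (mat K K (\<lambda>(i, j). D $$ (i, j))) \<noteq> 0"
    unfolding det_zero_iff_kernel using inj by auto
  moreover have "mat K K (\<lambda>(i, j). D $$ (j, i)) = transpose_mat (mat K K (\<lambda>(i, j). D $$ (i, j)))"
    by (intro eq_matI) auto
  ultimately have det: "det (mat K K (\<lambda>(i, j). D $$ (j, i))) \<noteq> 0"
    by (simp only: det_transpose[OF mat_carrier] not_False_eq_True)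
  have "(\<Sum>j<K. D $$ (j, i) * x j) = 0" if i: "i < K" for i
    using zero[rule_format, OF eS[OF i]] entry i by (simp add: form_def)
  then show "\<not> nonzero K x" using det unfolding det_zero_iff_kernel by auto
qed

lemma khatri_rao_independent_if_full_column_rank:
  assumes A: "A \<in> carrier_mat I R" and B: "B \<in> carrier_mat J R" and fr: "full_column_rank (khatri_rao A B)"
  shows "khatri_rao_independent I J R (\<lambda>r i. A $$ (i, r)) (\<lambda>r j. B $$ (j, r))"
  unfolding khatri_rao_independent_def
proof (intro allI impI)
  fix w r assume zero: "\<forall>i<I. \<forall>j<J. (\<Sum>r<R. A $$ (i, r) * B $$ (j, r) * w r) = 0" and r: "r < R"
  have dims: "dim_row (khatri_rao A B) = I * J" "dim_col (khatri_rao A B) = R"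
    using A B by (simp_all add: khatri_rao_def)
  have entry: "khatri_rao A B $$ (x, r) = A $$ (x div J, r) * B $$ (x mod J, r)" if x: "x < I * J" and r: "r < R" for x r
  proof -
    have "x div J < I" "x mod J < J" using x by (auto simp: less_mult_imp_div_less intro!: mod_less_divisor gr0I)
    then show ?thesis using A B x r by (simp add: khatri_rao_def mat_of_cols_def kron_def)
  qed
  show "w r = 0"
  proof (rule full_column_rank_indep[OF fr, of w r])
    show "\<forall>x<dim_row (khatri_rao A B). (\<Sum>r<dim_col (khatri_rao A B). khatri_rao A B $$ (x, r) * w r) = 0"
      unfolding dims
    proof (intro allI impI)
      fix x assume x: "x < I * J"
      have "x div J < I" "x mod J < J" using x by (auto simp: less_mult_imp_div_less intro!: mod_less_divisor gr0I)
      then show "(\<Sum>r<R. khatri_rao A B $$ (x, r) * w r) = 0" using zero entry[OF x] by simp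
    qed
  qed (simp add: dims r)
qed

lemma decomposes_if_is_pd:
  "is_pd I J K R T A B C \<Longrightarrow> decomposes I J K R T (\<lambda>r i. A $$ (i, r)) (\<lambda>r j. B $$ (j, r)) (\<lambda>r k. C $$ (k, r))"
  by (simp add: is_pd_def decomposes_def)

lemma cpd_uniqueI:
  assumes rank: "tensor_rank I J K T = R"
    and same: "\<And>a' b' c'. decomposes I J K R T a' b' c' \<Longrightarrow> same_terms I J K R a b c a' b' c'"
  shows "cpd_unique I J K T"
  unfolding cpd_unique_def is_cpd_def rank
proof (intro allI impI)
  fix A B C A' B' C'
  assume *: "is_pd I J K R T A B C \<and> is_pd I J K R T A' B' C'"
  then have car: "A \<in> carrier_mat I R" "B \<in> carrier_mat J R" "C \<in> carrier_mat K R"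
    "A' \<in> carrier_mat I R" "B' \<in> carrier_mat J R" "C' \<in> carrier_mat K R" by (auto simp: is_pd_def)
  have "same_terms I J K R (\<lambda>r i. A $$ (i, r)) (\<lambda>r j. B $$ (j, r)) (\<lambda>r k. C $$ (k, r))
      (\<lambda>r i. A' $$ (i, r)) (\<lambda>r j. B' $$ (j, r)) (\<lambda>r k. C' $$ (k, r))"
    by (rule same_terms_sym_trans[OF same same]) (use * decomposes_if_is_pd in auto)
  then obtain \<pi> \<alpha> \<beta> \<gamma> where \<pi>: "\<pi> permutes {..<R}"
    and eq: "\<forall>r<R. \<alpha> r * \<beta> r * \<gamma> r = 1 \<and> (\<forall>i<I. A' $$ (i, r) = \<alpha> r * A $$ (i, \<pi> r)) \<and>
      (\<forall>j<J. B' $$ (j, r) = \<beta> r * B $$ (j, \<pi> r)) \<and> (\<forall>k<K. C' $$ (k, r) = \<gamma> r * C $$ (k, \<pi> r))"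
    unfolding same_terms_def by blast
  have col: "col M' r = s \<cdot>\<^sub>v col M (\<pi> r)"
    if "M \<in> carrier_mat n R" "M' \<in> carrier_mat n R" "r < R" "\<forall>i<n. M' $$ (i, r) = s * M $$ (i, \<pi> r)"
    for M M' :: "real mat" and n r s
  proof -
    have "\<pi> r < R" using permutes_in_image[OF \<pi>, of r] that(3) by simp
    then show ?thesis using that by (intro eq_vecI) auto
  qed
  show "\<exists>\<pi> \<alpha> \<beta> \<gamma>. \<pi> permutes {..<R} \<and> (\<forall>r<R. \<alpha> r * \<beta> r * \<gamma> r = 1 \<and> col A' r = \<alpha> r \<cdot>\<^sub>v col A (\<pi> r) \<and>
      col B' r = \<beta> r \<cdot>\<^sub>v col B (\<pi> r) \<and> col C' r = \<gamma> r \<cdot>\<^sub>v col C (\<pi> r))"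
    by (rule exI[of _ \<pi>], rule exI[of _ \<alpha>], rule exI[of _ \<beta>], rule exI[of _ \<gamma>])
      (use \<pi> eq col[OF car(1,4)] col[OF car(2,5)] col[OF car(3,6)] in simp)
qed

lemma tensor_rankI:
  assumes "is_pd I J K R T A B C" and "\<And>R' A B C. is_pd I J K R' T A B C \<Longrightarrow> R \<le> R'"
  shows "tensor_rank I J K T = R"
  unfolding tensor_rank_def by (rule Least_equality) (use assms in blast)+

lemma finds_cpdI:
  assumes "\<And>\<rho>. length \<rho> = K \<Longrightarrow> slices I J K T \<rho> \<Longrightarrow> all_runs alg \<rho> (is_cpd I J K T)"
  shows "finds_cpd alg I J K T"
  unfolding finds_cpd_def by (rule assms) (simp_all add: frontal_slices_def slices_def)

lemma rank_one_matches:
  assumes dec: "decomposes I J 1 1 T a b c" and ind: "khatri_rao_independent I J 1 a b" and c: "c 0 0 \<noteq> 0"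
  shows "\<And>R'. decomposes I J 1 R' T a' b' c' \<Longrightarrow> 1 \<le> R'"
    and "decomposes I J 1 1 T a' b' c' \<Longrightarrow> same_terms I J 1 1 a b c a' b' c'"
proof -
  have "\<exists>i0<I. \<exists>j0<J. a 0 i0 * b 0 j0 \<noteq> 0"
  proof (rule ccontr)
    assume "\<not> ?thesis"
    then have "\<forall>i<I. \<forall>j<J. (\<Sum>r<1. a r i * b r j * 1) = 0" by simp
    then have "\<forall>r<1::nat. (1 :: real) = 0"
      using ind[unfolded khatri_rao_independent_def, THEN spec, of "\<lambda>_. 1"] by blast
    then have "(1 :: real) = 0" by (elim allE[of _ 0]) simp
    then show False by simp
  qed
  then obtain i0 j0 where ij: "i0 < I" "j0 < J" "a 0 i0 * b 0 j0 \<noteq> 0" by blast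
  have T: "T i j 0 = a 0 i * b 0 j * c 0 0" if "i < I" "j < J" for i j
    using dec that by (simp add: decomposes_def)
  have nz: "T i0 j0 0 \<noteq> 0" using T ij c by simp
  show "1 \<le> R'" if "decomposes I J 1 R' T a' b' c'" for R'
    using that nz ij by (cases R') (auto simp: decomposes_def)
  assume dec': "decomposes I J 1 1 T a' b' c'"
  then have T': "T i j 0 = a' 0 i * b' 0 j * c' 0 0" if "i < I" "j < J" for i j
    using that by (simp add: decomposes_def)
  have nz': "a' 0 i0 \<noteq> 0" "b' 0 j0 \<noteq> 0" "c' 0 0 \<noteq> 0" using nz T'[OF ij(1,2)] by auto
  have ab: "a 0 i0 \<noteq> 0" "b 0 j0 \<noteq> 0" using ij(3) by auto
  have "a' 0 i = (b 0 j0 * c 0 0) / (b' 0 j0 * c' 0 0) * a 0 i" if "i < I" for i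
    using T[OF that ij(2)] T'[OF that ij(2)] nz' by (simp add: field_simps)
  moreover have "b' 0 j = (a 0 i0 * c 0 0) / (a' 0 i0 * c' 0 0) * b 0 j" if "j < J" for j
    using T[OF ij(1) that] T'[OF ij(1) that] nz' by (simp add: field_simps)
  ultimately have match: "\<exists>p \<alpha> \<beta>. p < (1::nat) \<and> \<alpha> \<noteq> 0 \<and> \<beta> \<noteq> 0 \<and> (\<forall>i<I. a' 0 i = \<alpha> * a p i) \<and> (\<forall>j<J. b' 0 j = \<beta> * b p j)"
    using ab nz' c by (intro exI[of _ "0::nat"] exI[of _ "(b 0 j0 * c 0 0) / (b' 0 j0 * c' 0 0)"]
        exI[of _ "(a 0 i0 * c 0 0) / (a' 0 i0 * c' 0 0)"]) simp
  show "same_terms I J 1 1 a b c a' b' c'"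
    by (rule same_termsI[OF dec dec' ind]) (use c match in auto)
qed

theorem theorem15:
  fixes I J K R m l :: nat
  assumes "1 \<le> K" and "K \<le> R" and "K = 1 \<longrightarrow> R = 1" and "m = R - K + 2"
  shows "\<exists>alg. \<forall>T A B C.
     is_pd I J K R T A B C \<and>
     vec_space.rank K C = K \<and>
     k_rank C = K \<and>
     full_column_rank (khatri_rao A B) \<and>
     subspace_dim (K ^ (m + l)) (mat_kernel (R_mat I J K m l T) \<inter> sym_space K (m + l))
       = R choose (K - 1)
     \<longrightarrow> tensor_rank I J K T = R \<and> cpd_unique I J K T \<and> finds_cpd alg I J K T"
proof (cases "K = 1")
  case True
  \<comment> \<open>For \<open>K = 1\<close> there are no two points of low rank to compare, but \<open>T\<close> is a matrix of rank one.\<close>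
  then have R: "R = 1" using assms(3) by simp
  obtain alg where alg: "\<And>T \<rho>. length \<rho> = 1 \<Longrightarrow> tensor_rank I J 1 T = 1 \<and> slices I J 1 T \<rho> \<and>
      (\<exists>a b c. decomposes I J 1 1 T a b c) \<Longrightarrow> all_runs alg \<rho> (is_cpd I J 1 T)"
    using solvable_rank_one[of I J] unfolding solvable_def by blast
  show ?thesis
    unfolding True R
  proof (intro exI[of _ alg] allI impI, elim conjE)
    fix T A B C
    assume pd: "is_pd I J 1 1 T A B C" and k: "k_rank C = 1" and fr: "full_column_rank (khatri_rao A B)"
    have car: "A \<in> carrier_mat I 1" "B \<in> carrier_mat J 1" "C \<in> carrier_mat 1 1" using pd by (auto simp: is_pd_def)
    note dec = decomposes_if_is_pd[OF pd]
    note ind = khatri_rao_independent_if_full_column_rank[OF car(1,2) fr]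
    have "nonzero 1 (\<lambda>k. C $$ (k, 0))"
      using general_position_nonzero[OF general_position_if_k_rank[OF car(3) k], of 0] by simp
    then have c: "C $$ (0, 0) \<noteq> 0" by simp
    note matches = rank_one_matches[OF dec ind c]
    have rank: "tensor_rank I J 1 T = 1"
      by (rule tensor_rankI[OF pd]) (use matches(1)[OF decomposes_if_is_pd] in blast)
    moreover have "cpd_unique I J 1 T" by (rule cpd_uniqueI[OF rank matches(2)])
    moreover have "finds_cpd alg I J 1 T" by (rule finds_cpdI, rule alg) (use rank dec in auto)
    ultimately show "tensor_rank I J 1 T = 1 \<and> cpd_unique I J 1 T \<and> finds_cpd alg I J 1 T" by blast
  qed
next
  case False
  then have K2: "2 \<le> K" and K: "0 < K" and m: "0 < m" using assms by auto
  let ?Q = "R choose (K - 1)"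
  obtain alg where alg: "\<And>T \<rho>. length \<rho> = K \<Longrightarrow> framed I J K R m l ?Q T \<and> slices I J K T \<rho> \<Longrightarrow>
      all_runs alg \<rho> (is_cpd I J K T)"
    using solvable_framed[OF m K, of I J R l ?Q] unfolding solvable_def by blast
  show ?thesis
  proof (intro exI[of _ alg] allI impI, elim conjE)
    fix T A B C
    assume pd: "is_pd I J K R T A B C" and k: "k_rank C = K" and fr: "full_column_rank (khatri_rao A B)"
      and dim: "subspace_dim (K ^ (m + l)) (mat_kernel (R_mat I J K m l T) \<inter> sym_space K (m + l)) = ?Q"
    have car: "A \<in> carrier_mat I R" "B \<in> carrier_mat J R" "C \<in> carrier_mat K R" using pd by (auto simp: is_pd_def)
    note dec = decomposes_if_is_pd[OF pd]
    note gp = general_position_if_k_rank[OF car(3) k]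
    note ind = khatri_rao_independent_if_full_column_rank[OF car(1,2) fr]
    obtain S xs where frame: "tensor_frame I J K R m l ?Q T (\<lambda>r i. A $$ (i, r)) (\<lambda>r j. B $$ (j, r)) (\<lambda>r k. C $$ (k, r)) S xs"
      using tensor_frame_exists[OF K2 assms(2,4) gp dec refl, of l] dim
      unfolding mat_kernel_kernel_system[OF K] by blast
    interpret tensor_frame I J K R m l ?Q T "\<lambda>r i. A $$ (i, r)" "\<lambda>r j. B $$ (j, r)" "\<lambda>r k. C $$ (k, r)" S xs
      by (rule frame)
    have rank: "tensor_rank I J K T = R"
    proof (rule tensor_rankI[OF pd])
      fix R' A' B' C' assume "is_pd I J K R' T A' B' C'"
      from decomposition_length_and_position[OF dec decomposes_if_is_pd[OF this]]
      show "R \<le> R'" by (cases "R' \<le> R") auto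
    qed
    moreover have "cpd_unique I J K T"
      by (rule cpd_uniqueI[OF rank decomposition_unique[OF dec ind]])
    moreover have "framed I J K R m l ?Q T" unfolding framed_def using rank frame by blast
    then have "finds_cpd alg I J K T" by (intro finds_cpdI alg) blast+
    ultimately show "tensor_rank I J K T = R \<and> cpd_unique I J K T \<and> finds_cpd alg I J K T" by blast
  qed
qed

end
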